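(* Let $\nu\in\mathbb{C}$ be fixed, with $\nu$ not a half-integer (i.e. $\nu-\tfrac12\notin\mathbb{Z}$), and let $M$ be a positive integer. For $x>0$ let $m_o=m_o(x)$ be the optimal truncation index of the dominant series $\sum_k (-1)^k a_k(\nu)x^{-k}$, a positive integer satisfying $m_o\simeq 2x$, in the sense that $m_o-2x$ stays bounded as $x\to+\infty$. Then, taking either all upper signs or all lower signs, $$K_\nu(xe^{\pm\pi i})=\mp i\sqrt{\frac{\pi}{2x}}\,e^x\sum_{k=0}^{m_o-1}\frac{(-1)^k a_k(\nu)}{x^k}+2\cos\pi\nu\,\sqrt{\frac{\pi}{2x}}\,e^{-x}\left\{\frac12\sum_{k=0}^{M-1}\frac{a_k(\nu)}{x^k}\mp\frac{i}{2\sqrt{\pi x}}\sum_{j=0}^{M-1}\frac{(-1)^jB_j}{(2x)^j}+O(x^{-M})\right\}$$ as $x\to+\infty$, where the coefficients $a_k(\nu)$ and $B_j$ (the latter depending on $\nu$ and on $m_o-2x$) are those defined in the context.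
   Context: $K_\nu(z)$ is the modified Bessel function of the second kind; $K_\nu(xe^{\pm\pi i})$, $x>0$, denotes the value obtained by analytic continuation from the positive real axis ($\arg z=0$) to $\arg z=\pm\pi$, $|z|=x$. $(a)_k=\Gamma(a+k)/\Gamma(a)=a(a+1)\cdots(a+k-1)$ is the Pochhammer symbol, with $(a)_0=1$. Coefficients: for $k,j\ge 0$, $$a_k(\nu)=\frac{(-1)^k}{2^k k!}(\tfrac12+\nu)_k(\tfrac12-\nu)_k,\qquad A_j=\frac{(\tfrac12-\nu)_j(\tfrac12+\nu)_j}{j!}=(-2)^j a_j(\nu),$$ $$B_j=\sum_{k=0}^j(-2)^k(\tfrac12)_k\,A_{j-k}\,g_{2k}(j-k).$$ Here, with $\gamma_j=m_o-2x-j$ (a bounded quantity for each fixed $j$), the numbers $g_k(j)$ are defined by the expansion about $w=0$ $$\frac{\tau^{\gamma_j-1}}{1-\tau}\,\frac{d\tau}{dw}=-\frac1w+\sum_{k=0}^\infty g_k(j)w^k,\qquad \tfrac12w^2=\tau-\log\tau-1,$$ where the branch of $w(\tau)$ is chosen such that $w\sim\tau-1$ as $\tau\to1$, so that $\tau=1+w+\tfrac13w^2+\tfrac1{36}w^3-\cdots$. For example $g_0(j)=\tfrac23-\gamma_j$. The optimal truncation index means truncation of the series at, or near, its term of least magnitude; thus $m_o=2x+\alpha$ with $\alpha$ bounded (for instance $|\alpha|\le\tfrac12$). *)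

theory Defs
  imports "HOL-Analysis.Analysis" "HOL-Library.Landau_Symbols"
begin

text \<open>
  The modified Bessel function of the second kind on the positive real axis, by the integral
  \<open>\<integral>\<^sub>0\<^sup>\<infinity> exp (- x cosh t) cosh (\<nu> t) dt\<close>. It converges absolutely for every complex order
  \<open>\<nu>\<close>, integers included, so no limit in \<open>\<nu>\<close> is needed.
\<close>

definition besselK :: "complex \<Rightarrow> real \<Rightarrow> complex" where
  "besselK \<nu> x =
     integral {0..} (\<lambda>t. exp (- of_real (x * cosh t)) * cosh (\<nu> * of_real t))"

text \<open>
  \<open>K\<^sub>\<nu>\<close> continues analytically from the positive axis to the whole Riemann surface of the
  logarithm. In the global coordinate \<open>\<zeta> = log z\<close> that surface is the complex plane, and the
  continuation is the unique entire function of \<open>\<zeta>\<close> that agrees with \<open>K\<^sub>\<nu> (exp t)\<close> at every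
  real \<open>\<zeta> = t\<close>.
\<close>

definition besselK_log :: "complex \<Rightarrow> complex \<Rightarrow> complex" where
  "besselK_log \<nu> =
     (THE F. F holomorphic_on UNIV \<and> (\<forall>t::real. F (of_real t) = besselK \<nu> (exp t)))"

text \<open>The value of the continuation at the point with modulus \<open>r\<close> and argument \<open>\<theta>\<close>,
  where \<open>\<theta>\<close> is not reduced modulo \<open>2 \<pi>\<close>.\<close>

definition besselK_polar :: "complex \<Rightarrow> real \<Rightarrow> real \<Rightarrow> complex" where
  "besselK_polar \<nu> r \<theta> = besselK_log \<nu> (Complex (ln r) \<theta>)"

definition coeff_a :: "complex \<Rightarrow> nat \<Rightarrow> complex" where
  "coeff_a \<nu> k =
     (-1) ^ k / (2 ^ k * fact k) * pochhammer (1/2 + \<nu>) k * pochhammer (1/2 - \<nu>) k"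

definition coeff_A :: "complex \<Rightarrow> nat \<Rightarrow> complex" where
  "coeff_A \<nu> j = pochhammer (1/2 - \<nu>) j * pochhammer (1/2 + \<nu>) j / fact j"

text \<open>
  \<open>\<tau>\<close> as an analytic function of \<open>w\<close> near \<open>w = 0\<close>. The asymptotic equivalence selects the branch
  \<open>\<tau> = 1 + w + w\<^sup>2 / 3 + \<dots>\<close> rather than \<open>\<tau> = 1 - w + w\<^sup>2 / 3 - \<dots>\<close>. Only the germ of \<open>\<tau>\<close> at
  \<open>0\<close> is determined.
\<close>

definition tau_branch :: "(complex \<Rightarrow> complex) \<Rightarrow> bool" where
  "tau_branch \<tau> \<longleftrightarrow>
     \<tau> analytic_on {0} \<and> \<tau> 0 = 1 \<and>
     (\<lambda>w. w) \<sim>[at 0] (\<lambda>w. \<tau> w - 1) \<and>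
     (\<forall>\<^sub>F w in nhds 0. w\<^sup>2 / 2 = \<tau> w - Ln (\<tau> w) - 1)"

text \<open>
  The coefficients of the regular part in
  \<open>\<tau> powr (\<gamma> - 1) / (1 - \<tau>) * d\<tau>/dw = - 1 / w + (\<Sum>k. g k * w ^ k)\<close> about \<open>w = 0\<close>.
\<close>

definition coeff_g :: "real \<Rightarrow> nat \<Rightarrow> complex" where
  "coeff_g \<gamma> =
     (THE g. \<exists>\<tau>. tau_branch \<tau> \<and>
        (\<forall>\<^sub>F w in at 0.
           (\<lambda>k. g k * w ^ k) sums
             (\<tau> w powr of_real (\<gamma> - 1) / (1 - \<tau> w) * deriv \<tau> w + 1 / w)))"

text \<open>The parameter \<open>\<alpha>\<close> is the offset \<open>m\<^sub>o - 2 x\<close> of the truncation index, so that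
  \<open>\<gamma>\<^sub>j = \<alpha> - j\<close>.\<close>

definition coeff_B :: "complex \<Rightarrow> real \<Rightarrow> nat \<Rightarrow> complex" where
  "coeff_B \<nu> \<alpha> j =
     (\<Sum>k=0..j. (-2) ^ k * pochhammer (1/2) k * coeff_A \<nu> (j - k)
                  * coeff_g (\<alpha> - real (j - k)) (2 * k))"

end

theory Submission
  imports Defs "HOL-Complex_Analysis.Complex_Analysis" "HOL-Probability.Probability"
begin

text \<open>
  Dividing \<open>cosh (\<nu> w) / cosh (w / 2)\<close> by powers of \<open>1 - cosh w\<close> with an integral remainder gives, for
  \<open>z > 0\<close>, the exact formula in which the remainder of the large-argument series of \<open>K\<^sub>\<nu>(z)\<close> after \<open>N\<close>
  terms is a Stieltjes transform of \<open>t powr (N - 1/2) * exp (- t) * K\<^sub>\<nu>(t)\<close>. Both sides continue to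
  \<open>\<bar>arg z\<bar> < \<pi>\<close>. With \<open>N = m\<close>, \<open>z \<rightarrow> x exp (\<plusminus>\<pi> i)\<close> and \<open>t = x \<tau>\<close> the remainder becomes, up to
  elementary factors, the boundary value of the integral of \<open>exp (- 2 x (\<tau> - log \<tau> - 1))\<close> against
  \<open>\<tau> powr (\<gamma> - 1) / (\<tau> - 1)\<close>, where \<open>K\<^sub>\<nu>(x \<tau>)\<close> is replaced by \<open>J\<close> terms of its own expansion and a
  remainder that is bounded and Lipschitz enough for the singular integral. Pole and saddle both lie at
  \<open>\<tau> = 1\<close>: half the residue produces the series in \<open>a\<^sub>k(\<nu>)\<close>, and the principal value, in the variable
  \<open>w\<close> with \<open>w\<^sup>2 / 2 = \<tau> - log \<tau> - 1\<close>, is a Gaussian integral of the regular part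
  \<open>\<Sum>k. g\<^sub>k w\<^sup>k\<close>, which produces the series in \<open>B\<^sub>j\<close>.
\<close>

text \<open>The obstacle is that the pole of the Stieltjes kernel reaches the path of integration
  just when arg z reaches +-pi, and does so at the saddle. Near the pole no estimate may take
  absolute values of the kernel. What stays uniform as the pole approaches the axis is the limit for
  a numerator with a known value at the pole, and the effect of a numerator that vanishes there.
  Hence the inner remainder has to be Lipschitz on the scale of x: its value at the pole is split
  off, and the rest need only be bounded, because it carries a factor x^(-J). The condition |Re
  \<nu>| < N + 1/2 is integrability at t = 0, where K_\<nu>(t) grows roughly like t^(-|Re \<nu>|).
  For large |Re \<nu>| it forces J beyond M, and the surplus terms go into the error. All bounds are
  uniform for \<gamma> in a bounded interval, since m_o - 2x moves with x. The value at arg z = +-pi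
  is a limit from inside the sector, by continuity of the entire function
  \<open>besselK_log\<close>.\<close>

section \<open>Integrals with a parameter, substitution and exchange of integrals\<close>

text \<open>Cauchy's estimate turns a local majorant of \<open>f\<close> into a majorant of its
  difference quotients, so dominated convergence differentiates under the integral. It is applied
  below in the variable \<zeta>, in the order \<nu> and in the argument of the Stieltjes
  transform.\<close>

lemma holomorphic_on_lebesgue_integral:
  fixes f :: "complex \<Rightarrow> 'a \<Rightarrow> complex"
  assumes hol: "\<And>t. t \<in> space M \<Longrightarrow> (\<lambda>z. f z t) holomorphic_on U"
    and meas: "\<And>z. z \<in> U \<Longrightarrow> f z \<in> borel_measurable M"
    and dom: "\<And>z. z \<in> U \<Longrightarrow> \<exists>r g. r > 0 \<and> ball z r \<subseteq> U \<and> integrable M g \<and>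
                 (\<forall>w\<in>ball z r. \<forall>t\<in>space M. norm (f w t) \<le> g t)"
  shows "(\<lambda>z. \<integral>t. f z t \<partial>M) holomorphic_on U"
proof -
  have "\<exists>D. ((\<lambda>z. \<integral>t. f z t \<partial>M) has_field_derivative D) (at z)" if z: "z \<in> U" for z
  proof -
    obtain r g where r: "r > 0" and sub: "ball z r \<subseteq> U" and g: "integrable M g"
      and bound: "\<And>w t. w \<in> ball z r \<Longrightarrow> t \<in> space M \<Longrightarrow> norm (f w t) \<le> g t"
      using dom[OF z] by blast
    define D where "D t = deriv (\<lambda>w. f w t) z" for t
    have int: "integrable M (f w)" if "w \<in> ball z r" for w
      using that sub bound by (intro Bochner_Integration.integrable_bound[OF g meas]) fastforce+
    have lip: "norm (f w t - f z t) \<le> 3 * g t / r * norm (w - z)"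
      if w: "w \<in> ball z (r/2)" and t: "t \<in> space M" for w t
    proof (rule field_differentiable_bound[where S = "ball z (r/2)" and f = "\<lambda>w. f w t"
            and f' = "deriv (\<lambda>w. f w t)"])
      fix y assume y: "y \<in> ball z (r/2)"
      \<comment> \<open>Since 1/2 + 1/3 < 1, Cauchy's estimate can use radius r/3; this is the
        source of the constant 3 / r.\<close>
      have cb: "cball y (r/3) \<subseteq> ball z r"
      proof
        fix x assume "x \<in> cball y (r/3)"
        then have "dist z x \<le> dist z y + dist y x" "dist y x \<le> r/3" "dist z y < r/2"
          using y by (auto simp: dist_triangle)
        with r show "x \<in> ball z r" by simp
      qed
      have h: "(\<lambda>w. f w t) holomorphic_on ball z r"
        using hol[OF t] sub holomorphic_on_subset by blast
      have "norm ((deriv ^^ 1) (\<lambda>w. f w t) y) \<le> fact 1 * g t / (r/3) ^ 1"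
        using r cb ball_subset_cball[of y "r/3"]
        by (intro Cauchy_inequality holomorphic_on_subset[OF h] holomorphic_on_imp_continuous_on bound t)
           (auto simp: dist_norm subset_iff)
      then show "norm (deriv (\<lambda>w. f w t) y) \<le> 3 * g t / r" by (simp add: field_simps)
      have "y \<in> ball z r" using y r by auto
      then show "((\<lambda>w. f w t) has_field_derivative deriv (\<lambda>w. f w t) y) (at y within ball z (r/2))"
        by (rule has_field_derivative_at_within[OF holomorphic_derivI[OF h open_ball]])
    qed (use w r in auto)
    have "((\<lambda>w. ((\<integral>t. f w t \<partial>M) - (\<integral>t. f z t \<partial>M)) / (w - z)) \<longlongrightarrow> (\<integral>t. D t \<partial>M)) (at z)"
      unfolding tendsto_at_iff_sequentially comp_def
    proof (intro allI impI)
      fix X :: "nat \<Rightarrow> complex"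
      assume X: "\<forall>i. X i \<in> UNIV - {z}" "X \<longlonglongrightarrow> z"
      \<comment> \<open>Only a tail of \<open>X\<close> lies in the half-size disc, so the sequence
        is shifted to have the majorant for every index.\<close>
      have "eventually (\<lambda>i. X i \<in> ball z (r/2)) sequentially"
        using r by (intro topological_tendstoD[OF X(2) open_ball]) auto
      then obtain N where N: "\<And>i. X (i + N) \<in> ball z (r/2)"
        by (meson eventually_at_top_linorder le_add2)
      have N': "X (i + N) \<in> ball z r" for i using N[of i] r by auto
      define s where "s i t = (f (X (i + N)) t - f z t) / (X (i + N) - z)" for i t
      have Xz: "(\<lambda>i. X (i + N)) \<longlonglongrightarrow> z" using X(2) by (rule LIMSEQ_ignore_initial_segment)
      have lim: "(\<lambda>i. s i t) \<longlonglongrightarrow> D t" if t: "t \<in> space M" for t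
      proof -
        have "((\<lambda>w. f w t) has_field_derivative D t) (at z)"
          unfolding D_def using r
          by (intro holomorphic_derivI[OF holomorphic_on_subset[OF hol[OF t] sub] open_ball]) auto
        then have "((\<lambda>w. (f w t - f z t) / (w - z)) \<longlongrightarrow> D t) (at z)"
          by (simp add: has_field_derivative_iff)
        then show ?thesis
          unfolding s_def tendsto_at_iff_sequentially comp_def using Xz X(1) by auto
      qed
      have smeas: "s i \<in> borel_measurable M" for i
        unfolding s_def using meas[of "X (i + N)"] N'[of i] sub meas[OF z] by auto
      have "(\<lambda>i. \<integral>t. s i t \<partial>M) \<longlonglongrightarrow> (\<integral>t. D t \<partial>M)"
      proof (rule integral_dominated_convergence[where w = "\<lambda>t. 3 * g t / r"])
        show "D \<in> borel_measurable M"
          by (rule borel_measurable_LIMSEQ_metric[OF smeas lim])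
        show "AE t in M. (\<lambda>i. s i t) \<longlonglongrightarrow> D t" using lim by auto
        show "AE t in M. norm (s i t) \<le> 3 * g t / r" for i
        proof (rule AE_I2)
          fix t assume t: "t \<in> space M"
          have "X (i + N) - z \<noteq> 0" using X(1) by auto
          with lip[OF N[of i] t] show "norm (s i t) \<le> 3 * g t / r"
            by (simp add: s_def norm_divide pos_divide_le_eq)
        qed
      qed (use smeas g in auto)
      moreover have "(\<integral>t. s i t \<partial>M) = ((\<integral>t. f (X (i+N)) t \<partial>M) - (\<integral>t. f z t \<partial>M)) / (X (i+N) - z)" for i
        unfolding s_def using int[OF N'] int[of z] r by simp
      ultimately show "(\<lambda>i. ((\<integral>t. f (X i) t \<partial>M) - (\<integral>t. f z t \<partial>M)) / (X i - z)) \<longlonglongrightarrow> (\<integral>t. D t \<partial>M)"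
        by (simp add: LIMSEQ_offset[of _ N])
    qed
    then show ?thesis unfolding has_field_derivative_iff by blast
  qed
  then show ?thesis
    unfolding holomorphic_on_def field_differentiable_def by (meson has_field_derivative_at_within)
qed

text \<open>For Borel data the completion of the measure changes nothing. This carries results on
  the gauge integral, such as the change of variables, over to \<open>lborel\<close>.\<close>

lemma absolutely_integrable_on_borel:
  fixes f :: "real \<Rightarrow> 'a::euclidean_space"
  assumes "S \<in> sets borel" and "set_borel_measurable borel S f"
  shows "f absolutely_integrable_on S \<longleftrightarrow> set_integrable lborel S f"
  using assms unfolding set_integrable_def set_borel_measurable_def
  by (subst integrable_completion) auto

lemma set_integral_substitution:
  fixes f :: "real \<Rightarrow> 'a::euclidean_space" and g g' :: "real \<Rightarrow> real"
  assumes S: "S \<in> sets borel" and T: "T \<in> sets borel" "bij_betw g S T"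
    and f: "set_borel_measurable borel T f" and fg: "set_borel_measurable borel S (\<lambda>x. \<bar>g' x\<bar> *\<^sub>R f (g x))"
    and deriv: "\<And>x. x \<in> S \<Longrightarrow> (g has_field_derivative g' x) (at x)"
  shows "set_integrable lborel T f \<longleftrightarrow> set_integrable lborel S (\<lambda>x. \<bar>g' x\<bar> *\<^sub>R f (g x))" (is ?A)
    and "(LINT x:T|lborel. f x) = (LINT x:S|lborel. \<bar>g' x\<bar> *\<^sub>R f (g x))" (is ?B)
proof -
  have S': "S \<in> sets lebesgue" using S by auto
  have inj: "inj_on g S" and im: "g ` S = T" using T(2) by (auto simp: bij_betw_def)
  have d: "(g has_field_derivative g' x) (at x within S)" if "x \<in> S" for x
    using deriv[OF that] has_field_derivative_at_within by blast
  note * = has_absolute_integral_change_of_variables_real[OF S' d inj, of f, unfolded im]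
  show A: ?A
    using absolutely_integrable_change_of_variables_real[OF S' d inj, of f, unfolded im]
    by (simp add: absolutely_integrable_on_borel[OF T(1) f] absolutely_integrable_on_borel[OF S fg])
  show ?B
  proof (cases "set_integrable lborel T f")
    case True
    then have "integral S (\<lambda>x. \<bar>g' x\<bar> *\<^sub>R f (g x)) = integral T f"
      using *[of "integral T f"] absolutely_integrable_on_borel[OF T(1) f] by auto
    with True A show ?thesis by (simp add: set_borel_integral_eq_integral)
  next
    \<comment> \<open>Integrability fails on both sides at once, and then both integrals have the
      default value 0.\<close>
    case False
    with A show ?thesis
      by (simp add: set_integrable_def set_lebesgue_integral_def not_integrable_integral_eq)
  qed
qed

text \<open>Every exchange of integrals below has a separated majorant, one integrable factor for
  each variable; joint integrability is then immediate.\<close>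

lemma Fubini_product_bound:
  fixes f :: "real \<Rightarrow> real \<Rightarrow> complex"
  assumes [measurable]: "case_prod f \<in> borel_measurable (lborel \<Otimes>\<^sub>M lborel)"
    and g: "integrable lborel g" and h: "integrable lborel h"
    and bound: "\<And>x y. norm (f x y) \<le> g x * h y"
  shows "(\<integral>y. (\<integral>x. f x y \<partial>lborel) \<partial>lborel) = (\<integral>x. (\<integral>y. f x y \<partial>lborel) \<partial>lborel)"
    and "integrable lborel (\<lambda>x. \<integral>y. f x y \<partial>lborel)"
    and "integrable lborel (\<lambda>y. \<integral>x. f x y \<partial>lborel)"
proof -
  note [measurable] = borel_measurable_integrable[OF g] borel_measurable_integrable[OF h]
  have "integrable (lborel \<Otimes>\<^sub>M lborel) (\<lambda>(x, y). g x * h y)"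
  proof (rule lborel_pair.Fubini_integrable)
    show "integrable lborel (\<lambda>x. \<integral>y. norm (case (x, y) of (x, y) \<Rightarrow> g x * h y) \<partial>lborel)"
      using g by (simp add: abs_mult)
    show "AE x in lborel. integrable lborel (\<lambda>y. case (x, y) of (x, y) \<Rightarrow> g x * h y)"
      using h by auto
  qed measurable
  then have int: "integrable (lborel \<Otimes>\<^sub>M lborel) (case_prod f)"
    by (rule Bochner_Integration.integrable_bound)
       (auto intro!: order.trans[OF bound] abs_ge_self)
  show "(\<integral>y. (\<integral>x. f x y \<partial>lborel) \<partial>lborel) = (\<integral>x. (\<integral>y. f x y \<partial>lborel) \<partial>lborel)"
    by (rule lborel_pair.Fubini_integral[OF int])
  show "integrable lborel (\<lambda>x. \<integral>y. f x y \<partial>lborel)"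
    using lborel_pair.integrable_fst[OF int] by simp
  show "integrable lborel (\<lambda>y. \<integral>x. f x y \<partial>lborel)"
    using lborel_pair.integrable_snd[OF int] by simp
qed

lemma set_integrable_exp_minus:
  assumes "a > 0"
  shows "set_integrable lborel {0..} (\<lambda>x::real. exp (- a * x))"
proof -
  have "(\<lambda>x. exp (- a * x)) absolutely_integrable_on {0..}"
    using integrable_on_exp_minus_to_infinity[OF assms, of 0]
    by (subst absolutely_integrable_on_iff_nonneg) auto
  then show ?thesis
    by (subst (asm) absolutely_integrable_on_borel) (auto simp: set_borel_measurable_def)
qed

lemma integrable_exp_minus_abs:
  assumes "a > 0"
  shows "integrable lborel (\<lambda>x::real. exp (- a * \<bar>x\<bar>))"
proof -
  have "integrable lborel (\<lambda>x. indicator {0..} x *\<^sub>R exp (- a * \<bar>x\<bar>))"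
    using set_integrable_exp_minus[OF assms] unfolding set_integrable_def
    by (rule Bochner_Integration.integrable_cong[THEN iffD1, rotated 2]) (auto simp: indicator_def)
  then have "has_bochner_integral lborel (\<lambda>x. indicator {0..} x *\<^sub>R exp (- a * \<bar>x\<bar>))
      (\<integral>x. indicator {0..} x *\<^sub>R exp (- a * \<bar>x\<bar>) \<partial>lborel)"
    by (rule has_bochner_integral_integrable)
  from has_bochner_integral_even_function[OF this] show ?thesis
    by (auto simp: has_bochner_integral_iff)
qed

lemma borel_measurable_cosh [measurable]: "(cosh :: real \<Rightarrow> real) \<in> borel_measurable borel"
  by (intro borel_measurable_continuous_onI continuous_intros)

lemma set_integral_atLeast_eq_greaterThan:
  fixes f :: "real \<Rightarrow> 'a::{banach, second_countable_topology}"
  assumes [measurable]: "f \<in> borel_measurable borel"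
  shows "(LINT u:{a<..}|lborel. f u) = (LINT u:{a..}|lborel. f u)"
  unfolding set_lebesgue_integral_def
proof (rule integral_cong_AE)
  show "AE u in lborel. indicator {a<..} u *\<^sub>R f u = indicator {a..} u *\<^sub>R f u"
    using AE_lborel_singleton[of a] by eventually_elim (auto simp: indicator_def)
qed measurable

lemma integral_whole_line_split:
  fixes f :: "real \<Rightarrow> complex"
  assumes "integrable lborel f"
  shows "(\<integral>u. f u \<partial>lborel) = (LINT u:{0..}|lborel. f u) + (LINT u:{0..}|lborel. f (- u))"
proof -
  have [measurable]: "f \<in> borel_measurable borel" using assms by auto
  have 1: "(LINT u:{..<0}|lborel. f u) = (LINT u:{0<..}|lborel. f (- u))"
    unfolding set_lebesgue_integral_def
    by (subst lborel_integral_real_affine[of "-1" _ 0]) (auto simp: indicator_def intro!: Bochner_Integration.integral_cong)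
  have 2: "(LINT u:{0<..}|lborel. f (- u)) = (LINT u:{0..}|lborel. f (- u))"
    by (rule set_integral_atLeast_eq_greaterThan) measurable
  have s: "set_integrable lborel A f" if "A \<in> sets lborel" for A
    unfolding set_integrable_def using assms that integrable_mult_indicator by blast
  have "(\<integral>u. f u \<partial>lborel) = (LINT u:{0..}\<union>{..<0}|lborel. f u)"
    unfolding set_lebesgue_integral_def by (rule Bochner_Integration.integral_cong) (auto simp: indicator_def)
  also have "\<dots> = (LINT u:{0..}|lborel. f u) + (LINT u:{..<0}|lborel. f u)"
    by (rule set_integral_Un) (auto intro: s)
  finally show ?thesis by (simp add: 1 2)
qed

text \<open>Quadratic growth is enough to beat a linear exponent. The constant is the Taylor
  coefficient 1/2 of the exponential, halved once more by cosh.\<close>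

lemma cosh_ge_quadratic: "cosh u \<ge> (u::real)\<^sup>2 / 4"
proof -
  have "exp \<bar>u\<bar> \<ge> \<bar>u\<bar>\<^sup>2 / 2"
    using exp_lower_Taylor_quadratic[of "\<bar>u\<bar>"] by simp
  moreover have "exp \<bar>u\<bar> \<le> exp u + exp (- u)" by (cases "u \<ge> 0") auto
  ultimately show ?thesis by (simp add: cosh_def)
qed

section \<open>Analytic continuation of the Bessel function\<close>

text \<open>Completing the square with b + 1 instead of b leaves exp (-|u|) over as an integrable
  majorant.\<close>

lemma integrable_exp_cosh:
  assumes "t > 0"
  shows "integrable lborel (\<lambda>u::real. exp (- t * cosh u + b * \<bar>u\<bar>))"
proof (rule Bochner_Integration.integrable_bound)
  show "integrable lborel (\<lambda>u::real. exp ((b + 1)\<^sup>2 / t) * exp (- 1 * \<bar>u\<bar>))"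
    using integrable_exp_minus_abs[of 1] by simp
  have "- t * cosh u + b * \<bar>u\<bar> \<le> (b + 1)\<^sup>2 / t - \<bar>u\<bar>" for u
  proof -
    have "0 \<le> (t * \<bar>u\<bar> / 2 - (b + 1))\<^sup>2 / t" using assms by simp
    also have "\<dots> = t * (u\<^sup>2 / 4) - (b + 1) * \<bar>u\<bar> + (b + 1)\<^sup>2 / t"
      using assms by (simp add: power2_eq_square field_simps)
    also have "\<dots> \<le> t * cosh u - (b + 1) * \<bar>u\<bar> + (b + 1)\<^sup>2 / t"
      using assms cosh_ge_quadratic[of u] by (intro add_right_mono diff_right_mono mult_left_mono) auto
    finally show ?thesis by (simp add: algebra_simps)
  qed
  then show "AE u in lborel. norm (exp (- t * cosh u + b * \<bar>u\<bar>))
      \<le> norm (exp ((b + 1)\<^sup>2 / t) * exp (- 1 * \<bar>u\<bar>))"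
    by (intro AE_I2) (simp flip: exp_add)
qed simp

lemma integrable_besselK_kernel:
  assumes "t > 0"
  shows "integrable lborel (\<lambda>u::real. exp (- of_real (t * cosh u) + \<nu> * of_real u) :: complex)"
proof (rule Bochner_Integration.integrable_bound[OF integrable_exp_cosh[OF assms, of "\<bar>Re \<nu>\<bar>"]])
  have "Re \<nu> * u \<le> \<bar>Re \<nu>\<bar> * \<bar>u\<bar>" for u
    by (metis abs_ge_self abs_mult)
  then show "AE u in lborel. norm (exp (- of_real (t * cosh u) + \<nu> * of_real u) :: complex)
      \<le> norm (exp (- t * cosh u + \<bar>Re \<nu>\<bar> * \<bar>u\<bar>))"
    by (intro AE_I2) simp
qed simp

lemma exp_mult_cosh: "exp a * cosh b = exp (a + b) / 2 + exp (a + - b) / 2" for a b :: complex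
  unfolding cosh_field_def exp_add by (simp add: algebra_simps add_divide_distrib)

text \<open>The two exponentials of cosh (\<nu> u) are kept apart because each half-line integral is
  continued on its own, with \<nu> and with -\<nu>.\<close>

lemma besselK_split:
  assumes "t > 0"
  shows "besselK \<nu> t = ((LINT u:{0..}|lborel. exp (- of_real (t * cosh u) + \<nu> * of_real u))
            + (LINT u:{0..}|lborel. exp (- of_real (t * cosh u) + (- \<nu>) * of_real u))) / 2"
proof -
  have s: "set_integrable lborel {0..} (\<lambda>u::real. exp (- of_real (t * cosh u) + \<mu> * of_real u) :: complex)" for \<mu>
    unfolding set_integrable_def
    using integrable_mult_indicator[OF _ integrable_besselK_kernel[OF assms]] by auto
  have eq: "exp (- of_real (t * cosh u)) * cosh (\<nu> * of_real u) =
      exp (- of_real (t * cosh u) + \<nu> * of_real u) / 2 + exp (- of_real (t * cosh u) + (- \<nu>) * of_real u) / 2" for u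
    using exp_mult_cosh[of "- of_real (t * cosh u)" "\<nu> * of_real u"] by simp
  have "set_integrable lborel {0..} (\<lambda>u. exp (- of_real (t * cosh u)) * cosh (\<nu> * of_real u))"
    unfolding eq by (intro set_integral_add set_integrable_divide s)
  then have "besselK \<nu> t = (LINT u:{0..}|lborel. exp (- of_real (t * cosh u)) * cosh (\<nu> * of_real u))"
    unfolding besselK_def by (simp add: set_borel_integral_eq_integral)
  then show ?thesis
    by (simp only: eq set_integral_add(2)[OF set_integrable_divide[OF s] set_integrable_divide[OF s]]
          set_integral_divide_zero add_divide_distrib)
qed

lemma besselK_eq:
  assumes "t > 0"
  shows "besselK \<nu> t = (\<integral>u. exp (- of_real (t * cosh u) + \<nu> * of_real u) \<partial>lborel) / 2"
  unfolding besselK_split[OF assms] integral_whole_line_split[OF integrable_besselK_kernel[OF assms]]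
  by simp

text \<open>
  The contribution of \<open>t > 0\<close> to \<open>2 K\<^sub>\<nu>(exp \<zeta>) = \<integral> exp (- exp \<zeta> * cosh t + \<nu> * t) dt\<close>, with the
  contour bent so that it runs straight from \<open>0\<close> to \<open>- \<zeta>\<close> and then parallel to the real axis: with
  \<open>t = s - \<zeta>\<close> the growing exponential no longer depends on \<open>\<zeta>\<close>.
\<close>

definition besselK_half :: "complex \<Rightarrow> complex \<Rightarrow> complex" where
  "besselK_half \<nu> \<zeta> = exp (- \<nu> * \<zeta>) *
     ((LINT s:{0..}|lborel. exp (- (of_real (exp s) + exp (2 * \<zeta> - of_real s)) / 2 + \<nu> * of_real s))
      - \<zeta> * (LINT q:{0..1}|lborel. exp (- (exp (\<zeta> * of_real q) + exp ((2 - of_real q) * \<zeta>)) / 2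
                                       + \<nu> * \<zeta> * of_real q)))"

lemma integrable_bent_kernel:
  "integrable lborel (\<lambda>s::real. indicator {0..} s * exp (- exp s / 2 + b * s))"
proof (rule Bochner_Integration.integrable_bound[OF integrable_exp_cosh[of "1/2" "\<bar>b\<bar>"]])
  have "norm (indicator {0..} s * exp (- exp s / 2 + b * s)) \<le> norm (exp (- (1/2) * cosh s + \<bar>b\<bar> * \<bar>s\<bar>))" for s :: real
  proof (cases "s \<ge> 0")
    case True
    then have "cosh s \<le> exp s" using cosh_plus_sinh[of s] by (simp add: sinh_def cosh_def field_simps)
    moreover have "b * s \<le> \<bar>b\<bar> * \<bar>s\<bar>" by (metis abs_ge_self abs_mult)
    ultimately show ?thesis using True by simp
  qed simp
  then show "AE s in lborel. norm (indicator {0..} s * exp (- exp s / 2 + b * s))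
       \<le> norm (exp (- (1/2) * cosh s + \<bar>b\<bar> * \<bar>s\<bar>))" by blast
qed simp_all

text \<open>This is the gain from bending the contour: on s >= 0 the factor depending on \<zeta> is
  bounded through Re \<zeta> alone, whatever Im \<zeta> is, so the half-line part is holomorphic in
  the whole plane.\<close>

lemma norm_bent_kernel_le:
  "norm (exp (- (of_real (exp s) + exp (2 * \<zeta> - of_real s)) / 2 + \<nu> * of_real s) :: complex)
     \<le> exp (exp (2 * Re \<zeta>) / 2) * exp (- exp s / 2 + Re \<nu> * s)" if "s \<ge> 0"
proof -
  have "- Re (exp (2 * \<zeta> - of_real s)) \<le> norm (exp (2 * \<zeta> - of_real s))"
    using abs_Re_le_cmod[of "exp (2 * \<zeta> - of_real s)"] by linarith
  also have "\<dots> \<le> exp (2 * Re \<zeta>)" using that by simp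
  finally show ?thesis by (simp add: Re_exp[symmetric] flip: exp_add)
qed

lemma besselK_half_holomorphic: "besselK_half \<nu> holomorphic_on UNIV"
proof -
  have 1: "(\<lambda>\<zeta>. LINT s:{0..}|lborel. exp (- (of_real (exp s) + exp (2 * \<zeta> - of_real s)) / 2 + \<nu> * of_real s))
      holomorphic_on UNIV"
    unfolding set_lebesgue_integral_def
  proof (rule holomorphic_on_lebesgue_integral)
    fix z :: complex
    show "\<exists>r g. r > 0 \<and> ball z r \<subseteq> UNIV \<and> integrable lborel g \<and>
       (\<forall>w\<in>ball z r. \<forall>t\<in>space lborel. norm (indicator {0..} t *\<^sub>R
          exp (- (of_real (exp t) + exp (2 * w - of_real t)) / 2 + \<nu> * of_real t)) \<le> g t)"
    proof (intro exI[of _ 1] exI[of _ "\<lambda>t. exp (exp (2 * (Re z + 1)) / 2) * (indicator {0..} t * exp (- exp t / 2 + Re \<nu> * t))"]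
        conjI ballI)
      fix w t assume w: "w \<in> ball z 1"
      have "Re w \<le> Re z + 1"
        using w abs_Re_le_cmod[of "z - w"] by (simp add: dist_norm)
      then have "exp (exp (2 * Re w) / 2) \<le> exp (exp (2 * (Re z + 1)) / 2)" by simp
      then show "norm (indicator {0..} t *\<^sub>R
          exp (- (of_real (exp t) + exp (2 * w - of_real t)) / 2 + \<nu> * of_real t)) \<le>
          exp (exp (2 * (Re z + 1)) / 2) * (indicator {0..} t * exp (- exp t / 2 + Re \<nu> * t))"
        using order.trans[OF norm_bent_kernel_le[of t w \<nu>] mult_right_mono[of _ "exp (exp (2 * (Re z + 1)) / 2)"]]
        by (cases "t \<ge> 0") (simp_all del: norm_exp_eq_Re)
    qed (use integrable_bent_kernel in \<open>auto intro!: integrable_mult_right\<close>)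
  qed (auto intro!: holomorphic_intros)
  have 2: "(\<lambda>\<zeta>. LINT q:{0..1}|lborel. exp (- (exp (\<zeta> * of_real q) + exp ((2 - of_real q) * \<zeta>)) / 2
                                       + \<nu> * \<zeta> * of_real q))
      holomorphic_on UNIV"
    unfolding set_lebesgue_integral_def
  proof (rule holomorphic_on_lebesgue_integral)
    fix z :: complex
    \<comment> \<open>The segment is compact, so a crude constant suffices: \<open>R\<close> bounds
      |w| on the unit disc about z, and \<open>C\<close> then bounds the integrand.\<close>
    define R where "R = norm z + 1"
    define C where "C = exp (exp R / 2 + exp (2 * R) / 2 + norm \<nu> * R)"
    show "\<exists>r g. r > 0 \<and> ball z r \<subseteq> UNIV \<and> integrable lborel g \<and>
       (\<forall>w\<in>ball z r. \<forall>q\<in>space lborel. norm (indicator {0..1} q *\<^sub>R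
          exp (- (exp (w * of_real q) + exp ((2 - of_real q) * w)) / 2 + \<nu> * w * of_real q)) \<le> g q)"
    proof (intro exI[of _ 1] exI[of _ "\<lambda>q. indicator {0..1} q *\<^sub>R C"] conjI ballI)
      fix w and q :: real assume w: "w \<in> ball z 1"
      have wR: "norm w \<le> R"
        using w norm_triangle_sub[of w z] by (simp add: R_def dist_norm norm_minus_commute)
      have "norm (exp (- (exp (w * of_real q) + exp ((2 - of_real q) * w)) / 2 + \<nu> * w * of_real q)) \<le> C"
        if q: "0 \<le> q" "q \<le> 1"
      proof -
        have q1: "norm (w * of_real q) \<le> R"
          using mult_mono[OF wR, of q 1] q wR order.trans[OF norm_ge_zero wR] by (simp add: norm_mult)
        have "norm ((2 - of_real q) * w) = (2 - q) * norm w"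
          using q norm_of_real[of "2 - q", where 'a = complex] by (simp add: norm_mult)
        also have "\<dots> \<le> 2 * R" using q wR by (intro mult_mono) auto
        finally have q2: "norm ((2 - of_real q) * w) \<le> 2 * R" .
        have q3: "norm (\<nu> * w * of_real q) \<le> norm \<nu> * R"
          using mult_left_mono[OF q1, of "norm \<nu>"] by (simp add: norm_mult mult.assoc)
        have "norm (- (exp (w * of_real q) + exp ((2 - of_real q) * w)) / 2 + \<nu> * w * of_real q)
           \<le> norm (exp (w * of_real q)) / 2 + norm (exp ((2 - of_real q) * w)) / 2 + norm (\<nu> * w * of_real q)"
          by (intro order.trans[OF norm_triangle_ineq] add_right_mono)
             (simp add: norm_divide norm_minus_commute order.trans[OF norm_triangle_ineq4] add_divide_distrib[symmetric] divide_right_mono del: norm_exp_eq_Re)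
        also have "\<dots> \<le> exp R / 2 + exp (2 * R) / 2 + norm \<nu> * R"
          using q1 q2 q3 by (intro add_mono divide_right_mono order.trans[OF norm_exp]) auto
        finally show ?thesis
          unfolding C_def using norm_exp order.trans by (meson exp_le_cancel_iff)
      qed
      then show "norm (indicator {0..1} q *\<^sub>R
          exp (- (exp (w * of_real q) + exp ((2 - of_real q) * w)) / 2 + \<nu> * w * of_real q)) \<le> indicator {0..1} q *\<^sub>R C"
        by (auto simp: indicator_def)
    qed (auto intro!: integrable_real_indicator)
  qed (auto intro!: holomorphic_intros)
  show ?thesis
    unfolding besselK_half_def by (intro holomorphic_intros 1 2)
qed

text \<open>For real \<zeta> = t the bent path collapses onto the real axis. After s = t + u the
  half-line starts at t, and it differs from the half-line starting at 0 by the segment between 0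
  and t.\<close>

lemma besselK_half_of_real:
  fixes t :: real
  shows "besselK_half \<nu> (of_real t) =
     (LINT u:{0..}|lborel. exp (- of_real (exp t * cosh u) + \<nu> * of_real u))"
proof -
  define g where "g s = exp (- (of_real (exp s) + of_real (exp (2 * t - s))) / 2 + \<nu> * of_real s)" for s :: real
  have [measurable]: "g \<in> borel_measurable borel" unfolding g_def by measurable
  have int: "integrable lborel (\<lambda>u::real. exp (\<nu> * of_real t) * exp (- of_real (exp t * cosh u) + \<nu> * of_real u) :: complex)"
    using integrable_besselK_kernel[of "exp t"] by simp
  have shift: "exp (\<nu> * of_real t) * exp (- of_real (exp t * cosh u) + \<nu> * of_real u) = g (t + u)" for u
    unfolding g_def exp_add[symmetric]
    by (rule arg_cong[where f = exp]) (simp add: cosh_field_def algebra_simps exp_add exp_diff exp_minus exp_double field_simps power2_eq_square)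
  have gi: "integrable lborel g"
    using int lborel_integrable_real_affine_iff[of 1 g t] unfolding shift by simp
  have si: "set_integrable lborel A g" if "A \<in> sets lborel" for A
    unfolding set_integrable_def using gi that integrable_mult_indicator by blast
  have 1: "exp (\<nu> * of_real t) * (LINT u:{0..}|lborel. exp (- of_real (exp t * cosh u) + \<nu> * of_real u))
       = (LINT s:{t..}|lborel. g s)"
    unfolding set_lebesgue_integral_def
  proof (subst (2) lborel_integral_real_affine[of 1 _ t])
    show "exp (\<nu> * of_real t) * (LINT u|lborel. indicator {0..} u *\<^sub>R exp (- of_real (exp t * cosh u) + \<nu> * of_real u))
        = \<bar>1\<bar> *\<^sub>R (LINT u|lborel. indicator {t..} (t + 1 * u) *\<^sub>R g (t + 1 * u))"
      unfolding integral_mult_right_zero[symmetric] abs_one scaleR_one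
    proof (rule Bochner_Integration.integral_cong[OF refl])
      fix u show "exp (\<nu> * of_real t) * (indicator {0..} u *\<^sub>R exp (- of_real (exp t * cosh u) + \<nu> * of_real u))
        = indicator {t..} (t + 1 * u) *\<^sub>R g (t + 1 * u)"
        using shift[of u] by (simp add: indicator_def)
    qed
  qed simp
  \<comment> \<open>The scaling by t reverses the orientation for t < 0 and degenerates for t = 0;
    hence the absolute value and the separate case.\<close>
  have aff: "\<bar>t\<bar> *\<^sub>R (LINT q:{0..1}|lborel. g (t * q)) = (LINT s:(if t \<ge> 0 then {0..t} else {t..0})|lborel. g s)"
  proof (cases "t = 0")
    case True
    then show ?thesis unfolding set_lebesgue_integral_def
      by (auto intro!: integral_eq_zero_AE AE_I'[of "{0}"] simp: indicator_def split: if_splits)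
  next
    case False
    then show ?thesis
      unfolding set_lebesgue_integral_def
      by (subst (2) lborel_integral_real_affine[of t _ 0])
         (auto simp: indicator_def zero_le_mult_iff mult_le_0_iff mult_le_cancel_left1 mult_le_cancel_left2
            intro!: Bochner_Integration.integral_cong)
  qed
  have 2: "(LINT s:{t..}|lborel. g s) = (LINT s:{0..}|lborel. g s) - of_real t * (LINT q:{0..1}|lborel. g (t * q))"
  proof (cases "t \<ge> 0")
    case True
    have "(LINT s:{0..}|lborel. g s) = (LINT s:{0..t} \<union> {t<..}|lborel. g s)"
      using True by (intro arg_cong2[where f = "\<lambda>A. set_lebesgue_integral lborel A"]) auto
    also have "\<dots> = (LINT s:{0..t}|lborel. g s) + (LINT s:{t<..}|lborel. g s)"
      by (rule set_integral_Un) (auto intro: si)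
    also have "(LINT s:{t<..}|lborel. g s) = (LINT s:{t..}|lborel. g s)"
      by (rule set_integral_atLeast_eq_greaterThan) measurable
    finally show ?thesis using aff True by (simp add: scaleR_conv_of_real)
  next
    case False
    have "{t..} = {t..0} \<union> {0<..}" using False by auto
    then have "(LINT s:{t..}|lborel. g s) = (LINT s:{t..0} \<union> {0<..}|lborel. g s)" by simp
    also have "\<dots> = (LINT s:{t..0}|lborel. g s) + (LINT s:{0<..}|lborel. g s)"
      by (rule set_integral_Un) (auto intro: si)
    also have "(LINT s:{0<..}|lborel. g s) = (LINT s:{0..}|lborel. g s)"
      by (rule set_integral_atLeast_eq_greaterThan) measurable
    finally show ?thesis using aff False by (simp add: scaleR_conv_of_real)
  qed
  have 3: "exp (2 * of_real t - of_real s) = (of_real (exp (2 * t - s)) :: complex)" for s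
    by (simp flip: exp_of_real)
  have 4: "exp (- (exp (of_real t * of_real q) + exp ((2 - of_real q) * of_real t)) / 2
                                       + \<nu> * of_real t * of_real q) = g (t * q)" for q
    unfolding g_def by (simp add: algebra_simps flip: exp_of_real)
  have "besselK_half \<nu> (of_real t) = exp (- \<nu> * of_real t) * (LINT s:{t..}|lborel. g s)"
    unfolding besselK_half_def 2 3 4 g_def[symmetric] by simp
  also have "\<dots> = (LINT u:{0..}|lborel. exp (- of_real (exp t * cosh u) + \<nu> * of_real u))"
    unfolding 1[symmetric] by (simp add: mult.assoc[symmetric] flip: exp_add)
  finally show ?thesis .
qed

lemma real_islimpt_Reals: "complex_of_real x islimpt range complex_of_real"
  unfolding islimpt_approachable
proof (intro allI impI)
  fix e :: real assume "e > 0"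
  then show "\<exists>x'\<in>range of_real. x' \<noteq> complex_of_real x \<and> dist x' (of_real x) < e"
    by (intro bexI[of _ "of_real (x + e/2)"]) (auto simp: dist_norm simp flip: of_real_add of_real_diff)
qed

text \<open>Existence comes from the two bent halves, uniqueness from the identity theorem on the
  real line. Together they give the definite description in \<open>besselK_log\<close> its
  meaning.\<close>

lemma besselK_log_entire:
  shows besselK_log_holomorphic: "besselK_log \<nu> holomorphic_on UNIV"
    and besselK_log_of_real: "besselK_log \<nu> (of_real t) = besselK \<nu> (exp t)"
proof -
  let ?P = "\<lambda>F. F holomorphic_on UNIV \<and> (\<forall>t::real. F (of_real t) = besselK \<nu> (exp t))"
  have "\<exists>!F. ?P F"
  proof (rule ex1I)
    let ?F = "\<lambda>\<zeta>. (besselK_half \<nu> \<zeta> + besselK_half (- \<nu>) \<zeta>) / 2"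
    show F: "?P ?F"
      by (auto intro!: holomorphic_intros besselK_half_holomorphic simp: besselK_half_of_real besselK_split)
    fix G assume G: "?P G"
    show "G = ?F"
    proof
      fix z
      have "G z - ?F z = 0"
      proof (rule analytic_continuation[of "\<lambda>z. G z - ?F z" UNIV "range complex_of_real" "of_real 0"])
        show "(\<lambda>z. G z - ?F z) holomorphic_on UNIV" using F G by (intro holomorphic_on_diff) auto
        show "of_real 0 islimpt range complex_of_real" by (rule real_islimpt_Reals)
      qed (use F G in auto)
      then show "G z = ?F z" by simp
    qed
  qed
  from theI'[OF this] show "besselK_log \<nu> holomorphic_on UNIV" "besselK_log \<nu> (of_real t) = besselK \<nu> (exp t)"
    unfolding besselK_log_def by auto
qed

section \<open>The remainder of the large-argument expansion\<close>

lemma integrable_exp_powr_cosh: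
  fixes b c :: real
  assumes "b < c" "0 \<le> c"
  shows "integrable lborel (\<lambda>u. exp (b * \<bar>u\<bar>) * (1 + cosh u) powr (- c))"
proof (rule Bochner_Integration.integrable_bound)
  show "integrable lborel (\<lambda>u. 2 powr c * exp (- (c - b) * \<bar>u\<bar>))"
    using integrable_exp_minus_abs[of "c - b"] assms by simp
  have "exp (b * \<bar>u\<bar>) * (1 + cosh u) powr (- c) \<le> 2 powr c * exp (- (c - b) * \<bar>u\<bar>)" for u
  proof -
    have "exp \<bar>u\<bar> / 2 \<le> 1 + cosh u"
    proof -
      have "exp \<bar>u\<bar> \<le> exp u + exp (- u)" by (cases "u \<ge> 0") auto
      moreover have "cosh u = (exp u + exp (- u)) / 2" by (simp add: cosh_def)
      ultimately show ?thesis by simp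
    qed
    then have "(1 + cosh u) powr (- c) \<le> (exp \<bar>u\<bar> / 2) powr (- c)"
      using assms by (intro powr_mono2') auto
    also have "\<dots> = 2 powr c * exp (- c * \<bar>u\<bar>)"
      by (simp add: powr_def ln_div algebra_simps flip: exp_add)
    finally have "exp (b * \<bar>u\<bar>) * (1 + cosh u) powr (- c) \<le> exp (b * \<bar>u\<bar>) * (2 powr c * exp (- c * \<bar>u\<bar>))"
      by (rule mult_left_mono) simp
    also have "exp (b * \<bar>u\<bar>) * (2 powr c * exp (- c * \<bar>u\<bar>)) = 2 powr c * exp (- (c - b) * \<bar>u\<bar>)"
      by (simp add: algebra_simps flip: exp_add)
    finally show ?thesis .
  qed
  then show "AE u in lborel. norm (exp (b * \<bar>u\<bar>) * (1 + cosh u) powr (- c))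
      \<le> norm (2 powr c * exp (- (c - b) * \<bar>u\<bar>))"
    by (intro AE_I2) simp
qed measurable

lemma one_plus_cosh_pos [simp]: "1 + cosh u > (0::real)"
  using cosh_real_pos[of u] by linarith

lemma one_plus_cosh_ge: "1 + cosh u \<ge> (2::real)"
  using cosh_real_ge_1[of u] by linarith

lemma integrable_exp_powr_cosh':
  fixes b c :: real
  assumes "\<bar>b\<bar> < c"
  shows "integrable lborel (\<lambda>u. exp (b * u) * (1 + cosh u) powr (- c))"
proof (rule Bochner_Integration.integrable_bound)
  show "integrable lborel (\<lambda>u. exp (\<bar>b\<bar> * \<bar>u\<bar>) * (1 + cosh u) powr (- c))"
    by (rule integrable_exp_powr_cosh) (use assms in auto)
  have "b * u \<le> \<bar>b\<bar> * \<bar>u\<bar>" for u by (metis abs_ge_self abs_mult)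
  then show "AE u in lborel. norm (exp (b * u) * (1 + cosh u) powr (- c))
      \<le> norm (exp (\<bar>b\<bar> * \<bar>u\<bar>) * (1 + cosh u) powr (- c))"
    by (intro AE_I2) (auto intro!: mult_right_mono)
qed measurable

text \<open>The logistic substitution s = 1 / (1 + exp (-u)) maps the line onto (0,1), with ds = s
  (1 - s) du.\<close>

lemma Beta_integral_line:
  fixes a b :: real
  assumes "a > 0" "b > 0"
  shows "(\<integral>u. (1 / (1 + exp (- u))) powr a * (1 / (1 + exp u)) powr b \<partial>lborel) = Beta a b"
proof -
  define f where "f s = s powr (a - 1) * (1 - s) powr (b - 1)" for s :: real
  define g where "g u = 1 / (1 + exp (- u))" for u :: real
  define g' where "g' u = exp (- u) / (1 + exp (- u))\<^sup>2" for u :: real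
  have [measurable]: "f \<in> borel_measurable borel" unfolding f_def by measurable
  have [measurable]: "g \<in> borel_measurable borel" "g' \<in> borel_measurable borel" unfolding g_def g'_def by measurable
  have pos: "1 + exp (- u) \<noteq> 0" "1 + exp u \<noteq> 0" "1 + exp u > 0" "1 + exp (- u) > 0" for u :: real
    by (smt (verit) exp_gt_zero)+
  have g1: "1 - g u = 1 / (1 + exp u)" for u
    using pos[of u] by (simp add: g_def exp_minus field_simps)
  have bij: "bij_betw g UNIV {0<..<1}"
  proof (rule bij_betwI[where g = "\<lambda>s. ln (s / (1 - s))"])
    show "g \<in> UNIV \<rightarrow> {0<..<1}" by (auto simp: g_def pos divide_simps)
    show "ln (g u / (1 - g u)) = u" for u
    proof -
      have "g u / (1 - g u) = exp u"
        unfolding g1 using pos[of u] by (simp add: g_def exp_minus field_simps)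
      then show ?thesis by simp
    qed
    show "g (ln (s / (1 - s))) = s" if "s \<in> {0<..<1}" for s
      using that by (simp add: g_def exp_minus field_simps)
  qed auto
  have deriv: "(g has_field_derivative g' u) (at u)" for u
    unfolding g_def g'_def by (rule derivative_eq_intros refl | simp add: pos power2_eq_square)+
  have eq: "\<bar>g' u\<bar> *\<^sub>R f (g u) = (1 / (1 + exp (- u))) powr a * (1 / (1 + exp u)) powr b" for u
  proof -
    define A B where "A = 1 / (1 + exp (- u))" and "B = 1 / (1 + exp u)"
    have AB: "A > 0" "B > 0" using pos[of u] by (simp_all add: A_def B_def)
    have "\<bar>g' u\<bar> = A * B"
      using pos[of u] by (simp add: g'_def A_def B_def exp_minus field_simps power2_eq_square)
    moreover have "f (g u) = A powr (a - 1) * B powr (b - 1)"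
      unfolding f_def g1 by (simp add: g_def A_def B_def)
    ultimately have "\<bar>g' u\<bar> *\<^sub>R f (g u) = (A * A powr (a - 1)) * (B * B powr (b - 1))" by simp
    also have "\<dots> = A powr a * B powr b"
      using AB powr_mult_base[of A "a - 1"] powr_mult_base[of B "b - 1"] by simp
    finally show ?thesis by (simp add: A_def B_def)
  qed
  have I: "set_integrable lborel {0<..<1} f"
    using integrable_Beta[OF assms] unfolding f_def
    by (rule set_integrable_subset) auto
  have "Beta a b = integral {0<..<1} f"
    using has_integral_Beta_real[OF assms] unfolding f_def has_integral_Icc_iff_Ioo
    by (simp add: integral_unique)
  also have "\<dots> = (LINT s:{0<..<1}|lborel. f s)"
    using I by (simp add: set_borel_integral_eq_integral)
  also have "\<dots> = (LINT u:UNIV|lborel. \<bar>g' u\<bar> *\<^sub>R f (g u))"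
    by (rule set_integral_substitution(2)[OF _ _ bij _ _ deriv]) (auto simp: set_borel_measurable_def)
  also have "\<dots> = (\<integral>u. (1 / (1 + exp (- u))) powr a * (1 / (1 + exp u)) powr b \<partial>lborel)"
    unfolding eq by (simp add: set_lebesgue_integral_def)
  finally show ?thesis by simp
qed

text \<open>The factors 1 + exp (-u) and 1 + exp u have product 2 (1 + cosh u) and quotient exp
  (-u). A Beta integrand on the line is therefore a power of 1 + cosh u times an
  exponential.\<close>

lemma integral_exp_powr_cosh:
  fixes \<nu> c :: real
  assumes "\<bar>\<nu>\<bar> < c"
  shows "(\<integral>u. exp (\<nu> * u) * (1 + cosh u) powr (- c) \<partial>lborel) = 2 powr c * Beta (c + \<nu>) (c - \<nu>)"
proof -
  have eq: "(1 / (1 + exp (- u))) powr (c + \<nu>) * (1 / (1 + exp u)) powr (c - \<nu>)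
      = exp (\<nu> * u) * (1 + cosh u) powr (- c) / 2 powr c" for u :: real
  proof -
    have 1: "(1 + exp (- u)) * (1 + exp u) = 2 * (1 + cosh u)"
      by (simp add: cosh_def exp_minus field_simps)
    have pos: "1 + exp u > 0" "1 + exp (- u) > 0" by (smt (verit) exp_gt_zero)+
    have ln1: "ln (1 + exp u) - ln (1 + exp (- u)) = u"
    proof -
      have "(1 + exp u) / (1 + exp (- u)) = exp u" using pos by (simp add: exp_minus field_simps)
      then have "ln ((1 + exp u) / (1 + exp (- u))) = u" by simp
      then show ?thesis using pos by (simp add: ln_div)
    qed
    have ln2: "ln (1 + exp u) + ln (1 + exp (- u)) = ln 2 + ln (1 + cosh u)"
      using arg_cong[OF 1, of ln] pos one_plus_cosh_pos[of u]
      by (simp only: ln_mult_pos zero_less_numeral add.commute)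
    have "(1 / (1 + exp (- u))) powr (c + \<nu>) * (1 / (1 + exp u)) powr (c - \<nu>)
       = exp (- ((c + \<nu>) * ln (1 + exp (- u)))) * exp (- ((c - \<nu>) * ln (1 + exp u)))"
      using pos by (simp add: powr_def ln_div)
    also have "\<dots> = exp (\<nu> * (ln (1 + exp u) - ln (1 + exp (- u))) - c * (ln (1 + exp u) + ln (1 + exp (- u))))"
      by (simp add: algebra_simps flip: exp_add)
    also have "\<dots> = exp (\<nu> * u) * exp (- c * ln (1 + cosh u)) / exp (c * ln 2)"
      unfolding ln1 ln2 by (simp add: algebra_simps flip: exp_add exp_diff)
    also have "\<dots> = exp (\<nu> * u) * (1 + cosh u) powr (- c) / 2 powr c"
      using less_imp_neq[OF one_plus_cosh_pos[of u]] by (simp add: powr_def)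
    finally show ?thesis .
  qed
  have "c + \<nu> > 0" "c - \<nu> > 0" using assms by auto
  from Beta_integral_line[OF this] show ?thesis
    unfolding eq by (simp add: field_simps)
qed

text \<open>The Gamma function in the denominator is (2k)! = 4^k (1/2)_k k!, and the reflection
  formula turns Gamma(1/2 + \<nu>) Gamma(1/2 - \<nu>) into pi / cos (pi \<nu>). This is the origin
  of the factor cos (pi \<nu>) in the remainder.\<close>

lemma Beta_half_shift:
  fixes \<nu> :: real
  assumes "\<bar>\<nu>\<bar> < 1/2"
  shows "2 powr (real k + 1/2) * Beta (real k + 1/2 + \<nu>) (real k + 1/2 - \<nu>) =
     sqrt 2 * pi / cos (pi * \<nu>) * (pochhammer (1/2 + \<nu>) k * pochhammer (1/2 - \<nu>) k / (pochhammer (1/2) k * fact k * 2 ^ k))"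
proof -
  have nz: "1/2 + \<nu> \<notin> \<int>\<^sub>\<le>\<^sub>0" "1/2 - \<nu> \<notin> \<int>\<^sub>\<le>\<^sub>0"
    using assms by (auto elim!: nonpos_Ints_cases)
  have g: "Gamma (real k + 1/2 + \<nu>) = pochhammer (1/2 + \<nu>) k * Gamma (1/2 + \<nu>)"
          "Gamma (real k + 1/2 - \<nu>) = pochhammer (1/2 - \<nu>) k * Gamma (1/2 - \<nu>)"
    using pochhammer_Gamma[OF nz(1), of k] pochhammer_Gamma[OF nz(2), of k] Gamma_eq_zero_iff[of "1/2+\<nu>"] Gamma_eq_zero_iff[of "1/2-\<nu>"] nz
    by (auto simp: field_simps algebra_simps)
  have "complex_of_real (Gamma (1/2 + \<nu>) * Gamma (1/2 - \<nu>)) = of_real (pi / sin (pi * (1/2 + \<nu>)))"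
    using Gamma_reflection_complex[of "of_real (1/2 + \<nu>)"]
    by (simp add: Gamma_complex_of_real[symmetric] sin_of_real[symmetric] algebra_simps)
  then have r: "Gamma (1/2 + \<nu>) * Gamma (1/2 - \<nu>) = pi / cos (pi * \<nu>)"
    unfolding of_real_eq_iff by (simp add: algebra_simps sin_add)
  have "Gamma (real k + 1/2 + \<nu> + (real k + 1/2 - \<nu>)) = fact (2 * k)"
    using Gamma_fact[of "2 * k", where 'a = real] by (simp add: algebra_simps)
  then have "Beta (real k + 1/2 + \<nu>) (real k + 1/2 - \<nu>)
     = pochhammer (1/2 + \<nu>) k * pochhammer (1/2 - \<nu>) k * (Gamma (1/2 + \<nu>) * Gamma (1/2 - \<nu>)) / fact (2 * k)"
    unfolding Beta_def g by (simp add: mult_ac)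
  moreover have "2 powr (real k + 1/2) = 2 ^ k * sqrt 2"
    by (simp add: powr_add powr_realpow powr_half_sqrt)
  ultimately show ?thesis
    unfolding r fact_double[where 'a = real] power_mult power2_eq_square power_mult_distrib
    by (simp add: mult_ac)
qed

text \<open>With A = (u+w)/2 and B = (u-w)/2, the sum cosh A + cosh B is 2 cosh (u/2) cosh (w/2),
  while cosh w + cosh u is 2 cosh A cosh B. The quotient thus splits into two translates of one
  function of u.\<close>

lemma sech_partial_fractions:
  fixes u w :: real
  shows "sqrt (1 + cosh u) / (cosh w + cosh u) =
     ((1 + cosh (u + w)) powr (- (1/2)) + (1 + cosh (u - w)) powr (- (1/2))) / (2 * cosh (w/2))"
proof -
  have c: "1 + cosh v = 2 * (cosh (v/2))\<^sup>2" for v :: real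
    using cosh_double_cosh[of "v/2"] by simp
  have s: "(1 + cosh v) powr (- (1/2)) = 1 / (sqrt 2 * cosh (v/2))" for v :: real
    unfolding c by (simp add: powr_minus_divide powr_half_sqrt real_sqrt_mult cosh_real_nonneg)
  have s': "sqrt (1 + cosh v) = sqrt 2 * cosh (v/2)" for v :: real
    unfolding c by (simp add: real_sqrt_mult cosh_real_nonneg)
  define A B where "A = (u + w) / 2" and "B = (u - w) / 2"
  have AB: "u / 2 = (A + B) / 2" "w / 2 = (A - B) / 2" "u = A + B" "w = A - B"
    by (simp_all add: A_def B_def field_simps)
  have 1: "cosh A + cosh B = 2 * cosh (u/2) * cosh (w/2)"
  proof -
    have "A = u/2 + w/2" "B = u/2 - w/2" by (simp_all add: A_def B_def field_simps)
    then show ?thesis by (simp add: cosh_add cosh_diff)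
  qed
  have 2: "cosh w + cosh u = 2 * cosh A * cosh B"
    unfolding AB(3,4) by (simp add: cosh_add cosh_diff)
  have pos: "cosh A > 0" "cosh B > 0" "cosh (w/2) > 0" by auto
  have "sqrt (1 + cosh u) / (cosh w + cosh u) = sqrt 2 * cosh (u/2) / (2 * cosh A * cosh B)"
    by (simp add: s' 2)
  also have "\<dots> = sqrt 2 * (cosh A + cosh B) / (4 * cosh A * cosh B * cosh (w/2))"
    unfolding 1 using pos by (simp add: field_simps)
  also have "\<dots> = (1 / (sqrt 2 * cosh A) + 1 / (sqrt 2 * cosh B)) / (2 * cosh (w/2))"
    using pos by (simp add: field_simps mult.assoc[symmetric, of "sqrt 2" "sqrt 2"])
  finally show ?thesis unfolding s A_def B_def .
qed

lemma cos_pi_times_pos: "cos (pi * \<nu>) > 0" if "\<bar>\<nu>\<bar> < 1/2"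
proof -
  have "pi * \<bar>\<nu>\<bar> < pi * (1/2)" using that by (intro mult_strict_left_mono) auto
  then have "cos \<bar>pi * \<nu>\<bar> > 0"
    using pi_gt_zero by (intro cos_gt_zero_pi) (simp_all add: abs_mult order.strict_trans2[of _ 0])
  then show ?thesis by simp
qed

text \<open>Translating the two summands back costs the factors exp (\<nu> w) and exp (-\<nu> w),
  which recombine to cosh (\<nu> w).\<close>

lemma integral_sech_kernel:
  fixes \<nu> w :: real
  assumes \<nu>: "\<bar>\<nu>\<bar> < 1/2"
  shows "integrable lborel (\<lambda>u. exp (\<nu> * u) * (sqrt (1 + cosh u) / (cosh w + cosh u)))" (is ?A)
    and "(\<integral>u. exp (\<nu> * u) * (sqrt (1 + cosh u) / (cosh w + cosh u)) \<partial>lborel)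
      = sqrt 2 * pi / cos (pi * \<nu>) * (cosh (\<nu> * w) / cosh (w/2))" (is ?B)
proof -
  let ?q = "\<lambda>u. exp (\<nu> * u) * (1 + cosh u) powr (- (1/2))"
  have int: "integrable lborel ?q" using \<nu> by (intro integrable_exp_powr_cosh')
  have val: "(\<integral>u. ?q u \<partial>lborel) = sqrt 2 * pi / cos (pi * \<nu>)"
    using integral_exp_powr_cosh[OF \<nu>] Beta_half_shift[OF \<nu>, of 0] by simp
  have eq: "exp (\<nu> * u) * (sqrt (1 + cosh u) / (cosh w + cosh u)) =
     (exp (- (\<nu> * w)) * ?q (w + 1 * u) + exp (\<nu> * w) * ?q (- w + 1 * u)) / (2 * cosh (w/2))" for u
    unfolding sech_partial_fractions by (simp add: algebra_simps exp_add exp_diff exp_minus field_simps)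
  have int': "integrable lborel (\<lambda>u. ?q (v + 1 * u))" for v
    using lborel_integrable_real_affine[OF int, of 1 v] by simp
  have val': "(\<integral>u. ?q (v + 1 * u) \<partial>lborel) = sqrt 2 * pi / cos (pi * \<nu>)" for v
    using lborel_integral_real_affine[of 1 ?q v] val by simp
  show ?A unfolding eq by (intro integrable_divide Bochner_Integration.integrable_add integrable_mult_right int')
  have "(\<integral>u. exp (\<nu> * u) * (sqrt (1 + cosh u) / (cosh w + cosh u)) \<partial>lborel)
     = (exp (- (\<nu> * w)) * (sqrt 2 * pi / cos (pi * \<nu>)) + exp (\<nu> * w) * (sqrt 2 * pi / cos (pi * \<nu>))) / (2 * cosh (w/2))"
    unfolding eq using int' by (simp only: integral_divide_zero Bochner_Integration.integral_add[OF integrable_mult_right integrable_mult_right] integral_mult_right_zero val')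
  also have "\<dots> = sqrt 2 * pi / cos (pi * \<nu>) * (cosh (\<nu> * w) / cosh (w/2))"
    unfolding cosh_def[of "\<nu> * w"] by (simp add: algebra_simps add_divide_distrib)
  finally show ?B .
qed

lemma cosh_add_cosh_pos: "cosh w + cosh u > (0::real)"
  using cosh_real_pos[of u] cosh_real_pos[of w] by linarith

lemma sech_weight_nonneg: "0 \<le> (1 + cosh u) powr c / (cosh w + cosh (u::real))"
  using cosh_add_cosh_pos[of w u] by simp

text \<open>As cosh w >= 1, the denominator is at least 1 + cosh u. The majorant is free of w, as a
  separated bound requires.\<close>

lemma sech_weight_le:
  "(1 + cosh u) powr (1/2 - real n) / (cosh w + cosh u) \<le> (1 + cosh u) powr - (1/2 + real n)"
proof -
  have "(1 + cosh u) powr (1/2 - real n) = (1 + cosh u) * (1 + cosh u) powr (- (1/2 + real n))"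
    using powr_mult_base[of "1 + cosh u" "- (1/2 + real n)"] one_plus_cosh_pos[of u] by (simp add: algebra_simps)
  also have "\<dots> \<le> (cosh w + cosh u) * (1 + cosh u) powr (- (1/2 + real n))"
    using cosh_real_ge_1[of w] by (intro mult_right_mono) auto
  finally show ?thesis using cosh_add_cosh_pos[of w u] by (simp add: field_simps)
qed

lemma norm_mult_left_mono: "0 \<le> a \<Longrightarrow> a \<le> b \<Longrightarrow> norm (c * a) \<le> norm (c * b)" for a b c :: real
  by (simp add: abs_mult mult_left_mono)

text \<open>The induction starts from the integral representation. In the remainder one writes 1 -
  cosh w = (1 + cosh u) - (cosh w + cosh u): the second part cancels the denominator and leaves a
  Beta integral, which is the next coefficient.\<close>

lemma sech_kernel_expansion_real:
  fixes \<nu> w :: real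
  assumes \<nu>: "\<bar>\<nu>\<bar> < 1/2"
  shows "cosh (\<nu> * w) / cosh (w/2) =
    (\<Sum>k<N. pochhammer (1/2 + \<nu>) k * pochhammer (1/2 - \<nu>) k / (pochhammer (1/2) k * fact k * 2 ^ k) * (1 - cosh w) ^ k)
    + (1 - cosh w) ^ N * (cos (pi * \<nu>) / (sqrt 2 * pi)) *
      (\<integral>u. exp (\<nu> * u) * ((1 + cosh u) powr (1/2 - real N) / (cosh w + cosh u)) \<partial>lborel)"
proof (induction N)
  case 0
  have "cos (pi * \<nu>) > 0"
    using \<nu> by (rule cos_pi_times_pos)
  then show ?case
    using integral_sech_kernel(2)[OF \<nu>, of w] by (simp add: powr_half_sqrt)
next
  case (Suc N)
  define J where "J n = (\<integral>u. exp (\<nu> * u) * ((1 + cosh u) powr (1/2 - real n) / (cosh w + cosh u)) \<partial>lborel)" for n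
  have cpos: "cos (pi * \<nu>) > 0"
    using \<nu> by (rule cos_pi_times_pos)
  have pos: "cosh w + cosh u > 0" for u using cosh_real_pos[of u] cosh_real_pos[of w] by linarith
  have eq: "exp (\<nu> * u) * ((1 + cosh u) powr (1/2 - real (Suc N)) / (cosh w + cosh u)) * (1 - cosh w)
      = exp (\<nu> * u) * ((1 + cosh u) powr (1/2 - real N) / (cosh w + cosh u)) - exp (\<nu> * u) * (1 + cosh u) powr (- (real N + 1/2))" for u
  proof -
    have "(1 + cosh u) powr (1/2 - real N) = (1 + cosh u) * (1 + cosh u) powr (- (real N + 1/2))"
      using powr_mult_base[of "1 + cosh u" "- (real N + 1/2)"] one_plus_cosh_pos[of u] by (simp add: algebra_simps)
    moreover have "1/2 - real (Suc N) = - (real N + 1/2)" by simp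
    moreover have "exp (\<nu> * u) * (P / (cosh w + cosh u)) * (1 - cosh w) =
       exp (\<nu> * u) * ((1 + cosh u) * P / (cosh w + cosh u)) - exp (\<nu> * u) * P" for P
      using pos[of u] by (simp add: field_simps)
    ultimately show ?thesis by metis
  qed
  have i1: "integrable lborel (\<lambda>u. exp (\<nu> * u) * ((1 + cosh u) powr (1/2 - real n) / (cosh w + cosh u)))" for n
  proof (rule Bochner_Integration.integrable_bound[OF integrable_exp_powr_cosh'[of \<nu> "1/2 + real n"]])
    show "AE u in lborel. norm (exp (\<nu> * u) * ((1 + cosh u) powr (1/2 - real n) / (cosh w + cosh u)))
       \<le> norm (exp (\<nu> * u) * (1 + cosh u) powr - (1/2 + real n))"
      by (intro AE_I2 norm_mult_left_mono sech_weight_nonneg sech_weight_le)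
  qed (use \<nu> in auto)
  have i2: "integrable lborel (\<lambda>u. exp (\<nu> * u) * (1 + cosh u) powr (- (real N + 1/2)))"
    using \<nu> by (intro integrable_exp_powr_cosh') auto
  have "J (Suc N) * (1 - cosh w) = J N - 2 powr (real N + 1/2) * Beta (real N + 1/2 + \<nu>) (real N + 1/2 - \<nu>)"
    unfolding J_def integral_mult_left_zero[symmetric] eq Bochner_Integration.integral_diff[OF i1 i2]
    using \<nu> by (subst integral_exp_powr_cosh) auto
  then have JN: "J N = J (Suc N) * (1 - cosh w) + sqrt 2 * pi / cos (pi * \<nu>) *
     (pochhammer (1/2 + \<nu>) N * pochhammer (1/2 - \<nu>) N / (pochhammer (1/2) N * fact N * 2 ^ N))"
    unfolding Beta_half_shift[OF \<nu>] by simp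
  define K where "K = cos (pi * \<nu>) / (sqrt 2 * pi)"
  have K: "K * (sqrt 2 * pi / cos (pi * \<nu>)) = 1" using cpos by (simp add: K_def)
  have "K * J N = K * J (Suc N) * (1 - cosh w) +
     (pochhammer (1/2 + \<nu>) N * pochhammer (1/2 - \<nu>) N / (pochhammer (1/2) N * fact N * 2 ^ N))"
    unfolding JN distrib_left mult.assoc[symmetric] K by simp
  then have "(1 - cosh w) ^ N * K * J N = (1 - cosh w) ^ N * (K * J (Suc N) * (1 - cosh w) +
     (pochhammer (1/2 + \<nu>) N * pochhammer (1/2 - \<nu>) N / (pochhammer (1/2) N * fact N * 2 ^ N)))"
    by (simp only: mult.assoc)
  then show ?case
    unfolding Suc.IH J_def[symmetric] K_def[symmetric] by (simp only: sum.lessThan_Suc power_Suc ring_distribs mult_ac add_ac)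
qed

lemma integrable_sech_kernel_bound:
  fixes b w :: real
  assumes "\<bar>b\<bar> < real N + 1/2"
  shows "integrable lborel (\<lambda>u. exp (b * \<bar>u\<bar>) * ((1 + cosh u) powr (1/2 - real N) / (cosh w + cosh u)))"
proof (rule Bochner_Integration.integrable_bound[OF integrable_exp_powr_cosh[of b "1/2 + real N"]])
  show "AE u in lborel. norm (exp (b * \<bar>u\<bar>) * ((1 + cosh u) powr (1/2 - real N) / (cosh w + cosh u)))
     \<le> norm (exp (b * \<bar>u\<bar>) * (1 + cosh u) powr - (1/2 + real N))"
    by (intro AE_I2 norm_mult_left_mono sech_weight_nonneg sech_weight_le)
qed (use assms in auto)

text \<open>The coefficients of \<open>cosh (\<nu> w) / cosh (w / 2)\<close> in powers of \<open>1 - cosh w\<close>.\<close>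

definition phi_coeff :: "complex \<Rightarrow> nat \<Rightarrow> complex" where
  "phi_coeff \<nu> k = pochhammer (1/2 + \<nu>) k * pochhammer (1/2 - \<nu>) k / (pochhammer (1/2) k * fact k * 2 ^ k)"

lemma holomorphic_on_pochhammer:
  "f holomorphic_on A \<Longrightarrow> (\<lambda>z. pochhammer (f z) n) holomorphic_on A" for f :: "complex \<Rightarrow> complex"
  by (induction n) (auto simp: pochhammer_Suc intro!: holomorphic_intros)

lemma complex_cosh_of_real: "cosh (complex_of_real x) = of_real (cosh x)"
  by (simp add: cosh_field_def flip: exp_of_real)

lemma holomorphic_on_cosh: "f holomorphic_on A \<Longrightarrow> (\<lambda>z. cosh (f z)) holomorphic_on A" for f :: "complex \<Rightarrow> complex"
  unfolding cosh_field_def by (intro holomorphic_intros) auto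

lemma holomorphic_on_phi_coeff: "(\<lambda>\<nu>. phi_coeff \<nu> k) holomorphic_on A"
  unfolding phi_coeff_def divide_inverse
  by (rule holomorphic_on_mult[OF _ holomorphic_on_const])
     (intro holomorphic_on_mult holomorphic_on_pochhammer holomorphic_intros)

text \<open>The Beta evaluation at order 0 needs |\<nu>| < 1/2, but the remainder integral converges
  for |Re \<nu>| < N + 1/2. Both sides are holomorphic in \<nu> on that strip, so the identity
  theorem carries the formula over.\<close>

lemma sech_kernel_expansion:
  assumes \<nu>: "\<bar>Re \<nu>\<bar> < real N + 1/2"
  shows "cosh (\<nu> * of_real w) / of_real (cosh (w/2)) =
    (\<Sum>k<N. phi_coeff \<nu> k * of_real (1 - cosh w) ^ k)
    + of_real (1 - cosh w) ^ N * (cos (of_real pi * \<nu>) / of_real (sqrt 2 * pi)) *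
      (\<integral>u. exp (\<nu> * of_real u) * of_real ((1 + cosh u) powr (1/2 - real N) / (cosh w + cosh u)) \<partial>lborel)"
proof -
  define S where "S = {z. Re z < real N + 1/2} \<inter> {z. - (real N + 1/2) < Re z}"
  define J where "J \<nu> = (\<integral>u. exp (\<nu> * of_real u) * of_real ((1 + cosh u) powr (1/2 - real N) / (cosh w + cosh u)) \<partial>lborel)" for \<nu> :: complex
  define D where "D \<nu> = cosh (\<nu> * of_real w) / of_real (cosh (w/2)) -
    ((\<Sum>k<N. phi_coeff \<nu> k * of_real (1 - cosh w) ^ k)
    + of_real (1 - cosh w) ^ N * (cos (of_real pi * \<nu>) / of_real (sqrt 2 * pi)) * J \<nu>)" for \<nu>
  have S: "open S" "connected S"
    unfolding S_def by (intro open_Int open_halfspace_Re_lt open_halfspace_Re_gt convex_connected convex_Int convex_halfspace_Re_lt convex_halfspace_Re_gt)+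
  have "J holomorphic_on S"
    unfolding J_def
  proof (rule holomorphic_on_lebesgue_integral)
    fix z assume z: "z \<in> S"
    \<comment> \<open>Half the distance to the edge of the strip, so that the enlarged exponent
      \<open>b\<close> stays strictly inside.\<close>
    define r where "r = (real N + 1/2 - \<bar>Re z\<bar>) / 2"
    have r: "r > 0" using z by (auto simp: r_def S_def)
    define b where "b = \<bar>Re z\<bar> + r"
    have b: "\<bar>b\<bar> < real N + 1/2" using r by (simp add: b_def r_def field_simps)
    have R: "\<bar>Re w\<bar> \<le> b" if "w \<in> ball z r" for w
      using that abs_Re_le_cmod[of "w - z"] by (simp add: b_def dist_norm norm_minus_commute)
    show "\<exists>r g. r > 0 \<and> ball z r \<subseteq> S \<and> integrable lborel g \<and>
       (\<forall>y\<in>ball z r. \<forall>u\<in>space lborel. norm (exp (y * of_real u) *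
          of_real ((1 + cosh u) powr (1/2 - real N) / (cosh w + cosh u))) \<le> g u)"
    proof (intro exI[of _ r] exI[of _ "\<lambda>u. exp (b * \<bar>u\<bar>) * ((1 + cosh u) powr (1/2 - real N) / (cosh w + cosh u))"] conjI ballI)
      show "ball z r \<subseteq> S" using R b by (fastforce simp: S_def)
      show "norm (exp (y * of_real u) * of_real ((1 + cosh u) powr (1/2 - real N) / (cosh w + cosh u)))
          \<le> exp (b * \<bar>u\<bar>) * ((1 + cosh u) powr (1/2 - real N) / (cosh w + cosh u))" if "y \<in> ball z r" for y and u :: real
      proof -
        have "Re y * u \<le> \<bar>Re y\<bar> * \<bar>u\<bar>" by (metis abs_ge_self abs_mult)
        also have "\<dots> \<le> b * \<bar>u\<bar>" using R[OF that] by (intro mult_right_mono) auto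
        finally have e: "norm (exp (y * of_real u)) \<le> exp (b * \<bar>u\<bar>)" by simp
        have "cosh w + cosh u > 0" using cosh_real_pos[of u] cosh_real_pos[of w] by linarith
        then have "norm (of_real ((1 + cosh u) powr (1/2 - real N) / (cosh w + cosh u)) :: complex) = (1 + cosh u) powr (1/2 - real N) / (cosh w + cosh u)"
          unfolding norm_of_real by simp
        then show ?thesis unfolding norm_mult using mult_right_mono[OF e norm_ge_zero] by metis
      qed
    qed (use r b integrable_sech_kernel_bound in auto)
  qed (auto intro!: holomorphic_intros)
  then have hD: "D holomorphic_on S"
    unfolding D_def by (intro holomorphic_intros holomorphic_on_phi_coeff holomorphic_on_cosh) auto
  have "D \<nu> = 0"
  proof (rule analytic_continuation[OF hD S, of "of_real ` {-1/2<..<1/2}" 0])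
    show "of_real ` {-1/2<..<1/2} \<subseteq> S" by (auto simp: S_def)
    show "0 \<in> S" by (auto simp: S_def)
    show "(0::complex) islimpt of_real ` {-1/2<..<1/2}"
      unfolding islimpt_approachable
    proof (intro allI impI)
      fix e :: real assume "e > 0"
      then show "\<exists>x'\<in>of_real ` {-1/2<..<1/2}. x' \<noteq> (0::complex) \<and> dist x' 0 < e"
        by (intro bexI[of _ "of_real (min (e/2) (1/4))"]) (auto simp: dist_norm)
    qed
    show "\<nu> \<in> S" using \<nu> by (auto simp: S_def)
    fix z :: complex assume "z \<in> of_real ` {-1/2<..<1/2}"
    then obtain x where x: "z = of_real x" "\<bar>x\<bar> < 1/2" by (auto simp: abs_less_iff)
    have J: "J z = of_real (\<integral>u. exp (x * u) * ((1 + cosh u) powr (1/2 - real N) / (cosh w + cosh u)) \<partial>lborel)"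
      unfolding J_def integral_complex_of_real[symmetric] x by (simp flip: exp_of_real)
    have p: "phi_coeff z k = of_real (pochhammer (1/2 + x) k * pochhammer (1/2 - x) k / (pochhammer (1/2) k * fact k * 2 ^ k))" for k
      unfolding phi_coeff_def x by (simp add: pochhammer_of_real[symmetric])
    have cs: "cos (of_real pi * z) = of_real (cos (pi * x))"
      unfolding x by (simp add: cos_of_real flip: of_real_mult)
    have "cosh (z * of_real w) / of_real (cosh (w/2)) = of_real (cosh (x * w) / cosh (w/2))"
      unfolding x by (simp add: complex_cosh_of_real flip: of_real_mult)
    also note sech_kernel_expansion_real[OF x(2), of w N]
    finally show "D z = 0" unfolding D_def J p cs by simp
  qed
  then show ?thesis unfolding D_def J_def by simp
qed

section \<open>Laplace integrals in w and the exact Stieltjes remainder\<close>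

lemma Gamma_integral_lborel:
  fixes a :: real
  assumes "a > 0"
  shows "set_integrable lborel {0<..} (\<lambda>t. t powr (a - 1) * exp (- t))" (is ?A)
    and "(LINT t:{0<..}|lborel. t powr (a - 1) * exp (- t)) = Gamma a" (is ?B)
proof -
  let ?f = "\<lambda>t::real. t powr (a - 1) * exp (- t)"
  have hi: "(?f has_integral Gamma a) {0..}"
    using Gamma_integral_real[OF assms] by (simp add: exp_minus divide_inverse)
  have "?f absolutely_integrable_on {0..}"
    using hi by (subst absolutely_integrable_on_iff_nonneg) auto
  then have s: "set_integrable lborel {0..} ?f"
    by (subst (asm) absolutely_integrable_on_borel) (auto simp: set_borel_measurable_def)
  then show ?A by (rule set_integrable_subset) auto
  have "(LINT t:{0<..}|lborel. ?f t) = (LINT t:{0..}|lborel. ?f t)"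
    by (rule set_integral_atLeast_eq_greaterThan) measurable
  then show ?B using s hi by (simp add: set_borel_integral_eq_integral integral_unique)
qed

text \<open>In half angles, cosh w - 1 = 2 sinh^2 (w/2) and sinh w = 2 sinh (w/2) cosh (w/2), so
  t^(-1/2) dt is a constant times cosh (w/2) dw. This is why cosh (\<nu> w) was divided by cosh
  (w/2) before being expanded.\<close>

lemma cosh_minus_one_substitution:
  fixes F :: "real \<Rightarrow> complex"
  assumes l: "c > 0" and [measurable]: "F \<in> borel_measurable borel"
  shows "set_integrable lborel {0<..} (\<lambda>t. (t powr (-1/2)) *\<^sub>R F t) \<longleftrightarrow>
         set_integrable lborel {0<..} (\<lambda>w. cosh (w/2) *\<^sub>R F (c * (cosh w - 1)))" (is ?A)
    and "(LINT w:{0<..}|lborel. cosh (w/2) *\<^sub>R F (c * (cosh w - 1)))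
         = (LINT t:{0<..}|lborel. (t powr (-1/2)) *\<^sub>R F t) / of_real (sqrt (2 * c))" (is ?B)
proof -
  define g where "g w = c * (cosh w - 1)" for w :: real
  define f where "f t = (t powr (-1/2)) *\<^sub>R F t" for t :: real
  have [measurable]: "g \<in> borel_measurable borel" "f \<in> borel_measurable borel"
    unfolding g_def f_def by measurable
  have [measurable]: "(sinh :: real \<Rightarrow> real) \<in> borel_measurable borel"
    by (intro borel_measurable_continuous_onI continuous_intros)
  have bij: "bij_betw g {0<..} {0<..}"
  proof (rule bij_betwI[where g = "\<lambda>t. arcosh (1 + t / c)"])
    show "g \<in> {0<..} \<rightarrow> {0<..}" using l cosh_real_strict_mono[of 0] by (auto simp: g_def)
    show "(\<lambda>t. arcosh (1 + t / c)) \<in> {0<..} \<rightarrow> {0<..}" using l by auto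
  qed (use l in \<open>auto simp: g_def arcosh_cosh_real cosh_arcosh_real field_simps\<close>)
  have deriv: "(g has_field_derivative c * sinh w) (at w)" for w
    unfolding g_def by (rule derivative_eq_intros refl | simp)+
  have eq: "\<bar>c * sinh w\<bar> *\<^sub>R f (g w) = sqrt (2 * c) *\<^sub>R (cosh (w/2) *\<^sub>R F (c * (cosh w - 1)))"
    if w: "w \<in> {0<..}" for w
  proof -
    define s where "s = sinh (w/2)"
    have s: "s > 0" using w by (simp add: s_def)
    have 1: "cosh w - 1 = 2 * s\<^sup>2"
      using cosh_double_cosh[of "w/2"] cosh_square_eq[of "w/2"] by (simp add: s_def)
    have 2: "sinh w = 2 * s * cosh (w/2)"
      using sinh_double[of "w/2"] by (simp add: s_def)
    have "(c * (2 * s\<^sup>2)) powr (-1/2) = 1 / (sqrt (2 * c) * s)"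
      using l s by (simp add: powr_minus_divide[of _ "1/2"] powr_half_sqrt real_sqrt_mult mult_ac)
    then have "\<bar>c * sinh w\<bar> * (g w) powr (-1/2) = (c * (2 * s * cosh (w/2))) * (1 / (sqrt (2 * c) * s))"
      using l s unfolding g_def 1 2 by (simp add: abs_mult)
    also have "\<dots> = (2 * c / sqrt (2 * c)) * cosh (w/2)" using l s by simp
    also have "2 * c / sqrt (2 * c) = sqrt (2 * c)" using l by (intro real_div_sqrt) simp
    finally have "\<bar>c * sinh w\<bar> * (g w) powr (-1/2) = sqrt (2 * c) * cosh (w/2)" .
    then show ?thesis by (simp add: f_def g_def)
  qed
  have iff: "set_integrable lborel {0<..} f \<longleftrightarrow> set_integrable lborel {0<..} (\<lambda>w. \<bar>c * sinh w\<bar> *\<^sub>R f (g w))"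
    and val: "(LINT t:{0<..}|lborel. f t) = (LINT w:{0<..}|lborel. \<bar>c * sinh w\<bar> *\<^sub>R f (g w))"
    by (rule set_integral_substitution[OF _ _ bij _ _ deriv]; simp add: set_borel_measurable_def)+
  have "set_integrable lborel {0<..} (\<lambda>w. \<bar>c * sinh w\<bar> *\<^sub>R f (g w)) \<longleftrightarrow>
        set_integrable lborel {0<..} (\<lambda>w. sqrt (2 * c) *\<^sub>R (cosh (w/2) *\<^sub>R F (c * (cosh w - 1))))"
    by (rule set_integrable_cong) (use eq in auto)
  also have "\<dots> \<longleftrightarrow> set_integrable lborel {0<..} (\<lambda>w. cosh (w/2) *\<^sub>R F (c * (cosh w - 1)))"
  proof
    assume "set_integrable lborel {0<..} (\<lambda>w. sqrt (2 * c) *\<^sub>R (cosh (w/2) *\<^sub>R F (c * (cosh w - 1))))"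
    then have "set_integrable lborel {0<..} (\<lambda>w. (1 / sqrt (2 * c)) *\<^sub>R (sqrt (2 * c) *\<^sub>R (cosh (w/2) *\<^sub>R F (c * (cosh w - 1)))))"
      by (rule set_integrable_scaleR_right)
    then show "set_integrable lborel {0<..} (\<lambda>w. cosh (w/2) *\<^sub>R F (c * (cosh w - 1)))" using l by simp
  qed (intro set_integrable_scaleR_right)
  finally show ?A using iff unfolding f_def by blast
  have "(LINT w:{0<..}|lborel. \<bar>c * sinh w\<bar> *\<^sub>R f (g w)) =
        (LINT w:{0<..}|lborel. sqrt (2 * c) *\<^sub>R (cosh (w/2) *\<^sub>R F (c * (cosh w - 1))))"
    by (rule set_lebesgue_integral_cong) (use eq in auto)
  then show ?B using val l unfolding f_def by (simp add: scaleR_conv_of_real)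
qed

text \<open>Half of the exponential decay is traded for a power. The constant is the maximum of
  y^\<beta> exp (-y/2), attained at y = 2 \<beta>.\<close>

lemma powr_mult_exp_minus_le:
  fixes y \<beta> :: real
  assumes "y > 0" "\<beta> > 0"
  shows "exp (- y) \<le> exp (\<beta> * ln (2 * \<beta>) - \<beta>) * exp (- y / 2) * y powr (- \<beta>)"
proof -
  have "ln (y / (2 * \<beta>)) \<le> y / (2 * \<beta>) - 1" using assms by (intro ln_le_minus_one) simp
  then have "\<beta> * ln (y / (2 * \<beta>)) \<le> \<beta> * (y / (2 * \<beta>) - 1)" using assms by (intro mult_left_mono) auto
  then have "- y \<le> (\<beta> * ln (2 * \<beta>) - \<beta>) + (- y / 2) + (- \<beta> * ln y)"
    using assms by (simp add: ln_div algebra_simps)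
  then have "exp (- y) \<le> exp ((\<beta> * ln (2 * \<beta>) - \<beta>) + (- y / 2) + (- \<beta> * ln y))" by simp
  also have "\<dots> = exp (\<beta> * ln (2 * \<beta>) - \<beta>) * exp (- y / 2) * y powr (- \<beta>)"
    using assms unfolding exp_add by (simp add: powr_def)
  finally show ?thesis .
qed

text \<open>Part of exp (-t (1 + cosh u)) is traded for (t (1 + cosh u))^(-\<beta>), which separates
  the variables. Convergence in u needs \<beta> > |Re \<nu>|, convergence at t = 0 needs \<beta> < N
  + 1/2; the midpoint is taken.\<close>

lemma besselK_moment_kernel_bound:
  assumes "\<bar>Re \<nu>\<bar> < real N + 1/2"
  obtains g h :: "real \<Rightarrow> real" where "integrable lborel g" "integrable lborel h"
    "\<And>t u. norm (indicator {0<..} t *\<^sub>R (of_real (t powr (real N - 1/2) * exp (- t * (1 + cosh u))) * exp (\<nu> * of_real u)))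
        \<le> g t * h u"
proof -
  define \<beta> where "\<beta> = (\<bar>Re \<nu>\<bar> + (real N + 1/2)) / 2"
  have \<beta>: "\<bar>Re \<nu>\<bar> < \<beta>" "\<beta> < real N + 1/2" "\<beta> > 0" using assms by (auto simp: \<beta>_def)
  define C where "C = exp (\<beta> * ln (2 * \<beta>) - \<beta>)"
  define g where "g t = indicator {0<..} t *\<^sub>R (t powr (real N + 1/2 - \<beta> - 1) * exp (- t))" for t :: real
  define h where "h u = C * (exp (Re \<nu> * u) * (1 + cosh u) powr (- \<beta>))" for u :: real
  show thesis
  proof (rule that[of g h])
    show "integrable lborel g"
      using Gamma_integral_lborel(1)[of "real N + 1/2 - \<beta>"] \<beta> unfolding g_def set_integrable_def by simp
    show "integrable lborel h"
      unfolding h_def using \<beta> by (intro integrable_mult_right integrable_exp_powr_cosh')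
    fix t u :: real
    show "norm (indicator {0<..} t *\<^sub>R (of_real (t powr (real N - 1/2) * exp (- t * (1 + cosh u))) * exp (\<nu> * of_real u)))
        \<le> g t * h u"
    proof (cases "t > 0")
      case True
      define p where "p = 1 + cosh u"
      have p: "p \<ge> 2" using one_plus_cosh_ge[of u] by (simp add: p_def)
      have "exp (- (t * p)) \<le> C * exp (- (t * p) / 2) * (t * p) powr (- \<beta>)"
        unfolding C_def using True p \<beta> by (intro powr_mult_exp_minus_le) auto
      \<comment> \<open>Because 1 + cosh u >= 2, half of the exponential is still at most exp
        (-t).\<close>
      also have "\<dots> \<le> C * exp (- t) * (t * p) powr (- \<beta>)"
        using True p by (intro mult_right_mono mult_left_mono) (auto simp: C_def)
      finally have "t powr (real N - 1/2) * exp (- (t * p)) \<le> t powr (real N - 1/2) * (C * exp (- t) * (t * p) powr (- \<beta>))"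
        by (rule mult_left_mono) simp
      also have "\<dots> = (t powr (real N - 1/2) * t powr (- \<beta>)) * exp (- t) * (C * p powr (- \<beta>))"
        using True p by (simp add: powr_mult mult_ac)
      also have "t powr (real N - 1/2) * t powr (- \<beta>) = t powr (real N + 1/2 - \<beta> - 1)"
        unfolding powr_add[symmetric] by (rule arg_cong[where f = "(powr) t"]) simp
      finally have "t powr (real N - 1/2) * exp (- (t * p)) * exp (Re \<nu> * u)
           \<le> t powr (real N + 1/2 - \<beta> - 1) * exp (- t) * (C * p powr (- \<beta>)) * exp (Re \<nu> * u)"
        by (rule mult_right_mono) simp
      then show ?thesis
        using True by (simp add: norm_mult g_def h_def p_def mult_ac)
    qed (simp add: g_def)
  qed
qed

lemma besselK_moment_kernel_integral:
  assumes "t > 0"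
  shows "(\<integral>u. of_real (t powr a * exp (- t * (1 + cosh u))) * exp (\<nu> * of_real u) \<partial>lborel)
     = 2 * (of_real (t powr a * exp (- t)) * besselK \<nu> t)"
proof -
  have "of_real (t powr a * exp (- t * (1 + cosh u))) * exp (\<nu> * of_real u)
     = of_real (t powr a * exp (- t)) * exp (- of_real (t * cosh u) + \<nu> * of_real u)" for u
    by (simp add: algebra_simps flip: exp_of_real exp_add)
  then show ?thesis unfolding besselK_eq[OF assms] integral_mult_right_zero[symmetric]
    by (simp only: integral_mult_right_zero) simp
qed

lemma integrable_besselK_moment:
  assumes "\<bar>Re \<nu>\<bar> < real N + 1/2"
  shows "set_integrable lborel {0<..} (\<lambda>t. of_real (t powr (real N - 1/2) * exp (- t)) * besselK \<nu> t)"
proof -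
  obtain g h where gh: "integrable lborel g" "integrable lborel h"
    "\<And>t u. norm (indicator {0<..} t *\<^sub>R (of_real (t powr (real N - 1/2) * exp (- t * (1 + cosh u))) * exp (\<nu> * of_real u)) :: complex)
        \<le> g t * h u"
    using besselK_moment_kernel_bound[OF assms] by metis
  have "integrable lborel (\<lambda>t. \<integral>u. indicator {0<..} t *\<^sub>R (of_real (t powr (real N - 1/2) * exp (- t * (1 + cosh u))) * exp (\<nu> * of_real u)) \<partial>lborel)"
    by (rule Fubini_product_bound(2)[OF _ gh]) (simp add: case_prod_unfold)
  then have "integrable lborel (\<lambda>t. (\<integral>u. indicator {0<..} t *\<^sub>R (of_real (t powr (real N - 1/2) * exp (- t * (1 + cosh u))) * exp (\<nu> * of_real u)) \<partial>lborel) / 2)"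
    by (rule integrable_divide)
  then show ?thesis
    unfolding set_integrable_def
  proof (rule Bochner_Integration.integrable_cong[THEN iffD1, rotated 2])
    fix t :: real
    show "(\<integral>u. indicator {0<..} t *\<^sub>R (of_real (t powr (real N - 1/2) * exp (- t * (1 + cosh u))) * exp (\<nu> * of_real u)) \<partial>lborel) / 2
       = indicator {0<..} t *\<^sub>R (of_real (t powr (real N - 1/2) * exp (- t)) * besselK \<nu> t)"
      using besselK_moment_kernel_integral[of t "real N - 1/2" \<nu>] by (cases "t > 0") simp_all
  qed simp
qed

definition stieltjesK :: "complex \<Rightarrow> nat \<Rightarrow> complex \<Rightarrow> complex" where
  "stieltjesK \<nu> N z =
     (LINT t:{0<..}|lborel. of_real (t powr (real N - 1/2) * exp (- t)) * besselK \<nu> t / (of_real t + z))"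

lemma besselK_even_integral:
  assumes "t > 0"
  shows "besselK \<nu> t = (LINT w:{0<..}|lborel. of_real (exp (- t * cosh w)) * cosh (\<nu> * of_real w))"
proof -
  have s: "set_integrable lborel {0..} (\<lambda>u::real. exp (- of_real (t * cosh u) + \<mu> * of_real u) :: complex)" for \<mu>
    unfolding set_integrable_def
    using integrable_mult_indicator[OF _ integrable_besselK_kernel[OF assms]] by auto
  have "set_integrable lborel {0..} (\<lambda>u. exp (- of_real (t * cosh u)) * cosh (\<nu> * of_real u))"
    unfolding exp_mult_cosh using s[of \<nu>] s[of "- \<nu>"] by (intro set_integral_add set_integrable_divide) auto
  then have "besselK \<nu> t = (LINT w:{0..}|lborel. exp (- of_real (t * cosh w)) * cosh (\<nu> * of_real w))"
    unfolding besselK_def by (simp add: set_borel_integral_eq_integral)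
  also have "\<dots> = (LINT w:{0<..}|lborel. exp (- of_real (t * cosh w)) * cosh (\<nu> * of_real w))"
    unfolding cosh_field_def by (rule set_integral_atLeast_eq_greaterThan[symmetric]) measurable
  finally show ?thesis by (simp flip: exp_of_real)
qed

lemma cosh_power_exp_integral:
  assumes z: "z > 0"
  shows "set_integrable lborel {0<..} (\<lambda>w. complex_of_real (exp (- z * cosh w) * cosh (w/2) * (cosh w - 1) ^ N))" (is ?A)
    and "(LINT w:{0<..}|lborel. complex_of_real (exp (- z * cosh w) * cosh (w/2) * (cosh w - 1) ^ N))
      = of_real (exp (- z) / (z ^ N * sqrt (2 * z)) * Gamma (real N + 1/2))" (is ?B)
proof -
  define F where "F t = complex_of_real (exp (- z) * (exp (- t) * (t / z) ^ N))" for t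
  have [measurable]: "F \<in> borel_measurable borel" unfolding F_def by measurable
  have F: "indicator {0<..} t *\<^sub>R ((t powr (-1/2)) *\<^sub>R F t) =
      complex_of_real (exp (- z) / z ^ N * (indicator {0<..} t *\<^sub>R (t powr (real N + 1/2 - 1) * exp (- t))))" for t
  proof (cases "t > 0")
    case True
    then have "t powr (real N + 1/2 - 1) = t powr (-1/2) * t ^ N"
      by (simp add: powr_realpow[symmetric] flip: powr_add)
    then show ?thesis unfolding F_def by (simp add: scaleR_conv_of_real power_divide)
  qed simp
  have E: "cosh (w/2) *\<^sub>R F (z * (cosh w - 1)) = complex_of_real (exp (- z * cosh w) * cosh (w/2) * (cosh w - 1) ^ N)" for w
  proof -
    have 1: "z * (cosh w - 1) / z = cosh w - 1" using z by simp
    have 2: "exp (- z) * exp (- (z * (cosh w - 1))) = exp (- z * cosh w)"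
      by (simp add: algebra_simps flip: exp_add)
    show ?thesis unfolding F_def 1 2[symmetric] by (simp add: scaleR_conv_of_real)
  qed
  have int: "integrable lborel (\<lambda>t. complex_of_real (exp (- z) / z ^ N * (indicator {0<..} t *\<^sub>R (t powr (real N + 1/2 - 1) * exp (- t)))))"
    using Gamma_integral_lborel(1)[of "real N + 1/2"] unfolding set_integrable_def
    by (intro integrable_of_real integrable_mult_right) simp
  then have "set_integrable lborel {0<..} (\<lambda>t. (t powr (-1/2)) *\<^sub>R F t)"
    unfolding set_integrable_def F .
  then show ?A using cosh_minus_one_substitution(1)[OF z, of F] unfolding E by simp
  have "(LINT t:{0<..}|lborel. (t powr (-1/2)) *\<^sub>R F t) = of_real (exp (- z) / z ^ N * Gamma (real N + 1/2))"
    using Gamma_integral_lborel(2)[of "real N + 1/2"] unfolding set_lebesgue_integral_def F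
    by (simp only: integral_complex_of_real integral_mult_right_zero)
  then show ?B using cosh_minus_one_substitution(2)[OF z, of F] unfolding E by simp
qed

text \<open>The w-integral is done inside for fixed u and becomes an integral over t with
  denominator t + z; exchanging back, the u-integral of exp (-t cosh u + \<nu> u) is 2
  \<open>besselK\<close> at t.\<close>

lemma besselK_stieltjes_remainder:
  assumes z: "z > 0" and \<nu>: "\<bar>Re \<nu>\<bar> < real N + 1/2"
  defines "G \<equiv> \<lambda>w. \<integral>u. exp (\<nu> * of_real u) * of_real ((1 + cosh u) powr (1/2 - real N) / (cosh w + cosh u)) \<partial>lborel"
  shows "set_integrable lborel {0<..} (\<lambda>w. of_real (exp (- z * cosh w) * cosh (w/2) * (cosh w - 1) ^ N) * G w)" (is ?A)
    and "(LINT w:{0<..}|lborel. of_real (exp (- z * cosh w) * cosh (w/2) * (cosh w - 1) ^ N) * G w)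
      = of_real (2 * exp (- z) * (z / z ^ N) / sqrt (2 * z)) * stieltjesK \<nu> N (of_real z)" (is ?B)
proof -
  define E where "E w = indicator {0<..} w *\<^sub>R (exp (- z * cosh w) * cosh (w/2) * (cosh w - 1) ^ N)" for w :: real
  define f where "f w u = of_real (E w) * (exp (\<nu> * of_real u) * of_real ((1 + cosh u) powr (1/2 - real N) / (cosh w + cosh u)))" for w u
  define h where "h u = exp (Re \<nu> * u) * (1 + cosh u) powr (- (1/2 + real N))" for u :: real
  have E: "integrable lborel E"
  proof -
    have "integrable lborel (\<lambda>w. complex_of_real (E w))"
      using cosh_power_exp_integral(1)[OF z, of N] unfolding set_integrable_def E_def
      by (simp add: scaleR_conv_of_real)
    then show ?thesis by (simp only: complex_of_real_integrable_eq)
  qed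
  note [measurable] = borel_measurable_integrable[OF E]
  have Enn: "E w \<ge> 0" for w using cosh_real_ge_1[of w] by (auto simp: E_def indicator_def)
  have h: "integrable lborel h"
    unfolding h_def using \<nu> by (intro integrable_exp_powr_cosh') auto
  have bound: "norm (f w u) \<le> E w * h u" for w u
  proof -
    have "norm (f w u) = E w * (exp (Re \<nu> * u) * ((1 + cosh u) powr (1/2 - real N) / (cosh w + cosh u)))"
      unfolding f_def norm_mult norm_of_real abs_of_nonneg[OF Enn] abs_of_nonneg[OF sech_weight_nonneg] norm_exp_eq_Re by simp
    also have "\<dots> \<le> E w * h u" unfolding h_def by (intro mult_left_mono sech_weight_le Enn) auto
    finally show ?thesis .
  qed
  have fm: "case_prod f \<in> borel_measurable (lborel \<Otimes>\<^sub>M lborel)"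
    unfolding f_def case_prod_unfold by measurable
  note Fub = Fubini_product_bound[OF fm E h bound]
  have fG: "(\<integral>u. f w u \<partial>lborel) = indicator {0<..} w *\<^sub>R (of_real (exp (- z * cosh w) * cosh (w/2) * (cosh w - 1) ^ N) * G w)" for w
    unfolding f_def G_def integral_mult_right_zero by (simp add: E_def indicator_def)
  show ?A using Fub(2) unfolding fG set_integrable_def .
  obtain g' h' where gh: "integrable lborel g'" "integrable lborel h'"
    "\<And>t u. norm (indicator {0<..} t *\<^sub>R (of_real (t powr (real N - 1/2) * exp (- t * (1 + cosh u))) * exp (\<nu> * of_real u)) :: complex)
        \<le> g' t * h' u"
    using besselK_moment_kernel_bound[OF \<nu>] by metis
  define H where "H t u = indicator {0<..} t *\<^sub>R (of_real (t powr (real N - 1/2) * exp (- t * (1 + cosh u))) * exp (\<nu> * of_real u)) / (of_real (t + z) :: complex)" for t u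
  have Hm: "case_prod H \<in> borel_measurable (lborel \<Otimes>\<^sub>M lborel)"
    unfolding H_def case_prod_unfold by measurable
  have g'': "integrable lborel (\<lambda>t. g' t / z)" using gh by simp
  have Hb: "norm (H t u) \<le> g' t / z * h' u" for t u
  proof (cases "t > 0")
    case True
    have "norm (H t u) \<le> (g' t * h' u) / norm (of_real (t + z) :: complex)"
      unfolding H_def norm_divide by (intro divide_right_mono gh(3)) simp
    also have "\<dots> \<le> (g' t * h' u) / z"
      unfolding norm_of_real using True z order.trans[OF norm_ge_zero gh(3)[of t u]] by (intro divide_left_mono) auto
    finally show ?thesis by simp
  next
    case False
    then have "norm (H t u) = 0" by (simp add: H_def)
    also have "0 \<le> (g' t * h' u) / z" using z order.trans[OF norm_ge_zero gh(3)[of t u]] by simp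
    finally show ?thesis by simp
  qed
  note FubH = Fubini_product_bound(1)[OF Hm g'' gh(2) Hb]
  have inner: "(\<integral>w. f w u \<partial>lborel) = of_real (exp (- z) * (z / z ^ N) / sqrt (2 * z)) * (\<integral>t. H t u \<partial>lborel)" for u
  proof -
    define p where "p = 1 + cosh u"
    have p: "p > 0" using one_plus_cosh_pos[of u] by (simp add: p_def)
    \<comment> \<open>For fixed u put t = z (cosh w - 1) / p. Then p (t + z) = z (cosh w + cosh u)
      supplies the Stieltjes denominator and z cosh w = z + t p the exponential. \<open>Q\<close>
      collects the factors free of t.\<close>
    define Q where "Q = exp (\<nu> * of_real u) * of_real (p powr (1/2 - real N) * exp (- z))"
    define F where "F t = Q * of_real (exp (- t * p) * (t * p / z) ^ N * z / (p * (t + z)))" for t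
    have [measurable]: "F \<in> borel_measurable borel" unfolding F_def by measurable
    have "(\<integral>w. f w u \<partial>lborel) = (LINT w:{0<..}|lborel. cosh (w/2) *\<^sub>R F (z / p * (cosh w - 1)))"
      unfolding set_lebesgue_integral_def
    proof (rule Bochner_Integration.integral_cong[OF refl])
      fix w
      have "z / p * (cosh w - 1) + z = z / p * (cosh w - 1 + p)"
        using p by (simp add: distrib_left)
      also have "cosh w - 1 + p = cosh w + cosh u" by (simp add: p_def)
      finally have "z / p * (cosh w - 1) + z = z / p * (cosh w + cosh u)" .
      then have *: "p * (z / p * (cosh w - 1) + z) = z * (cosh w + cosh u)" using p by simp
      have "exp (- z * cosh w) = exp (- z) * exp (- (z / p * (cosh w - 1)) * p)"
        using p by (simp add: algebra_simps flip: exp_add)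
      moreover have "z / p * (cosh w - 1) * p / z = cosh w - 1" using p z by simp
      ultimately show "f w u = indicator {0<..} w *\<^sub>R (cosh (w/2) *\<^sub>R F (z / p * (cosh w - 1)))"
        unfolding F_def Q_def f_def E_def * p_def[symmetric] using z
        by (simp add: indicator_def scaleR_conv_of_real)
    qed
    also have "\<dots> = (LINT t:{0<..}|lborel. (t powr (-1/2)) *\<^sub>R F t) / of_real (sqrt (2 * (z / p)))"
      using z p by (intro cosh_minus_one_substitution(2)) auto
    also have "(LINT t:{0<..}|lborel. (t powr (-1/2)) *\<^sub>R F t) =
       of_real (exp (- z) * (z / z ^ N) / sqrt p) * (\<integral>t. H t u \<partial>lborel)"
      unfolding set_lebesgue_integral_def integral_mult_right_zero[symmetric]
    proof (rule Bochner_Integration.integral_cong[OF refl])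
      fix t :: real
      show "indicator {0<..} t *\<^sub>R ((t powr (-1/2)) *\<^sub>R F t) = of_real (exp (- z) * (z / z ^ N) / sqrt p) * H t u"
      proof (cases "t > 0")
        case True
        have 1: "t powr (real N - 1/2) = t powr (-1/2) * t ^ N"
          using True by (simp add: powr_realpow[symmetric] flip: powr_add)
        have 2: "p powr (1/2 - real N) = sqrt p / p ^ N"
          using p by (simp add: powr_diff powr_realpow powr_half_sqrt)
        have 3: "sqrt p / p = 1 / sqrt p" using p by (simp add: field_simps)
        have "t powr (-1/2) * (sqrt p / p ^ N * exp (- z) * (exp (- t * p) * (t * p / z) ^ N * z / (p * (t + z))))
           = exp (- z) * (z / z ^ N) * (sqrt p / p) * (t powr (-1/2) * t ^ N * exp (- t * p) / (t + z))"
          using p by (simp add: power_divide power_mult_distrib mult_ac)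
        then have LR: "t powr (-1/2) * (p powr (1/2 - real N) * exp (- z) * (exp (- t * p) * (t * p / z) ^ N * z / (p * (t + z))))
           = exp (- z) * (z / z ^ N) / sqrt p * (t powr (real N - 1/2) * exp (- t * p) / (t + z))"
          unfolding 1 2 3 by simp
        have A: "(t powr (-1/2)) *\<^sub>R F t = exp (\<nu> * of_real u) * of_real (t powr (-1/2) * (p powr (1/2 - real N) * exp (- z) * (exp (- t * p) * (t * p / z) ^ N * z / (p * (t + z)))))"
          unfolding F_def Q_def by (simp add: scaleR_conv_of_real mult_ac)
        have B: "of_real (exp (- z) * (z / z ^ N) / sqrt p) * H t u = exp (\<nu> * of_real u) * of_real (exp (- z) * (z / z ^ N) / sqrt p * (t powr (real N - 1/2) * exp (- t * p) / (t + z)))"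
          using True unfolding H_def p_def[symmetric] by (simp add: mult_ac)
        show ?thesis unfolding A B LR using True by simp
      qed (simp add: H_def)
    qed
    finally show ?thesis using p by (simp add: real_sqrt_divide)
  qed
  have "(LINT w:{0<..}|lborel. of_real (exp (- z * cosh w) * cosh (w/2) * (cosh w - 1) ^ N) * G w) = (\<integral>w. \<integral>u. f w u \<partial>lborel \<partial>lborel)"
    unfolding set_lebesgue_integral_def fG ..
  also have "\<dots> = (\<integral>u. \<integral>w. f w u \<partial>lborel \<partial>lborel)" by (rule Fub(1)[symmetric])
  also have "\<dots> = of_real (exp (- z) * (z / z ^ N) / sqrt (2 * z)) * (\<integral>u. \<integral>t. H t u \<partial>lborel \<partial>lborel)"
    unfolding inner by simp
  also have "(\<integral>u. \<integral>t. H t u \<partial>lborel \<partial>lborel) = (\<integral>t. \<integral>u. H t u \<partial>lborel \<partial>lborel)" by (rule FubH)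
  also have "\<dots> = 2 * stieltjesK \<nu> N (of_real z)"
    unfolding stieltjesK_def set_lebesgue_integral_def integral_mult_right_zero[symmetric]
  proof (rule Bochner_Integration.integral_cong[OF refl])
    fix t :: real
    show "(\<integral>u. H t u \<partial>lborel) = 2 * (indicator {0<..} t *\<^sub>R (of_real (t powr (real N - 1/2) * exp (- t)) * besselK \<nu> t / (of_real t + of_real z)))"
      unfolding H_def using besselK_moment_kernel_integral[of t "real N - 1/2" \<nu>]
      by (simp add: indicator_def del: of_real_mult)
  qed
  finally show ?B by simp
qed

lemma set_integral_finite_sum:
  fixes f :: "'i \<Rightarrow> 'a \<Rightarrow> 'b::{banach, second_countable_topology}"
  assumes "\<And>i. i \<in> I \<Longrightarrow> set_integrable M A (f i)"
  shows "set_integrable M A (\<lambda>x. \<Sum>i\<in>I. f i x)"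
    and "(LINT x:A|M. \<Sum>i\<in>I. f i x) = (\<Sum>i\<in>I. LINT x:A|M. f i x)"
proof -
  show "set_integrable M A (\<lambda>x. \<Sum>i\<in>I. f i x)"
    unfolding set_integrable_def scaleR_sum_right
    by (rule Bochner_Integration.integrable_sum[OF assms[unfolded set_integrable_def]])
  show "(LINT x:A|M. \<Sum>i\<in>I. f i x) = (\<Sum>i\<in>I. LINT x:A|M. f i x)"
    unfolding set_lebesgue_integral_def scaleR_sum_right
    by (rule Bochner_Integration.integral_sum[OF assms[unfolded set_integrable_def]])
qed

text \<open>The factor (1/2)_k in the denominator of \<open>phi_coeff\<close> cancels against
  Gamma(k + 1/2) = (1/2)_k sqrt pi, so that exactly the coefficients of the asymptotic series
  remain.\<close>

lemma phi_coeff_Gamma_half: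
  "phi_coeff \<nu> k * (-1) ^ k * of_real (Gamma (real k + 1/2)) = of_real (sqrt pi) * coeff_a \<nu> k"
proof -
  have "Gamma (1/2 + real k) = pochhammer (1/2) k * Gamma (1/2 :: real)"
  proof -
    have "(1/2::real) \<notin> \<int>\<^sub>\<le>\<^sub>0" by (auto elim!: nonpos_Ints_cases)
    from pochhammer_Gamma[OF this, of k] show ?thesis by (simp add: Gamma_one_half_real)
  qed
  then have g: "complex_of_real (Gamma (real k + 1/2)) = pochhammer (1/2) k * of_real (sqrt pi)"
    by (simp add: add.commute Gamma_one_half_real pochhammer_of_real[symmetric])
  have "pochhammer (1/2) k \<noteq> (0::complex)"
  proof -
    have "pochhammer (1/2) k = complex_of_real (pochhammer (1/2) k)"
      using pochhammer_of_real[of "1/2" k, where 'a = complex] by simp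
    moreover have "pochhammer (1/2::real) k > 0" by (rule pochhammer_pos) simp
    ultimately show ?thesis by (metis of_real_eq_0_iff less_irrefl)
  qed
  then show ?thesis
    unfolding g phi_coeff_def coeff_a_def by (simp add: divide_simps)
qed

text \<open>Term by term integration of the finite expansion in powers of 1 - cosh w. The result is
  an identity and not merely an asymptotic statement, which is what allows it to be continued in
  z.\<close>

lemma besselK_stieltjes:
  assumes z: "z > 0" and \<nu>: "\<bar>Re \<nu>\<bar> < real N + 1/2"
  shows "besselK \<nu> z = of_real (sqrt (pi / (2 * z)) * exp (- z)) *
    ((\<Sum>k<N. coeff_a \<nu> k / of_real z ^ k) +
     (-1) ^ N * of_real (z / z ^ N) * (cos (of_real pi * \<nu>) * of_real (sqrt (2 / pi) / pi)) * stieltjesK \<nu> N (of_real z))"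
proof -
  define E where "E k w = complex_of_real (exp (- z * cosh w) * cosh (w/2) * (cosh w - 1) ^ k)" for k w
  define G where "G w = (\<integral>u. exp (\<nu> * of_real u) * of_real ((1 + cosh u) powr (1/2 - real N) / (cosh w + cosh u)) \<partial>lborel)" for w
  define \<kappa> where "\<kappa> = cos (of_real pi * \<nu>) / of_real (sqrt 2 * pi)"
  note rem = besselK_stieltjes_remainder[OF z \<nu>, folded E_def G_def]
  have pw: "(1 - cosh w) ^ k = (-1) ^ k * (cosh w - 1) ^ k" for w :: real and k
    by (simp flip: power_mult_distrib)
  have "of_real (exp (- z * cosh w)) * cosh (\<nu> * of_real w) =
     (\<Sum>k<N. phi_coeff \<nu> k * (-1) ^ k * E k w) + (-1) ^ N * \<kappa> * (E N w * G w)" for w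
  proof -
    have "of_real (exp (- z * cosh w)) * cosh (\<nu> * of_real w)
      = of_real (exp (- z * cosh w) * cosh (w/2)) * (cosh (\<nu> * of_real w) / of_real (cosh (w/2)))"
      by simp
    also have "\<dots> = (\<Sum>k<N. of_real (exp (- z * cosh w) * cosh (w/2)) * (phi_coeff \<nu> k * of_real (1 - cosh w) ^ k)) +
       of_real (exp (- z * cosh w) * cosh (w/2)) * (of_real (1 - cosh w) ^ N * \<kappa> * G w)"
      unfolding sech_kernel_expansion[OF \<nu>] \<kappa>_def G_def by (simp only: distrib_left sum_distrib_left)
    also have "of_real (exp (- z * cosh w) * cosh (w/2)) * (of_real (1 - cosh w) ^ N * \<kappa> * G w) = (-1) ^ N * \<kappa> * (E N w * G w)"
      unfolding of_real_power[symmetric] pw E_def by simp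
    also have "(\<Sum>k<N. of_real (exp (- z * cosh w) * cosh (w/2)) * (phi_coeff \<nu> k * of_real (1 - cosh w) ^ k))
       = (\<Sum>k<N. phi_coeff \<nu> k * (-1) ^ k * E k w)"
      unfolding of_real_power[symmetric] pw E_def by (intro sum.cong) simp_all
    finally show ?thesis .
  qed
  then have "besselK \<nu> z = (LINT w:{0<..}|lborel. (\<Sum>k<N. phi_coeff \<nu> k * (-1) ^ k * E k w) + (-1) ^ N * \<kappa> * (E N w * G w))"
    unfolding besselK_even_integral[OF z] by simp
  also have "\<dots> = (LINT w:{0<..}|lborel. \<Sum>k<N. phi_coeff \<nu> k * (-1) ^ k * E k w) +
      (LINT w:{0<..}|lborel. (-1) ^ N * \<kappa> * (E N w * G w))"
  proof (rule set_integral_add(2))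
    show "set_integrable lborel {0<..} (\<lambda>w. \<Sum>k<N. phi_coeff \<nu> k * (-1) ^ k * E k w)"
      using cosh_power_exp_integral(1)[OF z] unfolding E_def
      by (intro set_integral_finite_sum(1) set_integrable_mult_right) auto
    show "set_integrable lborel {0<..} (\<lambda>w. (-1) ^ N * \<kappa> * (E N w * G w))"
      using rem(1) by (intro set_integrable_mult_right)
  qed
  also have "(LINT w:{0<..}|lborel. \<Sum>k<N. phi_coeff \<nu> k * (-1) ^ k * E k w) =
     (\<Sum>k<N. phi_coeff \<nu> k * (-1) ^ k * (LINT w:{0<..}|lborel. E k w))"
    using cosh_power_exp_integral(1)[OF z] unfolding E_def
    by (subst set_integral_finite_sum(2)) (auto intro!: set_integrable_mult_right)
  also have "\<dots> = (\<Sum>k<N. of_real (sqrt (pi / (2 * z)) * exp (- z)) * (coeff_a \<nu> k / of_real z ^ k))"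
  proof (rule sum.cong[OF refl])
    fix k
    have "phi_coeff \<nu> k * (-1) ^ k * (LINT w:{0<..}|lborel. E k w) =
      (phi_coeff \<nu> k * (-1) ^ k * of_real (Gamma (real k + 1/2))) * of_real (exp (- z) / (z ^ k * sqrt (2 * z)))"
      unfolding E_def cosh_power_exp_integral(2)[OF z] by simp
    also have "\<dots> = of_real (sqrt (pi / (2 * z)) * exp (- z)) * (coeff_a \<nu> k / of_real z ^ k)"
      unfolding phi_coeff_Gamma_half using z by (simp add: real_sqrt_divide mult_ac)
    finally show "phi_coeff \<nu> k * (-1) ^ k * (LINT w:{0<..}|lborel. E k w) =
      of_real (sqrt (pi / (2 * z)) * exp (- z)) * (coeff_a \<nu> k / of_real z ^ k)" .
  qed
  also have "\<dots> = of_real (sqrt (pi / (2 * z)) * exp (- z)) * (\<Sum>k<N. coeff_a \<nu> k / of_real z ^ k)"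
    by (simp add: sum_distrib_left)
  also have "(LINT w:{0<..}|lborel. (-1) ^ N * \<kappa> * (E N w * G w)) = (-1) ^ N * \<kappa> * (LINT w:{0<..}|lborel. E N w * G w)"
    by simp
  also have "\<dots> = of_real (sqrt (pi / (2 * z)) * exp (- z)) *
     ((-1) ^ N * of_real (z / z ^ N) * (cos (of_real pi * \<nu>) * of_real (sqrt (2 / pi) / pi)) * stieltjesK \<nu> N (of_real z))"
  proof -
    have XY: "1 / (sqrt 2 * pi) * (2 * exp (- z) * (z / z ^ N) / sqrt (2 * z)) = sqrt (pi / (2 * z)) * exp (- z) * (z / z ^ N) * (sqrt (2 / pi) / pi)"
      using z by (simp add: real_sqrt_divide real_sqrt_mult field_simps)
    have "(-1) ^ N * \<kappa> * (LINT w:{0<..}|lborel. E N w * G w) =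
        (-1) ^ N * cos (of_real pi * \<nu>) * stieltjesK \<nu> N (of_real z) * of_real (1 / (sqrt 2 * pi) * (2 * exp (- z) * (z / z ^ N) / sqrt (2 * z)))"
      unfolding rem(2) \<kappa>_def by (simp add: mult_ac)
    also have "\<dots> = of_real (sqrt (pi / (2 * z)) * exp (- z)) *
     ((-1) ^ N * of_real (z / z ^ N) * (cos (of_real pi * \<nu>) * of_real (sqrt (2 / pi) / pi)) * stieltjesK \<nu> N (of_real z))"
      unfolding XY by (simp add: mult_ac)
    finally show ?thesis .
  qed
  finally show ?thesis by (simp only: distrib_left)
qed

text \<open>The point -t of the cut is at distance at least 2r from z, and w is within r of z. This
  bounds the Stieltjes denominator from below, uniformly in t.\<close>

lemma norm_add_nonneg_ge:
  fixes z w :: complex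
  assumes "ball z (2 * r) \<inter> \<real>\<^sub>\<le>\<^sub>0 = {}" "w \<in> ball z r" "t \<ge> 0"
  shows "norm (of_real t + w) \<ge> r"
proof -
  have "complex_of_real (- t) \<in> \<real>\<^sub>\<le>\<^sub>0" using assms(3) by simp
  then have "dist z (of_real (- t)) \<ge> 2 * r" using assms(1) by (auto simp: disjoint_iff not_less)
  moreover have "dist z (of_real (- t)) \<le> dist z w + dist w (of_real (- t))" by (rule dist_triangle)
  moreover have "dist w (of_real (- t)) = norm (of_real t + w)" by (simp add: dist_norm add.commute)
  ultimately show ?thesis using assms(2) by simp
qed

lemma stieltjesK_holomorphic:
  assumes "\<bar>Re \<nu>\<bar> < real N + 1/2"
  shows "stieltjesK \<nu> N holomorphic_on - \<real>\<^sub>\<le>\<^sub>0"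
proof -
  define m where "m t = indicator {0<..} t *\<^sub>R (of_real (t powr (real N - 1/2) * exp (- t)) * besselK \<nu> t)" for t
  have m: "integrable lborel m" using integrable_besselK_moment[OF assms] unfolding m_def set_integrable_def .
  have "(\<lambda>z. \<integral>t. m t / (of_real t + z) \<partial>lborel) holomorphic_on - \<real>\<^sub>\<le>\<^sub>0"
  proof (rule holomorphic_on_lebesgue_integral)
    fix t
    show "(\<lambda>z. m t / (of_real t + z)) holomorphic_on - \<real>\<^sub>\<le>\<^sub>0"
    proof (cases "t > 0")
      case True
      have "of_real t + z \<noteq> 0" if "z \<in> - \<real>\<^sub>\<le>\<^sub>0" for z :: complex
      proof
        assume "of_real t + z = 0"
        then have "z = of_real (- t)" by (simp add: eq_neg_iff_add_eq_0 add.commute)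
        with True that show False by simp
      qed
      then show ?thesis by (intro holomorphic_intros) auto
    qed (simp add: m_def)
  next
    show "(\<lambda>t. m t / (of_real t + z)) \<in> borel_measurable lborel" for z
      using borel_measurable_integrable[OF m] by measurable
  next
    fix z :: complex assume "z \<in> - \<real>\<^sub>\<le>\<^sub>0"
    moreover have "open (- \<real>\<^sub>\<le>\<^sub>0 :: complex set)" by (simp add: closed_nonpos_Reals_complex open_Compl)
    ultimately obtain e where e: "e > 0" "ball z e \<subseteq> - \<real>\<^sub>\<le>\<^sub>0" by (meson openE)
    define r where "r = e / 2"
    have r: "r > 0" "ball z (2 * r) \<inter> \<real>\<^sub>\<le>\<^sub>0 = {}" using e by (auto simp: r_def)
    show "\<exists>r g. r > 0 \<and> ball z r \<subseteq> - \<real>\<^sub>\<le>\<^sub>0 \<and> integrable lborel g \<and>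
       (\<forall>w\<in>ball z r. \<forall>t\<in>space lborel. norm (m t / (of_real t + w)) \<le> g t)"
    proof (intro exI[of _ r] exI[of _ "\<lambda>t. norm (m t) / r"] conjI ballI)
      show "ball z r \<subseteq> - \<real>\<^sub>\<le>\<^sub>0" using e r by (auto simp: r_def subset_iff)
      show "integrable lborel (\<lambda>t. norm (m t) / r)" using m by simp
      show "norm (m t / (of_real t + w)) \<le> norm (m t) / r" if "w \<in> ball z r" for w t
      proof (cases "t > 0")
        case True
        then have "r \<le> norm (of_real t + w)" using norm_add_nonneg_ge[OF r(2) that] by simp
        then show ?thesis unfolding norm_divide using r(1) by (intro divide_left_mono mult_pos_pos) auto
      qed (simp add: m_def)
    qed (use r in auto)
  qed
  moreover have "stieltjesK \<nu> N = (\<lambda>z. \<integral>t. m t / (of_real t + z) \<partial>lborel)"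
    unfolding stieltjesK_def m_def set_lebesgue_integral_def by (simp add: scaleR_conv_of_real)
  ultimately show ?thesis by simp
qed

lemma exp_not_nonpos_Reals: "\<bar>Im \<zeta>\<bar> < pi \<Longrightarrow> exp \<zeta> \<notin> \<real>\<^sub>\<le>\<^sub>0"
proof
  assume *: "\<bar>Im \<zeta>\<bar> < pi" "exp \<zeta> \<in> \<real>\<^sub>\<le>\<^sub>0"
  then have "Ln (exp \<zeta>) = \<zeta>" by (intro Ln_exp) auto
  moreover have "Re (exp \<zeta>) < 0 \<and> Im (exp \<zeta>) = 0"
    using *(2) exp_not_eq_zero[of \<zeta>] by (auto simp: complex_nonpos_Reals_iff complex_eq_iff less_le simp del: exp_not_eq_zero)
  then have "Im (Ln (exp \<zeta>)) = pi" using Im_Ln_eq_pi[of "exp \<zeta>"] by simp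
  ultimately show False using * by simp
qed

text \<open>Both sides are holomorphic in the strip and agree on the real line. Powers of z,
  including the square root, are written as exponentials of \<zeta>, so no choice of branch
  enters.\<close>

lemma besselK_log_stieltjes:
  assumes \<zeta>: "\<bar>Im \<zeta>\<bar> < pi" and \<nu>: "\<bar>Re \<nu>\<bar> < real N + 1/2"
  shows "besselK_log \<nu> \<zeta> = of_real (sqrt (pi / 2)) * exp (- \<zeta> / 2) * exp (- exp \<zeta>) *
    ((\<Sum>k<N. coeff_a \<nu> k * exp (- (of_nat k * \<zeta>))) +
     (-1) ^ N * exp (\<zeta> - of_nat N * \<zeta>) * (cos (of_real pi * \<nu>) * of_real (sqrt (2 / pi) / pi)) * stieltjesK \<nu> N (exp \<zeta>))"
proof -
  define S where "S = {z. Im z < pi} \<inter> {z. - pi < Im z}"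
  have S: "open S" "connected S"
    unfolding S_def by (intro open_Int open_halfspace_Im_lt open_halfspace_Im_gt convex_connected convex_Int convex_halfspace_Im_lt convex_halfspace_Im_gt)+
  define R where "R \<zeta> = of_real (sqrt (pi / 2)) * exp (- \<zeta> / 2) * exp (- exp \<zeta>) *
    ((\<Sum>k<N. coeff_a \<nu> k * exp (- (of_nat k * \<zeta>))) +
     (-1) ^ N * exp (\<zeta> - of_nat N * \<zeta>) * (cos (of_real pi * \<nu>) * of_real (sqrt (2 / pi) / pi)) * stieltjesK \<nu> N (exp \<zeta>))" for \<zeta>
  have "(\<lambda>\<zeta>. stieltjesK \<nu> N (exp \<zeta>)) holomorphic_on S"
  proof -
    have "exp ` S \<subseteq> - \<real>\<^sub>\<le>\<^sub>0" using exp_not_nonpos_Reals by (auto simp: S_def)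
    from holomorphic_on_compose_gen[OF holomorphic_on_exp stieltjesK_holomorphic[OF \<nu>] this]
    show ?thesis by (simp add: o_def)
  qed
  then have hol: "(\<lambda>\<zeta>. besselK_log \<nu> \<zeta> - R \<zeta>) holomorphic_on S"
    unfolding R_def by (intro holomorphic_intros holomorphic_on_subset[OF besselK_log_holomorphic]) auto
  have "besselK_log \<nu> \<zeta> - R \<zeta> = 0"
  proof (rule analytic_continuation[OF hol S, of "range complex_of_real" "of_real 0"])
    show "of_real 0 islimpt range complex_of_real" by (rule real_islimpt_Reals)
    show "\<zeta> \<in> S" using \<zeta> by (auto simp: S_def)
    fix z assume "z \<in> range complex_of_real"
    then obtain t where t: "z = of_real t" by auto
    have e1: "exp (of_real t) = complex_of_real (exp t)" by (simp add: exp_of_real)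
    have e2: "exp (- (of_nat k * complex_of_real t)) = 1 / of_real (exp t) ^ k" for k
      by (simp add: exp_minus exp_of_nat_mult e1 divide_inverse)
    have e3: "exp (complex_of_real t - of_nat N * of_real t) = of_real (exp t / exp t ^ N)"
      by (simp add: exp_diff exp_of_nat_mult e1)
    have sq: "sqrt (pi / (2 * exp t)) = sqrt (pi / 2) * exp (- t / 2)"
    proof (rule real_sqrt_unique)
      have "(exp (- t / 2))\<^sup>2 = exp (- t)" by (simp add: power2_eq_square flip: exp_add)
      then have h: "(exp (- t / 2))\<^sup>2 = inverse (exp t)" by (simp only: exp_minus)
      show "(sqrt (pi / 2) * exp (- t / 2))\<^sup>2 = pi / (2 * exp t)"
        unfolding power_mult_distrib h by (simp add: inverse_eq_divide)
    qed simp
    have "exp (- of_real t / 2) = complex_of_real (exp (- t / 2))"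
      "exp (- of_real (exp t)) = complex_of_real (exp (- exp t))"
      using exp_of_real[of "- t / 2", where 'a = complex] exp_of_real[of "- exp t", where 'a = complex]
      by (simp_all only: of_real_divide of_real_minus of_real_numeral)
    then have e4: "of_real (sqrt (pi / 2)) * exp (- of_real t / 2) * exp (- of_real (exp t)) = complex_of_real (sqrt (pi / (2 * exp t)) * exp (- exp t))"
      by (simp only: sq of_real_mult)
    show "besselK_log \<nu> z - R z = 0"
      unfolding t R_def besselK_log_of_real e1 e2 e3 e4 besselK_stieltjes[OF exp_gt_zero \<nu>] by simp
  qed (auto simp: S_def)
  then show ?thesis by (simp add: R_def)
qed

section \<open>The saddle coordinate\<close>

text \<open>Multiplication by w makes both expansions vanish at 0, whatever \<open>S 0\<close> is,
  so uniqueness of expansions in a full neighbourhood applies to the shifted coefficient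
  sequences.\<close>

lemma power_series_punctured_unique:
  fixes g g' :: "nat \<Rightarrow> complex"
  assumes "\<forall>\<^sub>F w in at 0. (\<lambda>k. g k * w ^ k) sums S w" "\<forall>\<^sub>F w in at 0. (\<lambda>k. g' k * w ^ k) sums S w"
  shows "g = g'"
proof -
  have exp: "(\<lambda>w. w * S w) has_fps_expansion Abs_fps (case_nat 0 a)"
    if "\<forall>\<^sub>F w in at 0. (\<lambda>k. a k * w ^ k) sums S w" for a :: "nat \<Rightarrow> complex"
  proof (rule has_fps_expansionI)
    have 0: "(\<lambda>n. fps_nth (Abs_fps (case_nat 0 a)) n * 0 ^ n) sums (0 * S 0)"
      using powser_sums_zero[of "fps_nth (Abs_fps (case_nat 0 a))"] by simp
    have "\<forall>\<^sub>F w in at 0. (\<lambda>n. fps_nth (Abs_fps (case_nat 0 a)) n * w ^ n) sums (w * S w)"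
      using that
    proof eventually_elim
      case (elim w)
      have "(\<lambda>k. w * (a k * w ^ k)) sums (w * S w)" using elim by (rule sums_mult)
      then have "(\<lambda>k. fps_nth (Abs_fps (case_nat 0 a)) (Suc k) * w ^ Suc k) sums (w * S w)"
        by (simp add: mult_ac)
      then show ?case by (subst (asm) sums_Suc_iff) simp
    qed
    with 0 show "\<forall>\<^sub>F w in nhds 0. (\<lambda>n. fps_nth (Abs_fps (case_nat 0 a)) n * w ^ n) sums (w * S w)"
      by (simp add: eventually_nhds_conv_at)
  qed
  have "Abs_fps (case_nat 0 g) = Abs_fps (case_nat 0 g')"
    by (rule fps_expansion_unique_complex[OF exp[OF assms(1)] exp[OF assms(2)]])
  then have "case_nat 0 g (Suc n) = case_nat 0 g' (Suc n)" for n
    by (metis fps_nth_Abs_fps)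
  then show ?thesis by auto
qed

text \<open>
  A uniformisation of the saddle of \<open>\<tau> - log \<tau> - 1\<close> at \<open>1\<close>: with \<open>w = (\<tau> - 1) G(\<tau>)\<close> the
  exponent becomes \<open>w\<^sup>2 / 2\<close>, and \<open>T\<close> is the inverse function.
\<close>

locale saddle =
  fixes G T :: "complex \<Rightarrow> complex" and r \<rho> :: real
  assumes r: "0 < r" "r \<le> 1/2" and \<rho>: "\<rho> > 0"
    and G_hol: "G holomorphic_on ball 1 r" and G1: "G 1 = 1"
    and G_near: "\<And>z. z \<in> ball 1 r \<Longrightarrow> norm (G z - 1) < 1/2"
    and square: "\<And>z. z \<in> ball 1 r \<Longrightarrow> ((z - 1) * G z)\<^sup>2 = 2 * (z - Ln z - 1)"
    and deriv_w: "\<And>z. z \<in> ball 1 r \<Longrightarrow> ((\<lambda>z. (z - 1) * G z) has_field_derivative 1 / (z * G z)) (at z)"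
    and T_hol: "T holomorphic_on ball 0 \<rho>"
    and T_in: "\<And>w. w \<in> ball 0 \<rho> \<Longrightarrow> T w \<in> ball 1 r"
    and w_T: "\<And>w. w \<in> ball 0 \<rho> \<Longrightarrow> (T w - 1) * G (T w) = w"
    and T_w: "\<And>z. z \<in> ball 1 r \<Longrightarrow> (z - 1) * G z \<in> ball 0 \<rho> \<Longrightarrow> T ((z - 1) * G z) = z"

text \<open>The function 2 (z - Ln z - 1) has a zero of order two at 1, so it is the square of (z -
  1) g(z) with g free of zeros. Its derivative 2 (z - 1) / z determines that of the square
  root.\<close>

lemma square_root_at_saddle:
  obtains G r where "0 < r" "r \<le> 1/2" "G holomorphic_on ball 1 r" "G 1 = 1"
    "\<And>z. z \<in> ball 1 r \<Longrightarrow> norm (G z - 1) < 1/2"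
    "\<And>z. z \<in> ball 1 r \<Longrightarrow> ((z - 1) * G z)\<^sup>2 = 2 * (z - Ln z - 1)"
    "\<And>z. z \<in> ball 1 r \<Longrightarrow> ((\<lambda>z. (z - 1) * G z) has_field_derivative 1 / (z * G z)) (at z)"
proof -
  define f where "f z = 2 * (z - Ln z - 1)" for z :: complex
  have nz: "z \<notin> \<real>\<^sub>\<le>\<^sub>0" "z \<noteq> 0" if "z \<in> ball 1 1" for z :: complex
  proof -
    have "Re (1 - z) < 1" using that complex_Re_le_cmod[of "1 - z"] by (simp add: dist_norm)
    then show "z \<notin> \<real>\<^sub>\<le>\<^sub>0" "z \<noteq> 0" by (auto simp: complex_nonpos_Reals_iff)
  qed
  have df: "(f has_field_derivative 2 * (1 - 1 / z)) (at z)" if "z \<in> ball 1 1" for z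
    unfolding f_def using nz[OF that] by (auto intro!: derivative_eq_intros simp: divide_inverse)
  have hf: "f holomorphic_on ball 1 1"
    using df by (meson holomorphic_onI field_differentiable_at_within field_differentiable_def)
  have d1: "deriv f z = 2 * (1 - 1 / z)" if "z \<in> ball 1 1" for z using df[OF that] by (rule DERIV_imp_deriv)
  have "((\<lambda>z. 2 * (1 - 1 / z)) has_field_derivative 2) (at (1::complex))"
    by (auto intro!: derivative_eq_intros)
  moreover have "\<forall>\<^sub>F z in nhds (1::complex). deriv f z = 2 * (1 - 1 / z)"
    using d1 eventually_nhds_in_open[of "ball 1 1" "1::complex"] by (auto elim!: eventually_mono)
  ultimately have d2: "deriv (deriv f) 1 = 2"
    using deriv_cong_ev[of "deriv f" "\<lambda>z. 2 * (1 - 1 / z)" 1 1] DERIV_imp_deriv by simp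
  obtain g r0 where g: "0 < r0" "g holomorphic_on ball 1 r0"
      "\<And>w. w \<in> ball 1 r0 \<Longrightarrow> f w - f 1 = ((w - 1) * g w)\<^sup>2" "\<And>w. w \<in> ball 1 r0 \<Longrightarrow> g w \<noteq> 0"
  proof (rule holomorphic_factor_order_of_zero_strong[OF hf, of 1 2])
    show "(deriv ^^ 2) f 1 \<noteq> 0" using d2 by (simp add: numeral_2_eq_2)
    show "(deriv ^^ i) f 1 = 0" if "0 < i" "i < 2" for i
    proof -
      have "i = 1" using that by simp
      then show ?thesis using d1[of 1] by simp
    qed
  qed auto
  define r1 where "r1 = min r0 (1/2)"
  have r1: "0 < r1" "r1 \<le> 1/2" "ball 1 r1 \<subseteq> ball 1 r0" "ball 1 r1 \<subseteq> ball (1::complex) 1"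
    using g(1) by (auto simp: r1_def)
  have sq: "((z - 1) * g z)\<^sup>2 = f z" if "z \<in> ball 1 r1" for z
    using g(3)[of z] that r1(3) by (auto simp: f_def)
  have hv: "(\<lambda>z. (z - 1) * g z) holomorphic_on ball 1 r1"
    by (intro holomorphic_intros holomorphic_on_subset[OF g(2)] r1)
  have gh: "g holomorphic_on ball 1 r1" by (intro holomorphic_on_subset[OF g(2)] r1)
  define v' where "v' = deriv (\<lambda>z. (z - 1) * g z)"
  have dv: "((\<lambda>z. (z - 1) * g z) has_field_derivative v' z) (at z)" if "z \<in> ball 1 r1" for z
    unfolding v'_def by (rule holomorphic_derivI[OF hv open_ball that])
  \<comment> \<open>Differentiating the square gives 2 (z - 1) g v' = 2 (z - 1) / z. The factor z -
    1 can be cancelled only off z = 1; the point itself is filled in by continuity.\<close>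
  have prod: "g z * v' z * z = 1" if z: "z \<in> ball 1 r1" "z \<noteq> 1" for z
  proof -
    have "((\<lambda>z. ((z - 1) * g z)\<^sup>2) has_field_derivative 2 * ((z - 1) * g z) * v' z) (at z)"
      using DERIV_power[OF dv[OF z(1)], of 2] by (simp add: mult_ac)
    moreover have "((\<lambda>z. ((z - 1) * g z)\<^sup>2) has_field_derivative 2 * (1 - 1 / z)) (at z)"
      by (rule has_field_derivative_transform_within_open[OF df, of _ "ball 1 r1"]) (use z r1 sq in auto)
    ultimately have *: "2 * ((z - 1) * g z) * v' z = 2 * (1 - 1 / z)" by (rule DERIV_unique)
    have "z \<noteq> 0" using nz[of z] z r1 by auto
    have "(z - 1) * (g z * v' z * z) = z / 2 * (2 * ((z - 1) * g z) * v' z)" by simp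
    also have "\<dots> = (z - 1) * 1" unfolding * using \<open>z \<noteq> 0\<close> by (simp add: field_simps)
    finally have "(z - 1) * (g z * v' z * z) = (z - 1) * 1" .
    with z(2) show ?thesis by (simp only: mult_cancel_left) simp
  qed
  have vhol: "v' holomorphic_on ball 1 r1" unfolding v'_def by (rule holomorphic_deriv[OF hv open_ball])
  have prod1: "g 1 * v' 1 * 1 = 1"
  proof -
    have "isCont (\<lambda>z. g z * v' z * z) 1"
      using gh vhol r1(1) by (intro continuous_intros) (auto simp: continuous_on_eq_continuous_at dest!: holomorphic_on_imp_continuous_on)
    then have "((\<lambda>z. g z * v' z * z) \<longlongrightarrow> g 1 * v' 1 * 1) (at 1)" by (simp add: isCont_def)
    moreover have "((\<lambda>z. g z * v' z * z) \<longlongrightarrow> 1) (at 1)"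
    proof (rule tendsto_eventually)
      show "\<forall>\<^sub>F z in at 1. g z * v' z * z = 1"
        unfolding eventually_at using r1(1) prod by (auto simp: dist_commute intro!: exI[of _ r1])
    qed
    ultimately show ?thesis by (intro tendsto_unique[of "at (1::complex)"]) auto
  qed
  have "((\<lambda>z. (z - 1) * g z) has_field_derivative g 1) (at 1)"
  proof -
    have "(g has_field_derivative deriv g 1) (at 1)" using gh r1(1) by (intro holomorphic_derivI[OF gh]) auto
    then show ?thesis by (auto intro!: derivative_eq_intros)
  qed
  then have "v' 1 = g 1" using dv[of 1] r1(1) by (intro DERIV_unique) auto
  with prod1 have g1: "g 1 = 1 \<or> g 1 = - 1"
    using power2_eq_1_iff[of "g 1"] by (simp add: power2_eq_square)
  \<comment> \<open>Since \<open>g 1\<close> is 1 or -1, the division leaves the square unchanged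
    and fixes the sign so that w ~ z - 1.\<close>
  define G where "G z = g z / g 1" for z
  have G: "G holomorphic_on ball 1 r1" unfolding G_def using g1 by (intro holomorphic_intros gh) auto
  have "isCont G 1" using G r1(1) by (auto simp: continuous_on_eq_continuous_at dest!: holomorphic_on_imp_continuous_on)
  then obtain d where d: "d > 0" "\<And>z. dist z 1 < d \<Longrightarrow> dist (G z) (G 1) < 1/2"
    unfolding continuous_at_eps_delta by (metis half_gt_zero_iff zero_less_one)
  have G1: "G 1 = 1" using g1 by (auto simp: G_def)
  define r where "r = min r1 d"
  have r: "0 < r" "r \<le> 1/2" "ball 1 r \<subseteq> ball 1 r1" using r1 d by (auto simp: r_def)
  show thesis
  proof (rule that[of r G])
    show "G holomorphic_on ball 1 r" using G r(3) by (rule holomorphic_on_subset)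
    fix z assume z: "z \<in> ball (1::complex) r"
    show "norm (G z - 1) < 1/2" using d(2)[of z] z G1 by (simp add: r_def dist_norm norm_minus_commute)
    have z1: "z \<in> ball 1 r1" using z r by auto
    show "((z - 1) * G z)\<^sup>2 = 2 * (z - Ln z - 1)"
      using sq[OF z1] g1 by (auto simp: G_def f_def)
    have pz: "g z * v' z * z = 1" using prod[OF z1] prod1 by (cases "z = 1") auto
    have "((\<lambda>z. (z - 1) * g z / g 1) has_field_derivative v' z / g 1) (at z)"
      by (rule DERIV_cdivide[OF dv[OF z1]])
    moreover have "v' z / g 1 = 1 / (z * G z)"
    proof -
      have "z * g z \<noteq> 0" using pz by auto
      then have "v' z = 1 / (z * g z)" using pz by (simp add: eq_divide_eq mult_ac)
      then show ?thesis using g1 by (auto simp: G_def)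
    qed
    ultimately show "((\<lambda>z. (z - 1) * G z) has_field_derivative 1 / (z * G z)) (at z)"
      by (simp add: G_def)
  qed (use r G1 in auto)
qed

text \<open>The derivative of w at 1 is \<open>G 1\<close> = 1, so w is injective near 1 and its
  open image contains a disc about 0, on which \<open>T\<close> is the inverse.\<close>

lemma saddle_exists: "\<exists>G T r \<rho>. saddle G T r \<rho>"
proof -
  obtain G r0 where G: "0 < r0" "r0 \<le> 1/2" "G holomorphic_on ball 1 r0" "G 1 = 1"
    "\<And>z. z \<in> ball 1 r0 \<Longrightarrow> norm (G z - 1) < 1/2"
    "\<And>z. z \<in> ball 1 r0 \<Longrightarrow> ((z - 1) * G z)\<^sup>2 = 2 * (z - Ln z - 1)"
    "\<And>z. z \<in> ball 1 r0 \<Longrightarrow> ((\<lambda>z. (z - 1) * G z) has_field_derivative 1 / (z * G z)) (at z)"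
    by (rule square_root_at_saddle) blast
  define v where "v z = (z - 1) * G z" for z
  have hv: "v holomorphic_on ball 1 r0" unfolding v_def by (intro holomorphic_intros G)
  have one: "1 \<in> ball (1::complex) r0" using G(1) by simp
  have dv: "deriv v 1 \<noteq> 0" using G(7)[of 1] G(1,4) by (subst DERIV_imp_deriv[of v 1]) (auto simp: v_def[abs_def])
  obtain r where r: "r > 0" "ball 1 r \<subseteq> ball (1::complex) r0" "inj_on v (ball 1 r)"
    by (rule has_complex_derivative_locally_injective[OF hv one open_ball dv]) (rule that)
  have hv': "v holomorphic_on ball 1 r" using hv r(2) by (rule holomorphic_on_subset)
  obtain T where T: "T holomorphic_on (v ` ball 1 r)" "\<And>z. z \<in> ball 1 r \<Longrightarrow> deriv v z * deriv T (v z) = 1"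
      "\<And>z. z \<in> ball 1 r \<Longrightarrow> T (v z) = z"
    by (rule holomorphic_has_inverse[OF hv' open_ball r(3)]) (rule that)
  have "open (v ` ball 1 r)" by (rule open_mapping_thm3[OF hv' open_ball r(3)])
  moreover have "0 \<in> v ` ball 1 r" using r(1) by (intro image_eqI[of _ _ 1]) (auto simp: v_def)
  ultimately obtain \<rho> where \<rho>: "\<rho> > 0" "ball 0 \<rho> \<subseteq> v ` ball 1 r" by (meson openE)
  have "r \<le> r0" using r(1,2) G(1) by (simp add: ball_subset_ball_iff)
  have "saddle G T r \<rho>"
  proof
    show "T holomorphic_on ball 0 \<rho>" using T(1) \<rho>(2) by (rule holomorphic_on_subset)
    show "T w \<in> ball 1 r" "(T w - 1) * G (T w) = w" if "w \<in> ball 0 \<rho>" for w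
    proof -
      have "w \<in> v ` ball 1 r" using that \<rho>(2) by blast
      then obtain z where z: "z \<in> ball 1 r" "w = v z" by blast
      then show "T w \<in> ball 1 r" "(T w - 1) * G (T w) = w" using T(3)[OF z(1)] by (auto simp: v_def)
    qed
    show "T ((z - 1) * G z) = z" if "z \<in> ball 1 r" for z using T(3)[OF that] by (simp add: v_def)
    show "G holomorphic_on ball 1 r" using G(3) r(2) by (rule holomorphic_on_subset)
    fix z :: complex assume "z \<in> ball 1 r"
    then have "z \<in> ball 1 r0" using r(2) by blast
    then show "norm (G z - 1) < 1/2" "((z - 1) * G z)\<^sup>2 = 2 * (z - Ln z - 1)"
      "((\<lambda>z. (z - 1) * G z) has_field_derivative 1 / (z * G z)) (at z)" by (fact G(5-7))+
  qed (use G(2,4) r(1) \<rho>(1) \<open>r \<le> r0\<close> in simp_all)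
  then show ?thesis by blast
qed

section \<open>The coefficients g_k as Taylor coefficients in the saddle coordinate\<close>

context saddle
begin

lemma ball_pos: "z \<in> ball 1 r \<Longrightarrow> Re z > 0"
proof -
  assume "z \<in> ball 1 r"
  then have "Re (1 - z) < 1" using r complex_Re_le_cmod[of "1 - z"] by (simp add: dist_norm)
  then show ?thesis by simp
qed

lemma G_nz: "z \<in> ball 1 r \<Longrightarrow> G z \<noteq> 0"
  using G_near[of z] by auto

lemma ball_nz: "z \<in> ball 1 r \<Longrightarrow> z \<noteq> 0" for z :: complex
  using ball_pos[of z] by auto

lemma T0: "T 0 = 1"
  using T_w[of 1] r \<rho> by simp

lemma T_deriv:
  assumes "w \<in> ball 0 \<rho>"
  shows "(T has_field_derivative T w * G (T w)) (at w)"
proof -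
  have z: "T w \<in> ball 1 r" by (rule T_in[OF assms])
  have "(T has_field_derivative deriv T w) (at w)"
    using assms by (intro holomorphic_derivI[OF T_hol]) auto
  then have "((\<lambda>w. (T w - 1) * G (T w)) has_field_derivative 1 / (T w * G (T w)) * deriv T w) (at w)"
    using DERIV_chain2[where f = "\<lambda>z. (z - 1) * G z" and g = T, OF deriv_w[OF z]] by blast
  moreover have "((\<lambda>w. (T w - 1) * G (T w)) has_field_derivative 1) (at w)"
    by (rule has_field_derivative_transform_within_open[OF DERIV_ident, of "ball 0 \<rho>"]) (use assms w_T in auto)
  ultimately have "1 / (T w * G (T w)) * deriv T w = 1" by (rule DERIV_unique)
  then have "deriv T w = T w * G (T w)" using ball_nz[OF z] G_nz[OF z] by (simp add: field_simps)
  then show ?thesis using \<open>(T has_field_derivative deriv T w) (at w)\<close> by simp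
qed

lemma nz_of_T: "w \<in> ball 0 \<rho> \<Longrightarrow> w \<noteq> 0 \<Longrightarrow> T w \<noteq> 1"
  using w_T by fastforce

lemma tau_branch_T: "tau_branch T"
  unfolding tau_branch_def
proof (intro conjI)
  show "T analytic_on {0}" using T_hol \<rho> by (auto simp: analytic_at intro!: exI[of _ "ball 0 \<rho>"])
  show "T 0 = 1" by (rule T0)
  have ev: "\<forall>\<^sub>F w in at 0. w \<in> ball 0 \<rho>" "\<forall>\<^sub>F w in at (0::complex). w \<noteq> 0"
    using \<rho> by (intro eventually_at_in_open') (auto simp: eventually_at_filter)
  have "isCont G 1" using G_hol r by (auto simp: continuous_on_eq_continuous_at dest!: holomorphic_on_imp_continuous_on)
  moreover have "isCont T 0" using T_hol \<rho> by (auto simp: continuous_on_eq_continuous_at dest!: holomorphic_on_imp_continuous_on)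
  ultimately have "isCont (\<lambda>w. G (T w)) 0" using isCont_o2[of 0 T G] T0 by simp
  then have "((\<lambda>w. G (T w)) \<longlongrightarrow> 1) (at 0)" using T0 G1 by (simp add: isCont_def)
  moreover have "\<forall>\<^sub>F w in at 0. G (T w) = (if w = 0 \<and> T w - 1 = 0 then 1 else w / (T w - 1))"
    using ev
  proof eventually_elim
    case (elim w)
    have "G (T w) = w / (T w - 1)"
      using w_T[OF elim(1)] nz_of_T[OF elim] by (simp add: eq_divide_eq mult.commute)
    with elim(2) show ?case by simp
  qed
  ultimately show "(\<lambda>w. w) \<sim>[at 0] (\<lambda>w. T w - 1)"
    unfolding asymp_equiv_def by (rule Lim_transform_eventually)
  have "\<forall>\<^sub>F w in nhds 0. w \<in> ball 0 \<rho>" using \<rho> by (intro eventually_nhds_in_open) auto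
  then show "\<forall>\<^sub>F w in nhds 0. w\<^sup>2 / 2 = T w - Ln (T w) - 1"
  proof eventually_elim
    case (elim w)
    show ?case using square[OF T_in[OF elim]] unfolding w_T[OF elim] by simp
  qed
qed

text \<open>The squares of (\<tau> - 1) G(\<tau>) and of w agree, so the two differ at most in sign.
  The asymptotic equivalence makes their quotient tend to 1, which excludes the minus sign.\<close>

lemma tau_branch_eq_T:
  assumes "tau_branch \<tau>"
  shows "\<forall>\<^sub>F w in nhds 0. \<tau> w = T w"
proof -
  have an: "\<tau> analytic_on {0}" and \<tau>0: "\<tau> 0 = 1" and as: "(\<lambda>w. w) \<sim>[at 0] (\<lambda>w. \<tau> w - 1)"
    and eq: "\<forall>\<^sub>F w in nhds 0. w\<^sup>2 / 2 = \<tau> w - Ln (\<tau> w) - 1"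
    using assms by (auto simp: tau_branch_def)
  have ct: "isCont \<tau> 0" using an analytic_on_imp_differentiable_at field_differentiable_imp_continuous_at by blast
  then have lim: "(\<tau> \<longlongrightarrow> 1) (at 0)" using \<tau>0 by (simp add: isCont_def)
  have in_ball: "\<forall>\<^sub>F w in at 0. \<tau> w \<in> ball 1 r" using r by (intro topological_tendstoD[OF lim]) auto
  have "isCont G 1" using G_hol r by (auto simp: continuous_on_eq_continuous_at dest!: holomorphic_on_imp_continuous_on)
  then have "isCont (\<lambda>w. G (\<tau> w)) 0" using isCont_o2[of 0 \<tau> G] \<tau>0 ct by simp
  then have l1: "((\<lambda>w. G (\<tau> w)) \<longlongrightarrow> 1) (at 0)" using \<tau>0 G1 by (simp add: isCont_def)
  have "(\<lambda>w. \<tau> w - 1) \<sim>[at 0] (\<lambda>w. w)" using as by (rule asymp_equiv_symI)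
  then have l2: "((\<lambda>w. (\<tau> w - 1) / w) \<longlongrightarrow> 1) (at 0)"
    by (rule asymp_equivD_strong) (auto simp: eventually_at_filter)
  have "((\<lambda>w. (\<tau> w - 1) / w * G (\<tau> w)) \<longlongrightarrow> 1) (at 0)" using tendsto_mult[OF l2 l1] by simp
  then have "\<forall>\<^sub>F w in at 0. dist ((\<tau> w - 1) / w * G (\<tau> w)) 1 < 1" by (rule tendstoD) simp
  moreover have "\<forall>\<^sub>F w in at 0. w\<^sup>2 / 2 = \<tau> w - Ln (\<tau> w) - 1" using eq by (simp add: eventually_nhds_conv_at)
  moreover have "\<forall>\<^sub>F w in at (0::complex). w \<noteq> 0" by (auto simp: eventually_at_filter)
  moreover have "\<forall>\<^sub>F w in at 0. w \<in> ball 0 \<rho>" using \<rho> by (intro eventually_at_in_open') auto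
  ultimately have "\<forall>\<^sub>F w in at 0. \<tau> w = T w"
    using in_ball
  proof eventually_elim
    case (elim w)
    have "((\<tau> w - 1) * G (\<tau> w))\<^sup>2 = w\<^sup>2" using square[OF elim(5)] elim(2) by simp
    then have "(\<tau> w - 1) * G (\<tau> w) = w \<or> (\<tau> w - 1) * G (\<tau> w) = - w" by (simp add: power2_eq_iff)
    moreover have "(\<tau> w - 1) * G (\<tau> w) \<noteq> - w"
    proof
      assume "(\<tau> w - 1) * G (\<tau> w) = - w"
      then have "(\<tau> w - 1) / w * G (\<tau> w) = - 1" using elim(3) by (simp add: field_simps)
      with elim(1) show False by (simp add: dist_norm)
    qed
    ultimately have "(\<tau> w - 1) * G (\<tau> w) = w" by blast
    then show ?case using T_w[OF elim(5)] elim(4) by simp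
  qed
  then show ?thesis using \<tau>0 T0 by (simp add: eventually_nhds_conv_at)
qed

text \<open>
  Since \<open>d\<tau>/dw = \<tau> G(\<tau>)\<close> and \<open>\<tau> - 1 = w / G(\<tau>)\<close>, the function
  \<open>\<tau> powr (\<gamma> - 1) / (1 - \<tau>) * d\<tau>/dw\<close> is \<open>- P \<gamma> w / w\<close>.
\<close>

definition P :: "real \<Rightarrow> complex \<Rightarrow> complex" where
  "P \<gamma> w = T w powr of_real \<gamma> * (G (T w))\<^sup>2"

lemma P_holomorphic: "P \<gamma> holomorphic_on ball 0 \<rho>"
proof -
  have "(\<lambda>w. G (T w)) holomorphic_on ball 0 \<rho>"
    using holomorphic_on_compose_gen[OF T_hol G_hol] T_in by (auto simp: o_def image_subset_iff)
  moreover have "T w \<notin> \<real>\<^sub>\<le>\<^sub>0" if "w \<in> ball 0 \<rho>" for w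
    using ball_pos[OF T_in[OF that]] by (auto simp: complex_nonpos_Reals_iff)
  ultimately show ?thesis
    unfolding P_def by (intro holomorphic_intros T_hol) auto
qed

lemma P0: "P \<gamma> 0 = 1"
  by (simp add: P_def T0 G1)

lemma saddle_integrand:
  assumes w: "w \<in> ball 0 \<rho>" "w \<noteq> 0"
  shows "T w powr of_real (\<gamma> - 1) / (1 - T w) * deriv T w + 1 / w = (1 - P \<gamma> w) / w"
proof -
  have z: "T w \<in> ball 1 r" by (rule T_in[OF w(1)])
  have nz: "T w \<noteq> 0" "G (T w) \<noteq> 0" "T w \<noteq> 1" using ball_nz[OF z] G_nz[OF z] nz_of_T[OF w] by auto
  have "deriv T w = T w * G (T w)" using T_deriv[OF w(1)] by (rule DERIV_imp_deriv)
  moreover have "T w powr of_real (\<gamma> - 1) * T w = T w powr of_real \<gamma>"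
    using nz(1) by (simp add: powr_diff)
  ultimately have "T w powr of_real (\<gamma> - 1) / (1 - T w) * deriv T w = T w powr of_real \<gamma> * G (T w) / (1 - T w)"
    by (simp add: mult_ac)
  also have "\<dots> = - P \<gamma> w / ((T w - 1) * G (T w))"
    using nz by (simp add: P_def power2_eq_square field_simps)
  also have "(T w - 1) * G (T w) = w" by (rule w_T[OF w(1)])
  finally show ?thesis by (simp add: diff_divide_distrib)
qed

text \<open>The function to be expanded is (1 - P) / w with P(0) = 1, so its coefficients are those
  of P with opposite sign and the index lowered by one.\<close>

definition gcoeff :: "real \<Rightarrow> nat \<Rightarrow> complex" where
  "gcoeff \<gamma> k = - ((deriv ^^ Suc k) (P \<gamma>) 0 / fact (Suc k))"

lemma gcoeff_sums:
  assumes w: "w \<in> ball 0 \<rho>" "w \<noteq> 0"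
  shows "(\<lambda>k. gcoeff \<gamma> k * w ^ k) sums ((1 - P \<gamma> w) / w)"
proof -
  have "(\<lambda>n. (deriv ^^ n) (P \<gamma>) 0 / fact n * w ^ n) sums P \<gamma> w"
    using holomorphic_power_series[OF P_holomorphic w(1)] by simp
  then have "(\<lambda>n. (deriv ^^ Suc n) (P \<gamma>) 0 / fact (Suc n) * w ^ Suc n) sums (P \<gamma> w - 1)"
    by (subst sums_Suc_iff) (simp add: P0)
  then have "(\<lambda>n. (- 1 / w) * ((deriv ^^ Suc n) (P \<gamma>) 0 / fact (Suc n) * w ^ Suc n)) sums ((- 1 / w) * (P \<gamma> w - 1))"
    by (rule sums_mult)
  moreover have "(- 1 / w) * ((deriv ^^ Suc n) (P \<gamma>) 0 / fact (Suc n) * w ^ Suc n) = gcoeff \<gamma> n * w ^ n" for n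
    using w(2) by (simp add: gcoeff_def)
  moreover have "(- 1 / w) * (P \<gamma> w - 1) = (1 - P \<gamma> w) / w" by (simp add: diff_divide_distrib)
  ultimately show ?thesis by simp
qed

text \<open>All admissible \<tau> have the same germ at 0 and a punctured expansion has only one
  coefficient sequence, so the definite description in \<open>coeff_g\<close> is well posed.\<close>

lemma coeff_g_eq: "coeff_g \<gamma> = gcoeff \<gamma>"
  unfolding coeff_g_def
proof (rule the_equality)
  have ev: "\<forall>\<^sub>F w in at 0. w \<in> ball 0 \<rho>" "\<forall>\<^sub>F w in at (0::complex). w \<noteq> 0"
    using \<rho> by (intro eventually_at_in_open') (auto simp: eventually_at_filter)
  have sums: "\<forall>\<^sub>F w in at 0. (\<lambda>k. gcoeff \<gamma> k * w ^ k) sums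
           (T w powr of_real (\<gamma> - 1) / (1 - T w) * deriv T w + 1 / w)"
    using ev
  proof eventually_elim
    case (elim w)
    show ?case unfolding saddle_integrand[OF elim] by (rule gcoeff_sums[OF elim])
  qed
  with tau_branch_T show "\<exists>\<tau>. tau_branch \<tau> \<and> (\<forall>\<^sub>F w in at 0. (\<lambda>k. gcoeff \<gamma> k * w ^ k) sums
           (\<tau> w powr of_real (\<gamma> - 1) / (1 - \<tau> w) * deriv \<tau> w + 1 / w))" by blast
  fix g assume "\<exists>\<tau>. tau_branch \<tau> \<and> (\<forall>\<^sub>F w in at 0. (\<lambda>k. g k * w ^ k) sums
           (\<tau> w powr of_real (\<gamma> - 1) / (1 - \<tau> w) * deriv \<tau> w + 1 / w))"
  then obtain \<tau> where \<tau>: "tau_branch \<tau>" and g: "\<forall>\<^sub>F w in at 0. (\<lambda>k. g k * w ^ k) sums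
           (\<tau> w powr of_real (\<gamma> - 1) / (1 - \<tau> w) * deriv \<tau> w + 1 / w)" by blast
  \<comment> \<open>Derivatives are to be compared as well, which takes agreement on a neighbourhood
    of each nearby w and not just at w.\<close>
  have "\<forall>\<^sub>F w in nhds 0. \<forall>\<^sub>F y in nhds w. \<tau> y = T y"
    using tau_branch_eq_T[OF \<tau>] by (simp add: eventually_eventually)
  then have "\<forall>\<^sub>F w in at 0. \<forall>\<^sub>F y in nhds w. \<tau> y = T y" by (simp add: eventually_nhds_conv_at)
  with g have "\<forall>\<^sub>F w in at 0. (\<lambda>k. g k * w ^ k) sums
           (T w powr of_real (\<gamma> - 1) / (1 - T w) * deriv T w + 1 / w)"
  proof eventually_elim
    case (elim w)
    have "deriv \<tau> w = deriv T w" by (rule deriv_cong_ev) (use elim in auto)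
    moreover have "\<tau> w = T w" using elim(2) by (rule eventually_nhds_x_imp_x)
    ultimately show ?case using elim(1) by simp
  qed
  then show "g = gcoeff \<gamma>" using sums by (rule power_series_punctured_unique)
qed

text \<open>As r <= 1/2, the modulus of \<open>T w\<close> lies between 1/2 and 2, and that of
  \<open>G\<close> is at most 3/2. The bound is uniform for |\<gamma>| <= \<Gamma>, as needed
  because \<gamma> varies with x.\<close>

lemma norm_P_le:
  assumes "w \<in> ball 0 \<rho>" "\<bar>\<gamma>\<bar> \<le> \<Gamma>"
  shows "norm (P \<gamma> w) \<le> 2 powr \<Gamma> * (9/4)"
proof -
  have z: "T w \<in> ball 1 r" by (rule T_in[OF assms(1)])
  have n: "norm (T w) \<ge> 1/2" "norm (T w) \<le> 2"
    using z r norm_triangle_ineq2[of 1 "1 - T w"] norm_triangle_ineq2[of "T w" 1] by (auto simp: dist_norm norm_minus_commute)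
  have "\<bar>ln (norm (T w))\<bar> \<le> ln 2"
  proof -
    have "ln (norm (T w)) \<le> ln 2" using n by (subst ln_le_cancel_iff) auto
    moreover have "ln (1/2) \<le> ln (norm (T w))" using n by (subst ln_le_cancel_iff) auto
    ultimately show ?thesis by (simp add: ln_div abs_le_iff)
  qed
  then have "\<bar>\<gamma>\<bar> * \<bar>ln (norm (T w))\<bar> \<le> \<Gamma> * ln 2" using assms(2) by (intro mult_mono) auto
  moreover have "\<gamma> * ln (norm (T w)) \<le> \<bar>\<gamma>\<bar> * \<bar>ln (norm (T w))\<bar>" by (metis abs_ge_self abs_mult)
  ultimately have "norm (T w) powr \<gamma> \<le> 2 powr \<Gamma>" using n by (simp add: powr_def)
  then have 1: "norm (T w powr of_real \<gamma>) \<le> 2 powr \<Gamma>" by (simp add: norm_powr_real_powr')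
  have "norm (G (T w)) \<le> 3/2" using G_near[OF z] norm_triangle_ineq2[of "G (T w)" 1] by simp
  then have "norm (G (T w)) ^ 2 \<le> (3/2) ^ 2" by (intro power_mono) auto
  then have 2: "norm ((G (T w))\<^sup>2) \<le> 9/4" unfolding norm_power by (simp add: power_divide)
  show ?thesis unfolding P_def norm_mult by (intro mult_mono 1 2) auto
qed

lemma norm_gcoeff_le:
  assumes "\<bar>\<gamma>\<bar> \<le> \<Gamma>"
  shows "norm (gcoeff \<gamma> k) \<le> 2 powr \<Gamma> * (9/4) / (\<rho>/2) ^ Suc k"
proof -
  have sub: "cball 0 (\<rho>/2) \<subseteq> ball 0 \<rho>" using \<rho> by auto
  have "norm ((deriv ^^ Suc k) (P \<gamma>) 0) \<le> fact (Suc k) * (2 powr \<Gamma> * (9/4)) / (\<rho>/2) ^ Suc k"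
  proof (rule Cauchy_inequality)
    show "P \<gamma> holomorphic_on ball 0 (\<rho>/2)" using \<rho> by (intro holomorphic_on_subset[OF P_holomorphic]) auto
    show "continuous_on (cball 0 (\<rho>/2)) (P \<gamma>)"
      by (intro holomorphic_on_imp_continuous_on holomorphic_on_subset[OF P_holomorphic] sub)
    show "norm (P \<gamma> x) \<le> 2 powr \<Gamma> * (9/4)" if "norm (0 - x) = \<rho>/2" for x
      using that \<rho> assms by (intro norm_P_le) auto
  qed (use \<rho> in auto)
  then show ?thesis unfolding gcoeff_def norm_minus_cancel norm_divide norm_fact
    by (simp add: pos_divide_le_eq mult_ac del: fact_Suc power_Suc funpow.simps)
qed

end

section \<open>Boundary values at the pole\<close>

text \<open>Passing to -z moves the argument away from the cut at the price of +-i pi; the side of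
  approach, encoded in \<open>s\<close>, decides the sign.\<close>

lemma Ln_near_negative_axis:
  fixes y s :: real and \<eta> :: "nat \<Rightarrow> real"
  assumes y: "y > 0" and s: "s \<in> {1, -1}" and \<eta>: "\<And>n. \<eta> n > 0" "\<eta> \<longlonglongrightarrow> 0"
  shows "(\<lambda>n. Ln (of_real (- y) + \<i> * of_real (s * \<eta> n))) \<longlonglongrightarrow> of_real (ln y) + \<i> * of_real (s * pi)"
proof -
  have *: "Ln (of_real (- y) + \<i> * of_real (s * \<eta> n)) = Ln (of_real y - \<i> * of_real (s * \<eta> n)) + \<i> * of_real (s * pi)" for n
  proof -
    have "of_real y - \<i> * of_real (s * \<eta> n) \<noteq> 0" using y by (auto simp: complex_eq_iff)
    from Ln_minus[OF this] show ?thesis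
      using s \<eta>(1)[of n] y by (auto simp: algebra_simps)
  qed
  have "(\<lambda>n. Ln (of_real y - \<i> * of_real (s * \<eta> n))) \<longlonglongrightarrow> Ln (of_real y - \<i> * of_real (s * 0))"
    using y by (intro tendsto_intros \<eta>) auto
  then have "(\<lambda>n. Ln (of_real y - \<i> * of_real (s * \<eta> n)) + \<i> * of_real (s * pi)) \<longlonglongrightarrow> Ln (of_real y) + \<i> * of_real (s * pi)"
    by (intro tendsto_add tendsto_const) simp
  then show ?thesis unfolding * using y by (simp add: Ln_of_real)
qed

lemma shifted_pole_nonzero: "s \<in> {1, -1} \<Longrightarrow> \<eta> > 0 \<Longrightarrow> of_real y + \<i> * of_real (s * \<eta>) \<noteq> 0"
  for y s \<eta> :: real
  by (auto simp: complex_eq_iff)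

lemma norm_shifted_pole_ge: "norm (of_real y + \<i> * of_real (s * \<eta>)) \<ge> \<bar>y\<bar>" for y s \<eta> :: real
  using abs_Re_le_cmod[of "of_real y + \<i> * of_real (s * \<eta>)"] by simp

text \<open>The shifted logarithm is an antiderivative, because the path keeps a nonzero imaginary
  part and never meets the cut. Its limit is real at b and has imaginary part s pi at a: this is the
  half residue.\<close>

lemma plemelj_pole:
  fixes a b s :: real and \<eta> :: "nat \<Rightarrow> real"
  assumes ab: "a < 1" "1 < b" and s: "s \<in> {1, -1}" and \<eta>: "\<And>n. \<eta> n > 0" "\<eta> \<longlonglongrightarrow> 0"
  shows "(\<lambda>n. LINT t:{a..b}|lborel. 1 / (of_real (t - 1) + \<i> * of_real (s * \<eta> n)))
     \<longlonglongrightarrow> of_real (ln (b - 1) - ln (1 - a)) - \<i> * of_real (s * pi)"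
proof -
  define F where "F n t = Ln (of_real (t - 1) + \<i> * of_real (s * \<eta> n))" for n and t :: real
  have eq: "(LINT t:{a..b}|lborel. 1 / (of_real (t - 1) + \<i> * of_real (s * \<eta> n))) = F n b - F n a" for n
  proof -
    have nz: "of_real (t - 1) + \<i> * of_real (s * \<eta> n) \<noteq> 0" for t by (rule shifted_pole_nonzero[OF s \<eta>(1)])
    have "((\<lambda>t. 1 / (of_real (t - 1) + \<i> * of_real (s * \<eta> n))) has_integral F n b - F n a) {a..b}"
    proof (rule fundamental_theorem_of_calculus)
      fix t assume "t \<in> {a..b}"
      have "of_real (t - 1) + \<i> * of_real (s * \<eta> n) \<notin> \<real>\<^sub>\<le>\<^sub>0"
        using s \<eta>(1)[of n] by (auto simp: complex_nonpos_Reals_iff)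
      then have "((\<lambda>z. Ln (z - 1 + \<i> * of_real (s * \<eta> n))) has_field_derivative
          1 / (of_real (t - 1) + \<i> * of_real (s * \<eta> n))) (at (of_real t))"
        by (auto intro!: derivative_eq_intros simp: divide_inverse)
      from has_vector_derivative_real_field[OF this]
      show "(F n has_vector_derivative 1 / (of_real (t - 1) + \<i> * of_real (s * \<eta> n))) (at t within {a..b})"
        unfolding F_def by (simp add: has_vector_derivative_at_within)
    qed (use ab in auto)
    moreover have "set_integrable lborel {a..b} (\<lambda>t. 1 / (of_real (t - 1) + \<i> * of_real (s * \<eta> n)))"
      using nz by (intro borel_integrable_atLeastAtMost' continuous_intros) auto
    ultimately show ?thesis by (simp add: set_borel_integral_eq_integral integral_unique)
  qed
  have "F n b = Ln (of_real (b - 1) + \<i> * of_real (s * \<eta> n))" for n by (simp add: F_def)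
  moreover have "(\<lambda>n. Ln (of_real (b - 1) + \<i> * of_real (s * \<eta> n))) \<longlonglongrightarrow> Ln (of_real (b - 1) + \<i> * of_real (s * 0))"
    using ab by (intro tendsto_intros \<eta>) (auto simp: complex_nonpos_Reals_iff)
  moreover have "(\<lambda>n. F n a) \<longlonglongrightarrow> of_real (ln (1 - a)) + \<i> * of_real (s * pi)"
    using Ln_near_negative_axis[of "1 - a" s \<eta>] ab s \<eta> unfolding F_def by (simp add: algebra_simps)
  moreover have "Ln (of_real (b - 1)) = of_real (ln (b - 1))" using ab by (intro Ln_of_real) simp
  ultimately have "(\<lambda>n. F n b - F n a) \<longlonglongrightarrow> of_real (ln (b - 1)) - (of_real (ln (1 - a)) + \<i> * of_real (s * pi))"
    by (intro tendsto_diff) auto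
  then show ?thesis unfolding eq by (simp add: algebra_simps)
qed

lemma integrable_indicator_Icc: "integrable lborel (\<lambda>t::real. indicator {a..b} t *\<^sub>R (L::real))"
  by (intro integrable_scaleR_left integrable_real_indicator) (auto simp: emeasure_lborel_Icc_eq)

lemma norm_indicator_scaleR_le:
  fixes f :: "real \<Rightarrow> 'a::real_normed_vector"
  assumes "\<And>t. t \<in> A \<Longrightarrow> norm (f t) \<le> L"
  shows "norm (indicator A t *\<^sub>R f t) \<le> indicator A t *\<^sub>R (L::real)"
    and "norm (indicator A t *\<^sub>R f t) \<le> norm (indicator A t *\<^sub>R (L::real))"
proof -
  have "norm (f t) \<le> \<bar>L\<bar>" if "t \<in> A" using assms[OF that] by simp
  with assms[of t] show "norm (indicator A t *\<^sub>R f t) \<le> indicator A t *\<^sub>R L"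
    "norm (indicator A t *\<^sub>R f t) \<le> norm (indicator A t *\<^sub>R L)"
    by (simp_all add: indicator_def)
qed

text \<open>The Lipschitz bound forces \<open>q 1\<close> = 1. After subtraction of this value the
  quotient is bounded by \<open>L\<close> for all shifts, so dominated convergence applies; the bare
  pole is explicit.\<close>

lemma plemelj:
  fixes a b s L :: real and \<eta> :: "nat \<Rightarrow> real" and q :: "real \<Rightarrow> real"
  assumes ab: "a < 1" "1 < b" and s: "s \<in> {1, -1}" and \<eta>: "\<And>n. \<eta> n > 0" "\<eta> \<longlonglongrightarrow> 0"
    and [measurable]: "q \<in> borel_measurable borel"
    and lip: "\<And>t. t \<in> {a..b} \<Longrightarrow> \<bar>q t - 1\<bar> \<le> L * \<bar>t - 1\<bar>"
  shows "(\<lambda>n. LINT t:{a..b}|lborel. of_real (q t) / (of_real (t - 1) + \<i> * of_real (s * \<eta> n)))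
     \<longlonglongrightarrow> of_real ((LINT t:{a..b}|lborel. (q t - 1) / (t - 1)) + ln (b - 1) - ln (1 - a)) - \<i> * of_real (s * pi)"
proof -
  define D where "D n t = of_real (t - 1) + \<i> * of_real (s * \<eta> n)" for n and t :: real
  have nz: "D n t \<noteq> 0" for n t unfolding D_def by (rule shifted_pole_nonzero[OF s \<eta>(1)])
  have "0 \<le> L * \<bar>b - 1\<bar>" using ab by (intro order.trans[OF abs_ge_zero lip]) auto
  then have "0 \<le> L" using ab by (simp add: zero_le_mult_iff)
  have L: "norm (of_real (q t - 1) / D n t) \<le> L" if "t \<in> {a..b}" for n t
  proof -
    have "\<bar>t - 1\<bar> \<le> norm (D n t)" unfolding D_def by (rule norm_shifted_pole_ge)
    then have "\<bar>q t - 1\<bar> \<le> L * norm (D n t)"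
      using order.trans[OF lip[OF that] mult_left_mono] \<open>0 \<le> L\<close> by blast
    then show ?thesis unfolding norm_divide norm_of_real using nz[of n t] by (simp add: pos_divide_le_eq)
  qed
  have Dm [measurable]: "D n \<in> borel_measurable borel" for n unfolding D_def by measurable
  have "(\<lambda>n. LINT t:{a..b}|lborel. of_real (q t - 1) / D n t) \<longlonglongrightarrow> (LINT t:{a..b}|lborel. complex_of_real ((q t - 1) / (t - 1)))"
    unfolding set_lebesgue_integral_def
  proof (rule integral_dominated_convergence[where w = "\<lambda>t. indicator {a..b} t *\<^sub>R L"])
    show "integrable lborel (\<lambda>t. indicator {a..b} t *\<^sub>R L)" by (rule integrable_indicator_Icc)
    show "AE t in lborel. norm (indicator {a..b} t *\<^sub>R (of_real (q t - 1) / D n t)) \<le> indicator {a..b} t *\<^sub>R L" for n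
      by (intro AE_I2 norm_indicator_scaleR_le(1) L)
    show "AE t in lborel. (\<lambda>n. indicator {a..b} t *\<^sub>R (of_real (q t - 1) / D n t))
        \<longlonglongrightarrow> indicator {a..b} t *\<^sub>R complex_of_real ((q t - 1) / (t - 1))"
      using AE_lborel_singleton[of 1]
    proof eventually_elim
      case (elim t)
      have "(\<lambda>n. of_real (q t - 1) / D n t) \<longlonglongrightarrow> of_real (q t - 1) / (of_real (t - 1) + \<i> * of_real (s * 0))"
        unfolding D_def using elim by (intro tendsto_intros \<eta>(2)) auto
      then show ?case by (intro tendsto_scaleR tendsto_const) simp
    qed
  qed measurable
  moreover have "(\<lambda>n. LINT t:{a..b}|lborel. 1 / D n t) \<longlonglongrightarrow> of_real (ln (b - 1) - ln (1 - a)) - \<i> * of_real (s * pi)"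
    unfolding D_def by (rule plemelj_pole[OF ab s \<eta>])
  moreover have "(LINT t:{a..b}|lborel. of_real (q t) / D n t) =
      (LINT t:{a..b}|lborel. of_real (q t - 1) / D n t) + (LINT t:{a..b}|lborel. 1 / D n t)" for n
  proof -
    have "set_integrable lborel {a..b} (\<lambda>t. of_real (q t - 1) / D n t)"
      unfolding set_integrable_def
    proof (rule Bochner_Integration.integrable_bound[where f = "\<lambda>t. indicator {a..b} t *\<^sub>R L"])
      show "AE t in lborel. norm (indicator {a..b} t *\<^sub>R (of_real (q t - 1) / D n t)) \<le> norm (indicator {a..b} t *\<^sub>R L)"
        by (intro AE_I2 norm_indicator_scaleR_le(2) L)
    qed (rule integrable_indicator_Icc, measurable)
    moreover have "set_integrable lborel {a..b} (\<lambda>t. 1 / D n t)"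
      using nz unfolding D_def by (intro borel_integrable_atLeastAtMost' continuous_intros) auto
    moreover have "of_real (q t) / D n t = of_real (q t - 1) / D n t + 1 / D n t" for t
      by (simp add: diff_divide_distrib)
    ultimately show ?thesis by (simp only: set_integral_add(2))
  qed
  ultimately have "(\<lambda>n. LINT t:{a..b}|lborel. of_real (q t) / D n t) \<longlonglongrightarrow>
     (LINT t:{a..b}|lborel. complex_of_real ((q t - 1) / (t - 1))) + (of_real (ln (b - 1) - ln (1 - a)) - \<i> * of_real (s * pi))"
    by (simp only: tendsto_add)
  moreover have "(LINT t:{a..b}|lborel. complex_of_real ((q t - 1) / (t - 1))) = of_real (LINT t:{a..b}|lborel. (q t - 1) / (t - 1))"
    by (rule set_integral_complex_of_real)
  ultimately show ?thesis unfolding D_def by (simp add: algebra_simps)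
qed

context saddle
begin

text \<open>The coordinate w on the real axis. Taking the real part of \<open>G\<close> makes it a
  real function; nothing is lost, since \<open>G\<close> is real there.\<close>

definition V :: "real \<Rightarrow> real" where "V t = (t - 1) * Re (G (of_real t))"

lemma real_in_ball: "\<bar>t - 1\<bar> < r \<Longrightarrow> complex_of_real t \<in> ball 1 r"
  using dist_of_real[of 1 t, where 'a = complex] by (simp add: dist_real_def abs_minus_commute)

text \<open>For real t the square of (t - 1) G(t) is a nonnegative real number, hence (t - 1) G(t)
  is real.\<close>

lemma G_real: "complex_of_real (Re (G (of_real t))) = G (of_real t)" if t: "\<bar>t - 1\<bar> < r"
proof (cases "t = 1")
  case False
  have t0: "t > 0" using t r by (auto simp: abs_less_iff)
  define X where "X = (of_real t - 1) * G (of_real t)"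
  have "X\<^sup>2 = of_real (2 * (t - ln t - 1))"
    unfolding X_def square[OF real_in_ball[OF t]] using t0 by (simp add: Ln_of_real)
  moreover have "2 * (t - ln t - 1) \<ge> 0" using ln_le_minus_one[OF t0] by simp
  ultimately have "X\<^sup>2 = (of_real (sqrt (2 * (t - ln t - 1))))\<^sup>2"
    by (simp only: of_real_power[symmetric] real_sqrt_pow2)
  then have "Im X = 0" by (auto simp: power2_eq_iff)
  then have "Im (G (of_real t)) = 0" using False by (simp add: X_def)
  then show ?thesis by (simp add: complex_eq_iff)
qed (simp add: G1)

lemma Re_G_pos: "\<bar>t - 1\<bar> < r \<Longrightarrow> Re (G (of_real t)) > 1/2"
proof -
  assume "\<bar>t - 1\<bar> < r"
  then have "norm (G (of_real t) - 1) < 1/2" by (intro G_near real_in_ball)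
  moreover have "\<bar>Re (G (of_real t)) - 1\<bar> \<le> norm (G (of_real t) - 1)"
    using abs_Re_le_cmod[of "G (of_real t) - 1"] by simp
  ultimately show ?thesis by linarith
qed

lemma of_real_V: "\<bar>t - 1\<bar> < r \<Longrightarrow> complex_of_real (V t) = (of_real t - 1) * G (of_real t)"
  by (simp add: V_def G_real)

lemma V_square: "\<bar>t - 1\<bar> < r \<Longrightarrow> (V t)\<^sup>2 = 2 * (t - ln t - 1)"
proof -
  assume t: "\<bar>t - 1\<bar> < r"
  then have t0: "t > 0" using r by (auto simp: abs_less_iff)
  have "complex_of_real ((V t)\<^sup>2) = of_real (2 * (t - ln t - 1))"
    unfolding of_real_power of_real_V[OF t] square[OF real_in_ball[OF t]] using t0 by (simp add: Ln_of_real)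
  then show ?thesis by (simp only: of_real_eq_iff)
qed

definition dG :: "real \<Rightarrow> real" where "dG t = Re (deriv G (of_real t))"

lemma Re_G_deriv: "\<bar>t - 1\<bar> < r \<Longrightarrow> ((\<lambda>t. Re (G (of_real t))) has_real_derivative dG t) (at t)"
  unfolding dG_def using holomorphic_derivI[OF G_hol open_ball real_in_ball]
  by (intro has_field_derivative_Re has_vector_derivative_real_field)

lemma V_deriv: "\<bar>t - 1\<bar> < r \<Longrightarrow> (V has_real_derivative 1 / (t * Re (G (of_real t)))) (at t)"
proof -
  assume t: "\<bar>t - 1\<bar> < r"
  have "((\<lambda>t. Re ((of_real t - 1) * G (of_real t))) has_real_derivative Re (1 / (of_real t * G (of_real t)))) (at t)"
    by (intro has_field_derivative_Re has_vector_derivative_real_field[OF deriv_w[OF real_in_ball[OF t]]])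
  moreover have "Re (1 / (of_real t * G (of_real t))) = 1 / (t * Re (G (of_real t)))"
  proof -
    have "of_real t * G (of_real t) = complex_of_real (t * Re (G (of_real t)))"
      using G_real[OF t] by simp
    then have "1 / (of_real t * G (of_real t)) = complex_of_real (1 / (t * Re (G (of_real t))))" by simp
    then show ?thesis by (simp only: Re_complex_of_real)
  qed
  ultimately show ?thesis by (simp add: V_def[abs_def])
qed

text \<open>Comparing the two forms of the derivative splits V'/V into the pole 1/(t-1) and the
  regular part G'/G.\<close>

lemma V_deriv_eq: "\<bar>t - 1\<bar> < r \<Longrightarrow> 1 / (t * Re (G (of_real t))) = Re (G (of_real t)) + (t - 1) * dG t"
proof -
  assume t: "\<bar>t - 1\<bar> < r"
  have "(V has_real_derivative Re (G (of_real t)) + (t - 1) * dG t) (at t)"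
    unfolding V_def[abs_def] by (rule derivative_eq_intros Re_G_deriv[OF t] refl | simp)+
  with V_deriv[OF t] show ?thesis by (rule DERIV_unique)
qed

text \<open>The intermediate value theorem chooses the ends so that w runs between -\<delta> and
  \<delta>: on a symmetric interval odd integrands drop out. The bound \<rho>/8 keeps w well inside
  the disc of convergence.\<close>

lemma interval_exists:
  obtains a b \<delta> where "1 - r < a" "a < 1" "1 < b" "b < 1 + r" "V a = - \<delta>" "V b = \<delta>" "0 < \<delta>" "\<delta> \<le> \<rho> / 8"
proof -
  have near: "\<bar>t - 1\<bar> < r" if "t \<in> {1 - r/2..1 + r/2}" for t
    using that r unfolding atLeastAtMost_iff abs_less_iff by linarith
  have cont: "continuous_on {1 - r/2..1 + r/2} V"
    by (rule DERIV_continuous_on[OF has_field_derivative_at_within[OF V_deriv[OF near]]])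
  have V1: "V 1 = 0" by (simp add: V_def)
  define \<delta> where "\<delta> = min (\<rho>/8) (min (V (1 + r/2)) (- V (1 - r/2)))"
  have "V (1 + r/2) > 0" "V (1 - r/2) < 0"
    using Re_G_pos[OF near, of "1 + r/2"] Re_G_pos[OF near, of "1 - r/2"] r by (auto simp: V_def mult_less_0_iff)
  then have \<delta>: "\<delta> > 0" "\<delta> \<le> \<rho>/8" "\<delta> \<le> V (1 + r/2)" "\<delta> \<le> - V (1 - r/2)" using \<rho> by (auto simp: \<delta>_def)
  have "\<exists>b. 1 \<le> b \<and> b \<le> 1 + r/2 \<and> V b = \<delta>"
    by (rule IVT') (use \<delta> r V1 in \<open>auto intro: continuous_on_subset[OF cont]\<close>)
  then obtain b where b: "1 \<le> b" "b \<le> 1 + r/2" "V b = \<delta>" by blast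
  have "\<exists>a. 1 - r/2 \<le> a \<and> a \<le> 1 \<and> V a = - \<delta>"
    by (rule IVT') (use \<delta> r V1 in \<open>auto intro: continuous_on_subset[OF cont]\<close>)
  then obtain a where a: "1 - r/2 \<le> a" "a \<le> 1" "V a = - \<delta>" by blast
  have "a \<noteq> 1" "b \<noteq> 1" using a b \<delta>(1) by (auto simp: V_def)
  then show thesis using that[of a b \<delta>] a b \<delta> r by auto
qed

definition h :: "real \<Rightarrow> real \<Rightarrow> complex" where
  "h \<gamma> w = (\<Sum>k. gcoeff \<gamma> k * of_real w ^ k)"

lemma gcoeff_summable: "\<bar>w\<bar> < \<rho> \<Longrightarrow> summable (\<lambda>k. gcoeff \<gamma> k * of_real w ^ k)"
proof (cases "w = 0")
  case False
  assume "\<bar>w\<bar> < \<rho>"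
  with False show ?thesis by (intro sums_summable[OF gcoeff_sums]) auto
qed (use summable_0_powser[of "gcoeff \<gamma>"] in simp)

lemma h_eq: "\<bar>w\<bar> < \<rho> \<Longrightarrow> w \<noteq> 0 \<Longrightarrow> h \<gamma> w = (1 - P \<gamma> (of_real w)) / of_real w"
  unfolding h_def by (intro sums_unique[symmetric] gcoeff_sums) auto

lemma h_continuous: "continuous_on {-\<rho>/2..\<rho>/2} (h \<gamma>)"
proof (rule continuous_at_imp_continuous_on, intro ballI)
  fix w assume w: "w \<in> {-\<rho>/2..\<rho>/2}"
  have "isCont (\<lambda>z. \<Sum>k. gcoeff \<gamma> k * z ^ k) (of_real w)"
    by (rule isCont_powser[OF gcoeff_summable, of "3 * \<rho>/4"]) (use w \<rho> in \<open>auto simp: abs_le_iff\<close>)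
  then show "isCont (h \<gamma>) w" unfolding h_def[abs_def]
    using isCont_o2[of w complex_of_real "\<lambda>z. \<Sum>k. gcoeff \<gamma> k * z ^ k"] by simp
qed

lemma P_V:
  assumes "\<bar>t - 1\<bar> < r" "\<bar>V t\<bar> < \<rho>"
  shows "P \<gamma> (of_real (V t)) = of_real (t powr \<gamma> * (Re (G (of_real t)))\<^sup>2)"
proof -
  have "T (of_real (V t)) = of_real t"
    unfolding of_real_V[OF assms(1)] using assms
    by (intro T_w real_in_ball) (simp_all add: of_real_V[symmetric])
  moreover have "t > 0" using assms r by (auto simp: abs_less_iff)
  ultimately show ?thesis unfolding P_def by (simp add: powr_of_real G_real[OF assms(1)])
qed

end

locale saddle_interval = saddle +
  fixes a b \<delta> :: real
  assumes ab: "1 - r < a" "a < 1" "1 < b" "b < 1 + r"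
    and V_ends: "V a = - \<delta>" "V b = \<delta>" and \<delta>: "0 < \<delta>" "\<delta> \<le> \<rho> / 8"
begin

lemma near: "t \<in> {a..b} \<Longrightarrow> \<bar>t - 1\<bar> < r"
  using ab by (auto simp: abs_less_iff)

lemma V_range: "V ` {a..b} \<subseteq> {-\<delta>..\<delta>}"
proof -
  have pos: "0 \<le> 1 / (t * Re (G (of_real t)))" if "t \<in> {a..b}" for t
    using Re_G_pos[OF near[OF that]] that ab r by auto
  have mono: "V u \<le> V v" if "a \<le> u" "u \<le> v" "v \<le> b" for u v
  proof (rule DERIV_nonneg_imp_nondecreasing[OF that(2)])
    fix t assume "u \<le> t" "t \<le> v"
    then have "t \<in> {a..b}" using that by simp
    then show "\<exists>y. (V has_real_derivative y) (at t) \<and> y \<ge> 0" using V_deriv[OF near] pos by blast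
  qed
  show ?thesis
  proof (rule image_subsetI)
    fix t assume "t \<in> {a..b}"
    then show "V t \<in> {-\<delta>..\<delta>}" using mono[of a t] mono[of t b] V_ends by simp
  qed
qed

text \<open>Write e = exp (-x V^2) and K = V'/V, so that q/(t-1) = e K P and K = 1/(t-1) + G'/G.
  Then (q-1)/(t-1) = (e-1) K + G'/G - e K (1-P). In the coordinate w the first part is odd, the
  second integrates to logarithms at the ends, and the third is the integrand with the regular
  series \<open>h\<close>.\<close>

lemma principal_value:
  fixes x \<gamma> :: real
  assumes x: "x > 0"
  defines "q \<equiv> \<lambda>t. exp (- 2 * x * (t - ln t - 1)) * t powr (\<gamma> - 1)"
  shows "((\<lambda>t. complex_of_real ((q t - 1) / (t - 1))) has_integral
     of_real (ln (1 - a) - ln (b - 1)) - integral {-\<delta>..\<delta>} (\<lambda>w. of_real (exp (- x * w\<^sup>2)) * h \<gamma> w)) {a..b}"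
proof -
  define g where "g t = Re (G (of_real t))" for t
  define f1 where "f1 w = (exp (- x * w\<^sup>2) - 1) / w" for w :: real
  define f2 where "f2 w = of_real (exp (- x * w\<^sup>2)) * h \<gamma> w" for w :: real
  have gpos: "g t > 1/2" if "t \<in> {a..b}" for t using Re_G_pos[OF near[OF that]] by (simp add: g_def)
  have tpos: "t > 0" if "t \<in> {a..b}" for t using that ab r by auto
  \<comment> \<open>Division by zero gives \<open>f1 0\<close> the value 0, which is also the limit
    of \<open>f1\<close> there.\<close>
  have cf1: "continuous_on {-\<delta>..\<delta>} f1"
  proof (rule continuous_at_imp_continuous_on, intro ballI)
    fix w :: real
    show "isCont f1 w"
    proof (cases "w = 0")
      case False
      then show ?thesis unfolding f1_def by (intro continuous_intros)
    next
      case True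
      have "\<bar>f1 w\<bar> \<le> x * \<bar>w\<bar>" for w
      proof (cases "w = 0")
        case False
        have "exp (- x * w\<^sup>2) \<le> 1" using x by simp
        moreover have "1 + (- x * w\<^sup>2) \<le> exp (- x * w\<^sup>2)" by (rule exp_ge_add_one_self)
        ultimately have "\<bar>exp (- x * w\<^sup>2) - 1\<bar> \<le> x * w\<^sup>2" by (simp add: abs_le_iff)
        then have "\<bar>f1 w\<bar> \<le> x * w\<^sup>2 / \<bar>w\<bar>" unfolding f1_def abs_divide by (rule divide_right_mono) simp
        also have "x * w\<^sup>2 / \<bar>w\<bar> = x * \<bar>w\<bar>" using False by (simp add: power2_eq_square abs_mult[symmetric] field_simps)
        finally show ?thesis .
      qed (simp add: f1_def)
      moreover have "((\<lambda>w. x * \<bar>w\<bar>) \<longlongrightarrow> x * \<bar>0\<bar>) (at 0)" by (intro tendsto_intros)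
      ultimately have "(f1 \<longlongrightarrow> 0) (at 0)"
        by (intro Lim_null_comparison[of f1 "\<lambda>w. x * \<bar>w\<bar>"]) auto
      then show ?thesis using True by (simp add: isCont_def f1_def)
    qed
  qed
  have cf2: "continuous_on {-\<delta>..\<delta>} f2"
    unfolding f2_def using \<delta> \<rho> by (intro continuous_intros continuous_on_subset[OF h_continuous]) auto
  have dV: "(V has_real_derivative 1 / (t * g t)) (at t within {a..b})" if "t \<in> {a..b}" for t
    using V_deriv[OF near[OF that]] unfolding g_def by (rule has_field_derivative_at_within)
  have "integral {-\<delta>..\<delta>} f1 = - integral {-\<delta>..\<delta>} f1"
  proof -
    have "integral {-\<delta>..\<delta>} f1 = integral {-\<delta>..\<delta>} (\<lambda>w. f1 (- w))" using Henstock_Kurzweil_Integration.integral_reflect_real[of \<delta> "- \<delta>" f1] by simp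
    also have "(\<lambda>w. f1 (- w)) = (\<lambda>w. - f1 w)" by (simp add: f1_def fun_eq_iff)
    finally show ?thesis by simp
  qed
  then have z1: "integral {-\<delta>..\<delta>} f1 = 0" by simp
  have I1: "((\<lambda>t. (1 / (t * g t)) *\<^sub>R f1 (V t)) has_integral 0) {a..b}"
    using has_integral_substitution[OF _ _ V_range cf1 dV] ab V_ends \<delta> z1 by simp
  have I2: "((\<lambda>t. (1 / (t * g t)) *\<^sub>R f2 (V t)) has_integral integral {-\<delta>..\<delta>} f2) {a..b}"
    using has_integral_substitution[OF _ _ V_range cf2 dV] ab V_ends \<delta> by simp
  have I3: "((\<lambda>t. dG t / g t) has_integral ln (g b) - ln (g a)) {a..b}"
  proof (rule fundamental_theorem_of_calculus)
    fix t assume t: "t \<in> {a..b}"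
    have "((\<lambda>t. ln (g t)) has_real_derivative dG t / g t) (at t)"
      using DERIV_chain2[where f = ln and g = g, OF DERIV_ln_divide Re_G_deriv[OF near[OF t], folded g_def[abs_def]]]
        gpos[OF t] by simp
    then show "((\<lambda>t. ln (g t)) has_vector_derivative dG t / g t) (at t within {a..b})"
      by (simp add: has_real_derivative_iff_has_vector_derivative has_vector_derivative_at_within)
  qed (use ab in auto)
  \<comment> \<open>At the ends (b - 1) g(b) and (1 - a) g(a) both equal \<delta>, so \<delta> drops
    out of the difference.\<close>
  have lng: "ln (g b) - ln (g a) = ln (1 - a) - ln (b - 1)"
  proof -
    have "g b = \<delta> / (b - 1)" "g a = \<delta> / (1 - a)"
      using V_ends ab unfolding V_def g_def by (auto simp: field_simps)
    then show ?thesis using \<delta> ab by (simp add: ln_div)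
  qed
  have "((\<lambda>t. complex_of_real ((1 / (t * g t)) *\<^sub>R f1 (V t)) + of_real (dG t / g t) - (1 / (t * g t)) *\<^sub>R f2 (V t))
      has_integral (of_real 0 + of_real (ln (g b) - ln (g a)) - integral {-\<delta>..\<delta>} f2)) {a..b}"
    by (intro has_integral_diff has_integral_add has_integral_of_real I1 I2 I3)
  then have "((\<lambda>t. complex_of_real ((q t - 1) / (t - 1))) has_integral
      (of_real 0 + of_real (ln (g b) - ln (g a)) - integral {-\<delta>..\<delta>} f2)) {a..b}"
  proof (rule has_integral_spike_finite[of "{1}", rotated 2])
    fix t assume "t \<in> {a..b} - {1}"
    then have t: "t \<in> {a..b}" "t \<noteq> 1" by auto
    have g0: "g t \<noteq> 0" "t \<noteq> 0" using gpos[OF t(1)] tpos[OF t(1)] by auto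
    have V0: "V t \<noteq> 0" using g0 t by (simp add: V_def g_def)
    have Vb: "\<bar>V t\<bar> < \<rho>" using V_range t(1) \<delta> \<rho> by (force simp: abs_less_iff image_subset_iff)
    define e where "e = exp (- x * (V t)\<^sup>2)"
    \<comment> \<open>The logarithmic derivative V'/V at t.\<close>
    define K where "K = 1 / (t * g t) / V t"
    have e: "exp (- 2 * x * (t - ln t - 1)) = e"
      unfolding e_def V_square[OF near[OF t(1)]] by (simp add: algebra_simps)
    have K1: "K = 1 / (t - 1) + dG t / g t"
    proof -
      have "K = (g t + (t - 1) * dG t) / ((t - 1) * g t)"
        using V_deriv_eq[OF near[OF t(1)]] unfolding K_def V_def g_def by simp
      also have "\<dots> = 1 / (t - 1) + dG t / g t" using t(2) g0 by (simp add: field_simps)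
      finally show ?thesis .
    qed
    have K2: "K * (t powr \<gamma> * (g t)\<^sup>2) = t powr (\<gamma> - 1) / (t - 1)"
      using t g0 tpos[OF t(1)] unfolding K_def V_def g_def[symmetric]
      by (simp add: powr_diff power2_eq_square)
    have "(1 / (t * g t)) *\<^sub>R f2 (V t) = of_real (e * (K - K * (t powr \<gamma> * (g t)\<^sup>2)))"
      unfolding f2_def h_eq[OF Vb V0] P_V[OF near[OF t(1)] Vb] e_def K_def g_def
      by (simp add: scaleR_conv_of_real algebra_simps diff_divide_distrib)
    moreover have "(1 / (t * g t)) *\<^sub>R f1 (V t) = (e - 1) * K"
      unfolding f1_def e_def K_def by simp
    moreover have "(q t - 1) / (t - 1) = (e - 1) * K + dG t / g t - e * (K - K * (t powr \<gamma> * (g t)\<^sup>2))"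
      unfolding K2 unfolding q_def e K1 by (simp add: algebra_simps diff_divide_distrib)
    ultimately show "complex_of_real ((q t - 1) / (t - 1)) =
       complex_of_real ((1 / (t * g t)) *\<^sub>R f1 (V t)) + of_real (dG t / g t) - (1 / (t * g t)) *\<^sub>R f2 (V t)"
      by (simp only: of_real_add of_real_diff)
  qed simp
  then show ?thesis by (simp add: lng f2_def[abs_def])
qed

text \<open>The numerator is 1 at t = 1 and has a bounded derivative on [a,b]. The logarithms of the
  pole formula cancel those of the principal value, so that the limit no longer contains a and b
  explicitly.\<close>

lemma plemelj_saddle:
  fixes x \<gamma> s :: real and \<eta> :: "nat \<Rightarrow> real"
  assumes x: "x > 0" and s: "s \<in> {1, -1}" and \<eta>: "\<And>n. \<eta> n > 0" "\<eta> \<longlonglongrightarrow> 0"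
  shows "(\<lambda>n. LINT t:{a..b}|lborel. of_real (exp (- 2 * x * (t - ln t - 1)) * t powr (\<gamma> - 1)) /
             (of_real (t - 1) + \<i> * of_real (s * \<eta> n)))
     \<longlonglongrightarrow> - integral {-\<delta>..\<delta>} (\<lambda>w. of_real (exp (- x * w\<^sup>2)) * h \<gamma> w) - \<i> * of_real (s * pi)"
proof -
  define q where "q t = exp (- 2 * x * (t - ln t - 1)) * t powr (\<gamma> - 1)" for t
  define q' where "q' t = - 2 * x * (1 - 1 / t) * q t + exp (- 2 * x * (t - ln t - 1)) * ((\<gamma> - 1) * t powr (\<gamma> - 2))" for t
  have tpos: "t > 0" if "t \<in> {a..b}" for t using that ab r by auto
  have [measurable]: "q \<in> borel_measurable borel" unfolding q_def by measurable
  have dq: "(q has_real_derivative q' t) (at t)" if "t \<in> {a..b}" for t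
    unfolding q_def q'_def using tpos[OF that]
    by (auto intro!: derivative_eq_intros simp: divide_simps) (simp add: algebra_simps)?
  have "continuous_on {a..b} q'"
    unfolding q'_def q_def using tpos by (intro continuous_intros) force+
  then have "bounded (q' ` {a..b})" by (intro compact_imp_bounded compact_continuous_image) auto
  then obtain L where "\<forall>y\<in>q' ` {a..b}. norm y \<le> L" unfolding bounded_iff by blast
  then have L: "\<bar>q' t\<bar> \<le> L" if "t \<in> {a..b}" for t using that by simp
  have lip: "\<bar>q t - 1\<bar> \<le> L * \<bar>t - 1\<bar>" if "t \<in> {a..b}" for t
  proof -
    have "norm (q t - q 1) \<le> L * norm (t - 1)"
      by (rule field_differentiable_bound[where S = "{a..b}" and f' = q'])
         (use that ab L dq in \<open>auto intro: has_field_derivative_at_within\<close>)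
    then show ?thesis by (simp add: q_def)
  qed
  have int: "set_integrable lborel {a..b} (\<lambda>t. (q t - 1) / (t - 1))"
    unfolding set_integrable_def
  proof (rule Bochner_Integration.integrable_bound[where f = "\<lambda>t. indicator {a..b} t *\<^sub>R L"])
    have "\<bar>(q t - 1) / (t - 1)\<bar> \<le> L" if "t \<in> {a..b}" for t
      using lip[OF that] order.trans[OF abs_ge_zero L[OF that]]
      by (cases "t = 1") (auto simp: abs_divide pos_divide_le_eq)
    then show "AE t in lborel. norm (indicator {a..b} t *\<^sub>R ((q t - 1) / (t - 1))) \<le> norm (indicator {a..b} t *\<^sub>R L)"
      by (intro AE_I2 norm_indicator_scaleR_le(2)) simp
  qed (rule integrable_indicator_Icc, measurable)
  have "complex_of_real (LINT t:{a..b}|lborel. (q t - 1) / (t - 1)) =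
      of_real (ln (1 - a) - ln (b - 1)) - integral {-\<delta>..\<delta>} (\<lambda>w. of_real (exp (- x * w\<^sup>2)) * h \<gamma> w)"
  proof -
    have "((\<lambda>t. (q t - 1) / (t - 1)) has_integral (LINT t:{a..b}|lborel. (q t - 1) / (t - 1))) {a..b}"
      using set_borel_integral_eq_integral[OF int] by (simp add: has_integral_integral)
    from has_integral_of_real[OF this] principal_value[OF x, of \<gamma>] show ?thesis
      unfolding q_def by (rule has_integral_unique)
  qed
  then show ?thesis
    using plemelj[OF ab(2,3) s \<eta> _ lip] unfolding q_def[symmetric] by simp
qed

end

section \<open>Laplace's method for the regular part\<close>

text \<open>Scaling by sqrt x reduces this to the standard moment, in which (2k)! / (4^k k!) =
  (1/2)_k.\<close>

lemma gaussian_even_moment: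
  assumes x: "x > 0"
  shows "has_bochner_integral lborel (\<lambda>w::real. indicator {0..} w *\<^sub>R (exp (- x * w\<^sup>2) * w ^ (2 * k)))
     (sqrt pi / 2 * pochhammer (1/2) k / (x ^ k * sqrt x))"
proof -
  have "has_bochner_integral lborel (\<lambda>w. indicator {0..} (0 + sqrt x * w) *\<^sub>R (exp (- (0 + sqrt x * w)\<^sup>2) * (0 + sqrt x * w) ^ (2 * k)))
     ((sqrt pi / 2 * (fact (2 * k) / (2 ^ (2 * k) * fact k))) /\<^sub>R \<bar>sqrt x\<bar>)"
    using gaussian_moment_even_pos[of k] x
    by (subst lborel_has_bochner_integral_real_affine_iff[of "sqrt x" _ _ 0, symmetric]) auto
  then have "has_bochner_integral lborel (\<lambda>w. (indicator {0..} (0 + sqrt x * w) *\<^sub>R (exp (- (0 + sqrt x * w)\<^sup>2) * (0 + sqrt x * w) ^ (2 * k))) * (1 / x ^ k))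
     (((sqrt pi / 2 * (fact (2 * k) / (2 ^ (2 * k) * fact k))) /\<^sub>R \<bar>sqrt x\<bar>) * (1 / x ^ k))"
    by (rule has_bochner_integral_mult_left)
  moreover have "(indicator {0..} (0 + sqrt x * w) *\<^sub>R (exp (- (0 + sqrt x * w)\<^sup>2) * (0 + sqrt x * w) ^ (2 * k))) * (1 / x ^ k)
      = indicator {0..} w *\<^sub>R (exp (- x * w\<^sup>2) * w ^ (2 * k))" for w
  proof -
    have "(sqrt x * w) ^ (2 * k) = x ^ k * w ^ (2 * k)"
      using x by (simp add: power_mult_distrib power_mult)
    moreover have "(sqrt x * w)\<^sup>2 = x * w\<^sup>2" using x by (simp add: power_mult_distrib)
    ultimately show ?thesis using x by (simp add: indicator_def zero_le_mult_iff)
  qed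
  moreover have "((sqrt pi / 2 * (fact (2 * k) / (2 ^ (2 * k) * fact k))) /\<^sub>R \<bar>sqrt x\<bar>) * (1 / x ^ k)
      = sqrt pi / 2 * pochhammer (1/2) k / (x ^ k * sqrt x)"
  proof -
    have f: "fact (2 * k) / (2 ^ (2 * k) * fact k) = (pochhammer (1/2) k :: real)"
      by (simp only: fact_double) simp
    show ?thesis unfolding f using x by (simp add: inverse_eq_divide)
  qed
  ultimately show ?thesis by (simp only:)
qed

lemma sum_even_part:
  fixes g :: "nat \<Rightarrow> 'a::comm_ring_1"
  shows "(\<Sum>j<2*M. g j * w ^ j) + (\<Sum>j<2*M. g j * (- w) ^ j) = 2 * (\<Sum>k<M. g (2 * k) * w ^ (2 * k))"
  by (induction M) (simp_all add: algebra_simps)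

context saddle
begin

lemma norm_gcoeff_term_le:
  assumes "\<bar>\<gamma>\<bar> \<le> \<Gamma>"
  shows "norm (gcoeff \<gamma> k * of_real w ^ k) \<le> 2 powr \<Gamma> * (9/2) / \<rho> * (2 * \<bar>w\<bar> / \<rho>) ^ k"
proof -
  have "norm (gcoeff \<gamma> k * of_real w ^ k) \<le> 2 powr \<Gamma> * (9/4) / (\<rho>/2) ^ Suc k * \<bar>w\<bar> ^ k"
    unfolding norm_mult norm_power norm_of_real by (intro mult_right_mono norm_gcoeff_le assms) auto
  also have "\<dots> = 2 powr \<Gamma> * (9/2) / \<rho> * (2 * \<bar>w\<bar> / \<rho>) ^ k"
    using \<rho> by (simp add: power_divide power_mult_distrib field_simps)
  finally show ?thesis .
qed

text \<open>For |w| <= \<rho>/4 the ratio 2|w|/\<rho> is at most 1/2, so the geometric tail costs no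
  more than a factor 2.\<close>

lemma h_expansion:
  assumes \<gamma>: "\<bar>\<gamma>\<bar> \<le> \<Gamma>" and w: "\<bar>w\<bar> \<le> \<rho> / 4"
  shows "norm (h \<gamma> w - (\<Sum>k<n. gcoeff \<gamma> k * of_real w ^ k)) \<le> 2 powr \<Gamma> * 9 / \<rho> * (2 * \<bar>w\<bar> / \<rho>) ^ n"
proof -
  define K where "K = 2 powr \<Gamma> * (9/2) / \<rho>"
  define y where "y = 2 * \<bar>w\<bar> / \<rho>"
  have y: "0 \<le> y" "y \<le> 1/2" using w \<rho> by (auto simp: y_def field_simps)
  have K: "K \<ge> 0" using \<rho> by (simp add: K_def)
  have tm: "norm (gcoeff \<gamma> k * of_real w ^ k) \<le> K * y ^ k" for k
    unfolding K_def y_def by (rule norm_gcoeff_term_le[OF \<gamma>])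
  have geo: "summable (\<lambda>k. K * y ^ (k + n))" "(\<Sum>k. K * y ^ (k + n)) = K * y ^ n * (1 / (1 - y))"
  proof -
    have "(\<lambda>k. K * y ^ n * y ^ k) sums (K * y ^ n * (1 / (1 - y)))"
      using y by (intro sums_mult geometric_sums) auto
    then show "summable (\<lambda>k. K * y ^ (k + n))" "(\<Sum>k. K * y ^ (k + n)) = K * y ^ n * (1 / (1 - y))"
      by (simp_all add: power_add sums_iff mult_ac)
  qed
  have "\<bar>w\<bar> < \<rho>" using w \<rho> by linarith
  then have "h \<gamma> w - (\<Sum>k<n. gcoeff \<gamma> k * of_real w ^ k) = (\<Sum>k. gcoeff \<gamma> (k + n) * of_real w ^ (k + n))"
    unfolding h_def by (subst suminf_split_initial_segment[OF gcoeff_summable, of _ _ n]) auto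
  also have "norm \<dots> \<le> (\<Sum>k. K * y ^ (k + n))" by (rule norm_suminf_le[OF tm geo(1)])
  also have "\<dots> \<le> K * y ^ n * 2"
    unfolding geo(2) using y K by (intro mult_left_mono) (auto simp: field_simps)
  finally show ?thesis by (simp add: K_def y_def mult_ac)
qed

end

context saddle_interval
begin

text \<open>Folding onto u >= 0 removes the odd coefficients. The polynomial part is integrated over
  the whole half-line, and the difference to \<open>h\<close> is bounded by one multiple of u^(2M)
  both inside and outside [0,\<delta>], so no separate exponential tail appears and the error is a
  single Gaussian moment.\<close>

lemma laplace_saddle:
  obtains C where "\<And>\<gamma> x. \<bar>\<gamma>\<bar> \<le> \<Gamma> \<Longrightarrow> x > 0 \<Longrightarrow>
    norm (integral {-\<delta>..\<delta>} (\<lambda>w. of_real (exp (- x * w\<^sup>2)) * h \<gamma> w)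
      - of_real (sqrt (pi / x)) * (\<Sum>k<M. gcoeff \<gamma> (2 * k) * pochhammer (1/2) k / of_real x ^ k)) \<le> C / (x ^ M * sqrt x)"
proof -
  define K where "K = 2 powr \<Gamma> * (9/2) / \<rho>"
  have K: "K \<ge> 0" using \<rho> by (simp add: K_def)
  \<comment> \<open>The first summand covers u <= \<delta>, as two tails of the series with constant
    2 \<open>K\<close> each; the second covers u > \<delta>, where only the polynomial
    remains.\<close>
  define C1 where "C1 = 4 * K * (2 / \<rho>) ^ (2 * M) + (\<Sum>k<M. 2 * (K * (2 / \<rho>) ^ (2 * k)) / \<delta> ^ (2 * (M - k)))"
  have C1: "C1 \<ge> 4 * K * (2 / \<rho>) ^ (2 * M)" "C1 \<ge> (\<Sum>k<M. 2 * (K * (2 / \<rho>) ^ (2 * k)) / \<delta> ^ (2 * (M - k)))"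
    unfolding C1_def using K \<rho> \<delta> by (auto intro!: sum_nonneg)
  show thesis
  proof (rule that[of "C1 * (sqrt pi / 2 * pochhammer (1/2) M)"])
    fix \<gamma> x :: real
    assume \<gamma>: "\<bar>\<gamma>\<bar> \<le> \<Gamma>" and x: "x > 0"
    define f2 where "f2 w = of_real (exp (- x * w\<^sup>2)) * h \<gamma> w" for w :: real
    define S where "S u = (\<Sum>k<M. 2 * (gcoeff \<gamma> (2 * k) * of_real u ^ (2 * k)))" for u :: real
    define D where "D u = (if u \<le> \<delta> then h \<gamma> u + h \<gamma> (- u) else 0) - S u" for u
    have cont: "continuous_on {-\<delta>..\<delta>} f2"
      unfolding f2_def using \<delta> \<rho> by (intro continuous_intros continuous_on_subset[OF h_continuous]) auto
    have si: "set_integrable lborel {-\<delta>..\<delta>} f2" by (rule borel_integrable_atLeastAtMost'[OF cont])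
    have split: "integral {-\<delta>..\<delta>} f2 = (\<integral>u. indicator {0..} u *\<^sub>R (indicator {-\<delta>..\<delta>} u *\<^sub>R f2 u + indicator {-\<delta>..\<delta>} (- u) *\<^sub>R f2 (- u)) \<partial>lborel)"
      and split_int: "integrable lborel (\<lambda>u. indicator {0..} u *\<^sub>R (indicator {-\<delta>..\<delta>} u *\<^sub>R f2 u + indicator {-\<delta>..\<delta>} (- u) *\<^sub>R f2 (- u)))"
    proof -
      have int: "integrable lborel (\<lambda>u. indicator {-\<delta>..\<delta>} u *\<^sub>R f2 u)" using si by (simp add: set_integrable_def)
      then have int': "integrable lborel (\<lambda>u. indicator {-\<delta>..\<delta>} (- u) *\<^sub>R f2 (- u))"
        using lborel_integrable_real_affine[of "\<lambda>u. indicator {-\<delta>..\<delta>} u *\<^sub>R f2 u" "-1" 0] by simp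
      have s1: "integrable lborel (\<lambda>u. indicator {0..} u *\<^sub>R (indicator {-\<delta>..\<delta>} u *\<^sub>R f2 u))"
        by (rule integrable_mult_indicator[OF _ int]) simp
      have s2: "integrable lborel (\<lambda>u. indicator {0..} u *\<^sub>R (indicator {-\<delta>..\<delta>} (- u) *\<^sub>R f2 (- u)))"
        by (rule integrable_mult_indicator[OF _ int']) simp
      show "integrable lborel (\<lambda>u. indicator {0..} u *\<^sub>R (indicator {-\<delta>..\<delta>} u *\<^sub>R f2 u + indicator {-\<delta>..\<delta>} (- u) *\<^sub>R f2 (- u)))"
        unfolding scaleR_add_right by (rule Bochner_Integration.integrable_add[OF s1 s2])
      have "integral {-\<delta>..\<delta>} f2 = (\<integral>u. indicator {-\<delta>..\<delta>} u *\<^sub>R f2 u \<partial>lborel)"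
        using set_borel_integral_eq_integral(2)[OF si] by (simp add: set_lebesgue_integral_def)
      also have "\<dots> = (\<integral>u. indicator {0..} u *\<^sub>R (indicator {-\<delta>..\<delta>} u *\<^sub>R f2 u + indicator {-\<delta>..\<delta>} (- u) *\<^sub>R f2 (- u)) \<partial>lborel)"
        unfolding integral_whole_line_split[OF int] set_lebesgue_integral_def scaleR_add_right
        by (rule Bochner_Integration.integral_add[OF s1 s2, symmetric])
      finally show "integral {-\<delta>..\<delta>} f2 = (\<integral>u. indicator {0..} u *\<^sub>R (indicator {-\<delta>..\<delta>} u *\<^sub>R f2 u + indicator {-\<delta>..\<delta>} (- u) *\<^sub>R f2 (- u)) \<partial>lborel)" .
    qed
    have mom: "has_bochner_integral lborel (\<lambda>u. complex_of_real (indicator {0..} u *\<^sub>R (exp (- x * u\<^sup>2) * u ^ (2 * k))))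
        (of_real (sqrt pi / 2 * pochhammer (1/2) k / (x ^ k * sqrt x)))" for k
      by (rule has_bochner_integral_of_real[OF gaussian_even_moment[OF x]])
    have "has_bochner_integral lborel (\<lambda>u. \<Sum>k<M. 2 * gcoeff \<gamma> (2 * k) * complex_of_real (indicator {0..} u *\<^sub>R (exp (- x * u\<^sup>2) * u ^ (2 * k))))
        (\<Sum>k<M. 2 * gcoeff \<gamma> (2 * k) * of_real (sqrt pi / 2 * pochhammer (1/2) k / (x ^ k * sqrt x)))"
      by (intro has_bochner_integral_sum has_bochner_integral_mult_right mom)
    moreover have "(\<Sum>k<M. 2 * gcoeff \<gamma> (2 * k) * complex_of_real (indicator {0..} u *\<^sub>R (exp (- x * u\<^sup>2) * u ^ (2 * k)))) =
        indicator {0..} u *\<^sub>R (of_real (exp (- x * u\<^sup>2)) * S u)" for u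
      unfolding S_def sum_distrib_left scaleR_sum_right
      by (intro sum.cong) (simp_all add: scaleR_conv_of_real mult_ac)
    moreover have "(\<Sum>k<M. 2 * gcoeff \<gamma> (2 * k) * of_real (sqrt pi / 2 * pochhammer (1/2) k / (x ^ k * sqrt x))) =
       of_real (sqrt (pi / x)) * (\<Sum>k<M. gcoeff \<gamma> (2 * k) * pochhammer (1/2) k / of_real x ^ k)"
      unfolding sum_distrib_left
    proof (rule sum.cong[OF refl])
      fix k
      have "complex_of_real (pochhammer (1/2) k) = pochhammer (1/2) k"
        using pochhammer_of_real[of "1/2" k, where 'a = complex] by simp
      then show "2 * gcoeff \<gamma> (2 * k) * of_real (sqrt pi / 2 * pochhammer (1/2) k / (x ^ k * sqrt x)) =
         of_real (sqrt (pi / x)) * (gcoeff \<gamma> (2 * k) * pochhammer (1/2) k / of_real x ^ k)"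
        by (simp add: real_sqrt_divide mult_ac)
    qed
    ultimately have Sint: "integrable lborel (\<lambda>u. indicator {0..} u *\<^sub>R (of_real (exp (- x * u\<^sup>2)) * S u))"
      and Sval: "(\<integral>u. indicator {0..} u *\<^sub>R (of_real (exp (- x * u\<^sup>2)) * S u) \<partial>lborel) =
       of_real (sqrt (pi / x)) * (\<Sum>k<M. gcoeff \<gamma> (2 * k) * pochhammer (1/2) k / of_real x ^ k)"
      by (simp_all add: has_bochner_integral_iff)
    have "integral {-\<delta>..\<delta>} f2 - of_real (sqrt (pi / x)) * (\<Sum>k<M. gcoeff \<gamma> (2 * k) * pochhammer (1/2) k / of_real x ^ k) =
       (\<integral>u. indicator {0..} u *\<^sub>R (indicator {-\<delta>..\<delta>} u *\<^sub>R f2 u + indicator {-\<delta>..\<delta>} (- u) *\<^sub>R f2 (- u)) -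
          indicator {0..} u *\<^sub>R (of_real (exp (- x * u\<^sup>2)) * S u) \<partial>lborel)"
      unfolding split Sval[symmetric] by (rule Bochner_Integration.integral_diff[OF split_int Sint, symmetric])
    also have "\<dots> = (\<integral>u. indicator {0..} u *\<^sub>R (of_real (exp (- x * u\<^sup>2)) * D u) \<partial>lborel)"
    proof (rule Bochner_Integration.integral_cong[OF refl])
      fix u :: real
      show "indicator {0..} u *\<^sub>R (indicator {-\<delta>..\<delta>} u *\<^sub>R f2 u + indicator {-\<delta>..\<delta>} (- u) *\<^sub>R f2 (- u)) -
          indicator {0..} u *\<^sub>R (of_real (exp (- x * u\<^sup>2)) * S u) = indicator {0..} u *\<^sub>R (of_real (exp (- x * u\<^sup>2)) * D u)"
        unfolding D_def f2_def using \<delta> by (auto simp: indicator_def ring_distribs)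
    qed
    also have "norm \<dots> \<le> (\<integral>u. C1 * (indicator {0..} u *\<^sub>R (exp (- x * u\<^sup>2) * u ^ (2 * M))) \<partial>lborel)"
    proof (rule Bochner_Integration.integral_norm_bound_integral)
      have "integrable lborel (\<lambda>u. indicator {0..} u *\<^sub>R (indicator {-\<delta>..\<delta>} u *\<^sub>R f2 u + indicator {-\<delta>..\<delta>} (- u) *\<^sub>R f2 (- u)) -
          indicator {0..} u *\<^sub>R (of_real (exp (- x * u\<^sup>2)) * S u))"
        by (rule Bochner_Integration.integrable_diff[OF split_int Sint])
      then show "integrable lborel (\<lambda>u. indicator {0..} u *\<^sub>R (of_real (exp (- x * u\<^sup>2)) * D u))"
        by (rule Bochner_Integration.integrable_cong[THEN iffD1, rotated 2])
           (use \<delta> in \<open>auto simp: D_def f2_def indicator_def ring_distribs\<close>)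
      show "integrable lborel (\<lambda>u. C1 * (indicator {0..} u *\<^sub>R (exp (- x * u\<^sup>2) * u ^ (2 * M))))"
        using gaussian_even_moment[OF x, of M] by (auto simp: has_bochner_integral_iff)
      fix u :: real
      have pw: "(2 * \<bar>u\<bar> / \<rho>) ^ n = (2 / \<rho>) ^ n * u ^ n" if "u \<ge> 0" for n
        using that power_mult_distrib[of "2 / \<rho>" u n] by simp
      have "norm (D u) \<le> C1 * u ^ (2 * M)" if u: "u \<ge> 0"
      proof (cases "u \<le> \<delta>")
        case True
        have w4: "\<bar>u\<bar> \<le> \<rho>/4" "\<bar>- u\<bar> \<le> \<rho>/4" using True u \<delta> \<rho> by auto
        have "S u = (\<Sum>j<2*M. gcoeff \<gamma> j * of_real u ^ j) + (\<Sum>j<2*M. gcoeff \<gamma> j * of_real (- u) ^ j)"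
          unfolding S_def using sum_even_part[of "gcoeff \<gamma>" "of_real u" M] by (simp add: sum_distrib_left)
        then have "D u = (h \<gamma> u - (\<Sum>j<2*M. gcoeff \<gamma> j * of_real u ^ j)) + (h \<gamma> (- u) - (\<Sum>j<2*M. gcoeff \<gamma> j * of_real (- u) ^ j))"
          using True by (simp add: D_def)
        then have Du: "norm (D u) = norm ((h \<gamma> u - (\<Sum>j<2*M. gcoeff \<gamma> j * of_real u ^ j)) + (h \<gamma> (- u) - (\<Sum>j<2*M. gcoeff \<gamma> j * of_real (- u) ^ j)))"
          by (rule arg_cong)
        have "norm (D u) \<le> 2 powr \<Gamma> * 9 / \<rho> * (2 * \<bar>u\<bar> / \<rho>) ^ (2 * M) + 2 powr \<Gamma> * 9 / \<rho> * (2 * \<bar>- u\<bar> / \<rho>) ^ (2 * M)"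
          unfolding Du by (rule norm_triangle_mono[OF h_expansion[OF \<gamma> w4(1)] h_expansion[OF \<gamma> w4(2)]])
        also have "\<dots> = 4 * K * (2 / \<rho>) ^ (2 * M) * u ^ (2 * M)"
          unfolding K_def abs_minus_cancel pw[OF u] by (simp add: algebra_simps)
        also have "\<dots> \<le> C1 * u ^ (2 * M)" using u by (intro mult_right_mono C1(1)) auto
        finally show ?thesis .
      next
        case False
        have "norm (D u) \<le> (\<Sum>k<M. 2 * (K * (2 / \<rho>) ^ (2 * k)) / \<delta> ^ (2 * (M - k)) * u ^ (2 * M))"
        proof -
          have "D u = - S u" using False by (simp add: D_def)
          then have "norm (D u) = norm (\<Sum>k<M. 2 * (gcoeff \<gamma> (2 * k) * of_real u ^ (2 * k)))" by (simp add: S_def)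
          also have "\<dots> \<le> (\<Sum>k<M. 2 * (K * (2 / \<rho>) ^ (2 * k)) / \<delta> ^ (2 * (M - k)) * u ^ (2 * M))"
          proof (rule sum_norm_le)
          fix k assume k: "k \<in> {..<M}"
          have "norm (2 * (gcoeff \<gamma> (2 * k) * of_real u ^ (2 * k))) \<le> 2 * (K * (2 * \<bar>u\<bar> / \<rho>) ^ (2 * k))"
            unfolding K_def norm_mult[of 2] using norm_gcoeff_term_le[OF \<gamma>, of "2 * k" u] by simp
          also have "\<dots> = 2 * (K * (2 / \<rho>) ^ (2 * k)) * u ^ (2 * k)"
            unfolding pw[OF u] by simp
          also have "\<dots> \<le> 2 * (K * (2 / \<rho>) ^ (2 * k)) * (u ^ (2 * M) / \<delta> ^ (2 * (M - k)))"
          proof (rule mult_left_mono)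
            \<comment> \<open>Beyond \<delta> the quotient u/\<delta> exceeds 1, so missing powers
              of u may be supplied.\<close>
            have "\<delta> ^ (2 * (M - k)) * u ^ (2 * k) \<le> u ^ (2 * (M - k)) * u ^ (2 * k)"
              using False \<delta> u by (intro mult_right_mono power_mono) auto
            also have "\<dots> = u ^ (2 * M)"
            proof -
              have "2 * (M - k) + 2 * k = 2 * M" using k by simp
              then show ?thesis by (simp only: power_add[symmetric])
            qed
            finally show "u ^ (2 * k) \<le> u ^ (2 * M) / \<delta> ^ (2 * (M - k))"
              using \<delta> by (simp add: pos_le_divide_eq mult.commute)
          qed (use K \<rho> in auto)
          finally show "norm (2 * (gcoeff \<gamma> (2 * k) * of_real u ^ (2 * k))) \<le> 2 * (K * (2 / \<rho>) ^ (2 * k)) / \<delta> ^ (2 * (M - k)) * u ^ (2 * M)"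
            by simp
          qed
          finally show ?thesis .
        qed
        also have "\<dots> = (\<Sum>k<M. 2 * (K * (2 / \<rho>) ^ (2 * k)) / \<delta> ^ (2 * (M - k))) * u ^ (2 * M)"
          by (rule sum_distrib_right[symmetric])
        also have "\<dots> \<le> C1 * u ^ (2 * M)" using u by (intro mult_right_mono C1(2)) auto
        finally show ?thesis .
      qed
      then have "u \<ge> 0 \<Longrightarrow> exp (- x * u\<^sup>2) * norm (D u) \<le> exp (- x * u\<^sup>2) * (C1 * u ^ (2 * M))"
        by (intro mult_left_mono) auto
      then show "norm (indicator {0..} u *\<^sub>R (of_real (exp (- x * u\<^sup>2)) * D u)) \<le> C1 * (indicator {0..} u *\<^sub>R (exp (- x * u\<^sup>2) * u ^ (2 * M)))"
        by (simp add: indicator_def norm_mult mult_ac)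
    qed
    also have "\<dots> = C1 * (sqrt pi / 2 * pochhammer (1/2) M) / (x ^ M * sqrt x)"
      using gaussian_even_moment[OF x, of M] by (simp add: has_bochner_integral_iff)
    finally show "norm (integral {-\<delta>..\<delta>} (\<lambda>w. of_real (exp (- x * w\<^sup>2)) * h \<gamma> w)
      - of_real (sqrt (pi / x)) * (\<Sum>k<M. gcoeff \<gamma> (2 * k) * pochhammer (1/2) k / of_real x ^ k))
       \<le> C1 * (sqrt pi / 2 * pochhammer (1/2) M) / (x ^ M * sqrt x)"
      unfolding f2_def .
  qed
qed

end

section \<open>The weight at the saddle and its tails\<close>

definition weight :: "real \<Rightarrow> real \<Rightarrow> real \<Rightarrow> real" where
  "weight x \<gamma> t = exp (- 2 * x * (t - ln t - 1)) * t powr (\<gamma> - 1)"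

lemma borel_measurable_weight [measurable]: "weight x \<gamma> \<in> borel_measurable borel"
  unfolding weight_def by measurable

lemma weight_nonneg: "weight x \<gamma> t \<ge> 0"
  by (simp add: weight_def)

lemma weight_eq: "t > 0 \<Longrightarrow> weight x \<gamma> t = exp (2 * x) * (t powr (2 * x + \<gamma> - 1) * exp (- 2 * x * t))"
  by (simp add: weight_def powr_def algebra_simps flip: exp_add)

lemma weight_integrable:
  assumes "2 * x + \<gamma> > 0" "x > 0"
  shows "set_integrable lborel {0<..} (weight x \<gamma>)"
proof -
  define c where "c = 2 * x + \<gamma>"
  define f where "f s = indicator {0<..} s *\<^sub>R (s powr (c - 1) * exp (- s))" for s :: real
  have "integrable lborel f"
    using Gamma_integral_lborel(1)[of c] assms unfolding f_def set_integrable_def c_def by simp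
  then have "integrable lborel (\<lambda>t. exp (2 * x) * (2 * x) powr (1 - c) * f (0 + 2 * x * t))"
    using lborel_integrable_real_affine[of f "2 * x" 0] assms by simp
  moreover have "exp (2 * x) * (2 * x) powr (1 - c) * f (0 + 2 * x * t) = indicator {0<..} t *\<^sub>R weight x \<gamma> t" for t
  proof (cases "t > 0")
    case True
    have "(2 * x) powr (1 - c) * (2 * x * t) powr (c - 1) = t powr (c - 1)"
    proof -
      have "(2 * x) powr (1 - c) * (2 * x) powr (c - 1) = 1"
        using assms unfolding powr_add[symmetric] by simp
      moreover have "(2 * x * t) powr (c - 1) = (2 * x) powr (c - 1) * t powr (c - 1)"
        using assms True by (intro powr_mult) 
      ultimately show ?thesis by simp
    qed
    then show ?thesis using True assms weight_eq[OF True, of x \<gamma>] by (simp add: f_def c_def mult.assoc[symmetric])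
  qed (use assms in \<open>auto simp: f_def zero_less_mult_iff\<close>)
  ultimately show ?thesis unfolding set_integrable_def by (simp only:)
qed

text \<open>Only the exponent at \<open>x0\<close> is kept for integrability, and the excess x - x0
  is spent on decay. With t^(\<gamma>-1) dominated by its two extreme powers, one majorant serves
  all x >= x0 and all |\<gamma>| <= \<Gamma>.\<close>

lemma weight_le:
  assumes x: "x \<ge> x0" and \<gamma>: "\<bar>\<gamma>\<bar> \<le> \<Gamma>" and t: "t > 0" and u: "t - ln t - 1 \<ge> u"
  shows "weight x \<gamma> t \<le> exp (- 2 * (x - x0) * u) * (weight x0 \<Gamma> t + weight x0 (- \<Gamma>) t)"
proof -
  have "t powr (\<gamma> - 1) \<le> t powr (\<Gamma> - 1) + t powr (- \<Gamma> - 1)"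
  proof (cases "t \<ge> 1")
    case True
    then have "t powr (\<gamma> - 1) \<le> t powr (\<Gamma> - 1)" using \<gamma> by (intro powr_mono) auto
    then show ?thesis by (simp add: add_increasing2)
  next
    case False
    then have "t powr (\<gamma> - 1) \<le> t powr (- \<Gamma> - 1)" using \<gamma> t by (intro powr_mono') auto
    then show ?thesis by (simp add: add_increasing)
  qed
  moreover have "exp (- 2 * x * (t - ln t - 1)) \<le> exp (- 2 * (x - x0) * u) * exp (- 2 * x0 * (t - ln t - 1))"
  proof -
    have "(x - x0) * u \<le> (x - x0) * (t - ln t - 1)" using x u by (intro mult_left_mono) auto
    then show ?thesis by (simp add: algebra_simps flip: exp_add)
  qed
  ultimately have "weight x \<gamma> t \<le> (exp (- 2 * (x - x0) * u) * exp (- 2 * x0 * (t - ln t - 1))) * (t powr (\<Gamma> - 1) + t powr (- \<Gamma> - 1))"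
    unfolding weight_def by (intro mult_mono) auto
  then show ?thesis by (simp add: weight_def algebra_simps)
qed

lemma exponent_nonneg: "t > 0 \<Longrightarrow> t - ln t - 1 \<ge> (0::real)"
  using ln_le_minus_one[of t] by simp

text \<open>The tangent of the logarithm at c bounds the exponent from below. The sign condition
  says that t lies on the side of c that points away from 1.\<close>

lemma exponent_away:
  fixes t c :: real
  assumes "t > 0" "c > 0" "(t - c) * (c - 1) \<ge> 0"
  shows "t - ln t - 1 \<ge> c - ln c - 1"
proof -
  have "ln (t / c) \<le> t / c - 1" using assms by (intro ln_le_minus_one) simp
  moreover have "(t - c) * (c - 1) / c \<ge> 0" using assms by simp
  moreover have "(t - c) * (c - 1) / c = t - c - (t / c - 1)" using assms by (simp add: field_simps)
  ultimately show ?thesis using assms by (simp add: ln_div)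
qed

text \<open>The exponent equals w^2/2, hence \<delta>^2/2, at both ends of the interval.\<close>

lemma (in saddle_interval) exponent_outside:
  assumes "t > 0" "t \<notin> {a..b}"
  shows "t - ln t - 1 \<ge> \<delta>\<^sup>2 / 2"
proof -
  have a: "a - ln a - 1 = \<delta>\<^sup>2 / 2" "b - ln b - 1 = \<delta>\<^sup>2 / 2"
    using V_square[OF near, of a] V_square[OF near, of b] V_ends ab by auto
  show ?thesis
  proof (cases "t < a")
    case True
    then show ?thesis using exponent_away[of t a] assms a ab r by (auto simp: mult_nonpos_nonpos)
  next
    case False
    then show ?thesis using exponent_away[of t b] assms a ab r by auto
  qed
qed

section \<open>Re-expansion of the remainder\<close>

text \<open>Normalised so that the remainder after J terms is a constant times \<open>sigmaK\<close>
  divided by t^J; the factor t keeps it bounded as t grows.\<close>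

definition sigmaK :: "complex \<Rightarrow> nat \<Rightarrow> real \<Rightarrow> complex" where
  "sigmaK \<nu> J t = of_real t * stieltjesK \<nu> J (of_real t)"

text \<open>The kernel t/(s+t) lies in [0,1], and its difference at t and y is s/(s+t) times
  (t-y)/(s+y). The Lipschitz bound is relative to y: at y = x and t = x \<tau> it reads |\<tau> -
  1|, which cancels the pole uniformly in x.\<close>

lemma sigmaK_bounds:
  assumes "\<bar>Re \<nu>\<bar> < real J + 1/2"
  obtains C where "C \<ge> 0" "\<And>t. t > 0 \<Longrightarrow> norm (sigmaK \<nu> J t) \<le> C"
    "\<And>t y. t > 0 \<Longrightarrow> y > 0 \<Longrightarrow> norm (sigmaK \<nu> J t - sigmaK \<nu> J y) \<le> C * (\<bar>t - y\<bar> / y)"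
proof -
  define m where "m t = indicator {0<..} t *\<^sub>R (of_real (t powr (real J - 1/2) * exp (- t)) * besselK \<nu> t)" for t
  have m: "integrable lborel m" using integrable_besselK_moment[OF assms] unfolding m_def set_integrable_def .
  note [measurable] = borel_measurable_integrable[OF m]
  define k where "k t s = m s * of_real (t / (s + t))" for t s :: real
  have eq: "sigmaK \<nu> J t = (\<integral>s. k t s \<partial>lborel)" for t
    unfolding sigmaK_def stieltjesK_def set_lebesgue_integral_def integral_mult_right_zero[symmetric]
    by (rule Bochner_Integration.integral_cong[OF refl]) (simp add: k_def m_def scaleR_conv_of_real)
  have kb: "norm (k t s) \<le> norm (m s)" if "t > 0" for t s
  proof (cases "s > 0")
    case True
    then have "norm (of_real (t / (s + t)) :: complex) \<le> 1" using that unfolding norm_of_real by simp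
    then show ?thesis unfolding k_def norm_mult by (intro mult_right_le_one_le) auto
  qed (simp add: k_def m_def)
  have km: "k t \<in> borel_measurable lborel" for t unfolding k_def by measurable
  have ki: "integrable lborel (k t)" if "t > 0" for t
    by (rule Bochner_Integration.integrable_bound[OF m km]) (use kb[OF that] in auto)
  show thesis
  proof (rule that[of "\<integral>s. norm (m s) \<partial>lborel"])
    show "norm (sigmaK \<nu> J t) \<le> (\<integral>s. norm (m s) \<partial>lborel)" if "t > 0" for t
      unfolding eq using kb[OF that]
      by (intro Bochner_Integration.integral_norm_bound_integral[OF ki[OF that] integrable_norm[OF m]]) auto
    fix t y :: real assume ty: "t > 0" "y > 0"
    have "sigmaK \<nu> J t - sigmaK \<nu> J y = (\<integral>s. k t s - k y s \<partial>lborel)"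
      unfolding eq using ki ty by simp
    also have "norm \<dots> \<le> (\<integral>s. norm (m s) * (\<bar>t - y\<bar> / y) \<partial>lborel)"
    proof (rule Bochner_Integration.integral_norm_bound_integral)
      fix s :: real
      show "norm (k t s - k y s) \<le> norm (m s) * (\<bar>t - y\<bar> / y)"
      proof (cases "s > 0")
        case True
        have "t / (s + t) - y / (s + y) = s / (s + t) * ((t - y) / (s + y))"
          using True ty by (simp add: field_simps)
        also have "\<bar>\<dots>\<bar> = s / (s + t) * (\<bar>t - y\<bar> / (s + y))" using True ty by (simp add: abs_mult)
        also have "\<dots> \<le> 1 * (\<bar>t - y\<bar> / y)"
          using True ty by (intro mult_mono divide_left_mono) auto
        finally have "norm (of_real (t / (s + t) - y / (s + y)) :: complex) \<le> \<bar>t - y\<bar> / y"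
          unfolding norm_of_real by simp
        moreover have "k t s - k y s = m s * of_real (t / (s + t) - y / (s + y))" by (simp add: k_def right_diff_distrib)
        ultimately show ?thesis by (simp only: norm_mult mult_left_mono norm_ge_zero)
      qed (simp add: k_def m_def)
    qed (use ki ty m in auto)
    finally show "norm (sigmaK \<nu> J t - sigmaK \<nu> J y) \<le> (\<integral>s. norm (m s) \<partial>lborel) * (\<bar>t - y\<bar> / y)" by simp
  qed simp
qed

text \<open>The constant in front of the Stieltjes transform in the exact formula. Its cosine
  vanishes precisely for half-integer orders.\<close>

definition stokesC :: "complex \<Rightarrow> complex" where
  "stokesC \<nu> = cos (of_real pi * \<nu>) * of_real (sqrt (2 / pi) / pi)"

text \<open>Inserting the exact formula of order J for K_\<nu>(x t) brings in a second factor exp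
  (-x t), hence the exponent 2x. The j-th term lowers the power of t by j, which is how \<gamma>_j =
  \<alpha> - j arises.\<close>

lemma moment_integrand_expansion:
  fixes x t :: real and m J :: nat and \<nu> :: complex
  assumes x: "x > 0" and t: "t > 0" and \<nu>: "\<bar>Re \<nu>\<bar> < real J + 1/2"
  defines "\<alpha> \<equiv> real m - 2 * x"
  shows "of_real ((x * t) powr (real m - 1/2) * exp (- (x * t))) * besselK \<nu> (x * t) =
    of_real (sqrt (pi / 2) * (x ^ m / x) * exp (- 2 * x)) *
      ((\<Sum>j<J. coeff_a \<nu> j / of_real x ^ j * of_real (weight x (\<alpha> - real j) t)) +
       (-1) ^ J * stokesC \<nu> / of_real x ^ J * (of_real (weight x (\<alpha> - real J) t) * sigmaK \<nu> J (x * t)))"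
proof -
  define A where "A = sqrt (pi / 2) * (x ^ m / x) * exp (- 2 * x)"
  define B where "B = (x * t) powr (real m - 1/2) * exp (- (x * t)) * (sqrt (pi / (2 * (x * t))) * exp (- (x * t)))"
  have key: "B / (x * t) ^ j = A * (weight x (\<alpha> - real j) t / x ^ j)" for j
  proof -
    define y where "y = x * t"
    have y: "y > 0" using x t by (simp add: y_def)
    have 1: "y powr (real m - 1/2) = y ^ m / sqrt y" using y by (simp add: powr_diff powr_realpow powr_half_sqrt)
    have 2: "sqrt (pi / (2 * y)) = sqrt (pi / 2) / sqrt y" by (simp add: real_sqrt_divide real_sqrt_mult)
    have 3: "sqrt y * sqrt y = y" using y by simp
    have "B / y ^ j = (y ^ m / sqrt y) * (sqrt (pi / 2) / sqrt y) * (exp (- y) * exp (- y)) / y ^ j"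
      unfolding B_def y_def[symmetric] 1 2 by simp
    also have "\<dots> = y ^ m / (sqrt y * sqrt y) * sqrt (pi / 2) * exp (- 2 * y) / y ^ j"
      by (simp flip: exp_add)
    finally have Bj: "B / y ^ j = sqrt (pi / 2) * (y ^ m / y) * exp (- 2 * y) / y ^ j" unfolding 3 by simp
    have ex: "2 * x + (\<alpha> - real j) - 1 = real m - real j - 1" by (simp add: \<alpha>_def)
    have w: "weight x (\<alpha> - real j) t = exp (2 * x) * (t ^ m / t ^ j / t * exp (- 2 * x * t))"
      unfolding weight_eq[OF t] ex using t by (simp add: powr_diff powr_realpow)
    have e: "exp (- 2 * x) * exp (2 * x) = 1" by (simp flip: exp_add)
    have "A * (weight x (\<alpha> - real j) t / x ^ j)
      = (exp (- 2 * x) * exp (2 * x)) * (sqrt (pi / 2) * ((x * t) ^ m / (x * t)) * exp (- 2 * (x * t)) / (x * t) ^ j)"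
      unfolding A_def w by (simp add: power_mult_distrib mult_ac)
    then show ?thesis unfolding e Bj[unfolded y_def] by simp
  qed
  have "x * t > 0" using x t by simp
  note K = besselK_stieltjes[OF this \<nu>]
  have "of_real ((x * t) powr (real m - 1/2) * exp (- (x * t))) * besselK \<nu> (x * t) =
     (\<Sum>j<J. coeff_a \<nu> j * of_real (B / (x * t) ^ j)) + (-1) ^ J * stokesC \<nu> * of_real (B / (x * t) ^ J) * sigmaK \<nu> J (x * t)"
    unfolding K B_def sigmaK_def stokesC_def distrib_left sum_distrib_left
    by (intro arg_cong2[where f = "(+)"] sum.cong) (simp_all add: mult_ac)
  also have "\<dots> = (\<Sum>j<J. of_real A * (coeff_a \<nu> j / of_real x ^ j * of_real (weight x (\<alpha> - real j) t))) +
     of_real A * ((-1) ^ J * stokesC \<nu> / of_real x ^ J * (of_real (weight x (\<alpha> - real J) t) * sigmaK \<nu> J (x * t)))"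
    unfolding key by (intro arg_cong2[where f = "(+)"] sum.cong) (simp_all add: mult_ac)
  finally show ?thesis unfolding A_def by (simp only: sum_distrib_left distrib_left)
qed

text \<open>Scaling t by x puts the saddle at 1, and the pole at distance |y| from it.\<close>

lemma stieltjesK_scaled:
  assumes x: "x > 0"
  shows "stieltjesK \<nu> m (of_real x * (-1 + \<i> * of_real y)) =
    (LINT t:{0<..}|lborel. of_real ((x * t) powr (real m - 1/2) * exp (- (x * t))) * besselK \<nu> (x * t) /
        (of_real (t - 1) + \<i> * of_real y))"
proof -
  have "stieltjesK \<nu> m (of_real x * (-1 + \<i> * of_real y)) = \<bar>x\<bar> *\<^sub>R
    (\<integral>t. indicator {0<..} (0 + x * t) *\<^sub>R (of_real ((0 + x * t) powr (real m - 1/2) * exp (- (0 + x * t))) * besselK \<nu> (0 + x * t) /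
        (of_real (0 + x * t) + of_real x * (-1 + \<i> * of_real y))) \<partial>lborel)"
    unfolding stieltjesK_def set_lebesgue_integral_def using x by (intro lborel_integral_real_affine) simp
  also have "\<dots> = (\<integral>t. \<bar>x\<bar> *\<^sub>R (indicator {0<..} (0 + x * t) *\<^sub>R (of_real ((0 + x * t) powr (real m - 1/2) * exp (- (0 + x * t))) * besselK \<nu> (0 + x * t) /
        (of_real (0 + x * t) + of_real x * (-1 + \<i> * of_real y)))) \<partial>lborel)"
    unfolding scaleR_conv_of_real[of "\<bar>x\<bar>"] by (simp only: integral_mult_right_zero)
  also have "\<dots> = (\<integral>t. indicator {0<..} t *\<^sub>R (of_real ((x * t) powr (real m - 1/2) * exp (- (x * t))) * besselK \<nu> (x * t) /
        (of_real (t - 1) + \<i> * of_real y)) \<partial>lborel)"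
  proof (rule Bochner_Integration.integral_cong[OF refl])
    fix t :: real
    have d: "of_real (x * t) + of_real x * (-1 + \<i> * of_real y) = of_real x * (of_real (t - 1) + \<i> * of_real y)"
      by (simp add: algebra_simps)
    show "\<bar>x\<bar> *\<^sub>R (indicator {0<..} (0 + x * t) *\<^sub>R (of_real ((0 + x * t) powr (real m - 1/2) * exp (- (0 + x * t))) * besselK \<nu> (0 + x * t) /
        (of_real (0 + x * t) + of_real x * (-1 + \<i> * of_real y))))
      = indicator {0<..} t *\<^sub>R (of_real ((x * t) powr (real m - 1/2) * exp (- (x * t))) * besselK \<nu> (x * t) /
        (of_real (t - 1) + \<i> * of_real y))"
      unfolding add_0 d using x by (simp add: indicator_def zero_less_mult_iff scaleR_conv_of_real)
  qed
  finally show ?thesis unfolding set_lebesgue_integral_def .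
qed

lemma sigmaK_continuous:
  assumes "\<bar>Re \<nu>\<bar> < real J + 1/2" and "x > 0"
  shows "continuous_on {0<..} (\<lambda>t. sigmaK \<nu> J (x * t))"
  unfolding sigmaK_def
  by (intro continuous_intros continuous_on_compose2[OF holomorphic_on_imp_continuous_on[OF stieltjesK_holomorphic[OF assms(1)]]])
     (use assms(2) in \<open>auto simp: complex_nonpos_Reals_iff mult_le_0_iff\<close>)

text \<open>\<Gamma> is to bound all exponents \<gamma>_j, and 2 \<open>x0\<close> > \<Gamma> makes
  the weights with exponents +-\<Gamma> integrable at t = 0. J is the order to which the inner
  Bessel function is expanded.\<close>

locale saddle_estimates = saddle_interval +
  fixes \<Gamma> x0 :: real and \<nu> :: complex and J :: nat
  assumes \<Gamma>: "\<Gamma> \<ge> 0" and x0: "2 * x0 > \<Gamma>" and \<nu>: "\<bar>Re \<nu>\<bar> < real J + 1/2"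
begin

text \<open>The mass of the common majorant of all weights; it does not depend on x or
  \<gamma>.\<close>

definition W where "W = (LINT t:{0<..}|lborel. weight x0 \<Gamma> t + weight x0 (- \<Gamma>) t)"

definition d where "d = min (1 - a) (b - 1)"

lemma d_pos: "d > 0" using ab by (simp add: d_def)

lemma W_int: "set_integrable lborel {0<..} (\<lambda>t. weight x0 \<Gamma> t + weight x0 (- \<Gamma>) t)"
  using x0 \<Gamma> by (intro set_integral_add weight_integrable) auto

lemma W_nonneg: "W \<ge> 0"
  unfolding W_def set_lebesgue_integral_def by (intro Bochner_Integration.integral_nonneg) (simp add: weight_nonneg)

lemma weight_sum_nonneg: "0 \<le> weight x0 \<Gamma> t + weight x0 (- \<Gamma>) t"
  by (simp add: weight_nonneg)

lemma pole_integrable: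
  assumes x: "x \<ge> x0" and \<gamma>: "\<bar>\<gamma>\<bar> \<le> \<Gamma>" and y: "y \<noteq> 0"
  shows "set_integrable lborel {0<..} (\<lambda>t. of_real (weight x \<gamma> t) / (of_real (t - 1) + \<i> * of_real y))"
proof -
  have w: "set_integrable lborel {0<..} (weight x \<gamma>)" using x \<gamma> x0 \<Gamma> by (intro weight_integrable) auto
  show ?thesis unfolding set_integrable_def
  proof (rule Bochner_Integration.integrable_bound)
    show "integrable lborel (\<lambda>t. (indicator {0<..} t *\<^sub>R weight x \<gamma> t) / \<bar>y\<bar>)" using w unfolding set_integrable_def by simp
    have "norm (of_real (t - 1) + \<i> * of_real y) \<ge> \<bar>y\<bar>" for t
      using abs_Im_le_cmod[of "of_real (t - 1) + \<i> * of_real y"] by simp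
    then have "norm (of_real (weight x \<gamma> t) / (of_real (t - 1) + \<i> * of_real y)) \<le> weight x \<gamma> t / \<bar>y\<bar>" for t
      unfolding norm_divide norm_of_real using y weight_nonneg[of x \<gamma> t] by (intro frac_le) auto
    then show "AE t in lborel. norm (indicator {0<..} t *\<^sub>R (of_real (weight x \<gamma> t) / (of_real (t - 1) + \<i> * of_real y)))
        \<le> norm ((indicator {0<..} t *\<^sub>R weight x \<gamma> t) / \<bar>y\<bar>)"
      by (intro AE_I2) (simp add: indicator_def weight_nonneg)
  qed measurable
qed

text \<open>Off [a,b] the denominator is at least \<open>d\<close> in modulus and the exponent is at
  least \<delta>^2/2, so the contribution is exponentially small, uniformly in the shift y.\<close>

lemma pole_outside:
  assumes x: "x \<ge> x0" and \<gamma>: "\<bar>\<gamma>\<bar> \<le> \<Gamma>" and y: "y \<noteq> 0"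
  shows "norm ((LINT t:{0<..}|lborel. of_real (weight x \<gamma> t) / (of_real (t - 1) + \<i> * of_real y)) -
     (LINT t:{a..b}|lborel. of_real (weight x \<gamma> t) / (of_real (t - 1) + \<i> * of_real y))) \<le> W / d * exp (- (x - x0) * \<delta>\<^sup>2)"
proof -
  define f where "f t = of_real (weight x \<gamma> t) / (of_real (t - 1) + \<i> * of_real y)" for t
  have f: "set_integrable lborel {0<..} f" unfolding f_def by (rule pole_integrable[OF assms])
  have sub: "{a..b} \<subseteq> {0<..}" using ab r by auto
  have fab: "set_integrable lborel {a..b} f" by (rule set_integrable_subset[OF f _ sub]) simp
  have fo: "set_integrable lborel ({0<..} - {a..b}) f" by (rule set_integrable_subset[OF f]) auto
  have "(LINT t:{0<..}|lborel. f t) = (LINT t:{a..b} \<union> ({0<..} - {a..b})|lborel. f t)"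
    using sub by (intro arg_cong2[where f = "\<lambda>A. set_lebesgue_integral lborel A"]) auto
  also have "\<dots> = (LINT t:{a..b}|lborel. f t) + (LINT t:{0<..} - {a..b}|lborel. f t)"
    by (rule set_integral_Un[OF _ fab fo]) auto
  finally have "(LINT t:{0<..}|lborel. f t) - (LINT t:{a..b}|lborel. f t) = (LINT t:{0<..} - {a..b}|lborel. f t)" by simp
  also have "norm \<dots> \<le> (\<integral>t. (indicator {0<..} t *\<^sub>R (weight x0 \<Gamma> t + weight x0 (- \<Gamma>) t)) * (exp (- (x - x0) * \<delta>\<^sup>2) / d) \<partial>lborel)"
    unfolding set_lebesgue_integral_def
  proof (rule Bochner_Integration.integral_norm_bound_integral)
    show "integrable lborel (\<lambda>t. indicator ({0<..} - {a..b}) t *\<^sub>R f t)" using fo by (simp add: set_integrable_def)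
    show "integrable lborel (\<lambda>t. (indicator {0<..} t *\<^sub>R (weight x0 \<Gamma> t + weight x0 (- \<Gamma>) t)) * (exp (- (x - x0) * \<delta>\<^sup>2) / d))"
      using W_int unfolding set_integrable_def by (rule integrable_mult_left)
    fix t :: real
    show "norm (indicator ({0<..} - {a..b}) t *\<^sub>R f t) \<le> (indicator {0<..} t *\<^sub>R (weight x0 \<Gamma> t + weight x0 (- \<Gamma>) t)) * (exp (- (x - x0) * \<delta>\<^sup>2) / d)"
    proof (cases "t \<in> {0<..} - {a..b}")
      case True
      then have t: "t > 0" "t \<notin> {a..b}" by auto
      have "d \<le> \<bar>t - 1\<bar>" using t(2) by (auto simp: d_def)
      also have "\<dots> \<le> norm (of_real (t - 1) + \<i> * of_real y)"
        using norm_shifted_pole_ge[of "t - 1" 1 y] by simp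
      finally have "norm (f t) \<le> weight x \<gamma> t / d"
        unfolding f_def norm_divide norm_of_real using d_pos weight_nonneg[of x \<gamma> t] by (intro frac_le) auto
      also have "\<dots> \<le> exp (- 2 * (x - x0) * (\<delta>\<^sup>2 / 2)) * (weight x0 \<Gamma> t + weight x0 (- \<Gamma>) t) / d"
        using d_pos by (intro divide_right_mono weight_le[OF x \<gamma> t(1) exponent_outside[OF t]]) auto
      also have "exp (- 2 * (x - x0) * (\<delta>\<^sup>2 / 2)) = exp (- (x - x0) * \<delta>\<^sup>2)" by (rule arg_cong[where f = exp]) simp
      finally show ?thesis using True by (simp add: mult_ac)
    next
      case False
      then show ?thesis using weight_sum_nonneg[of t] d_pos by (auto simp: indicator_def)
    qed
  qed
  also have "\<dots> = W / d * exp (- (x - x0) * \<delta>\<^sup>2)" by (simp add: W_def set_lebesgue_integral_def)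
  finally show ?thesis unfolding f_def .
qed

text \<open>Replacing \<open>sigmaK\<close> at x t by its value at x leaves a difference of size |t
  - 1|, which the denominator absorbs for every y. The bound \<open>C * W\<close> is not small;
  smallness comes from the factor x^(-J) attached later.\<close>

lemma pole_sigma:
  assumes x: "x \<ge> x0" and \<gamma>: "\<bar>\<gamma>\<bar> \<le> \<Gamma>" and y: "y \<noteq> 0"
    and C: "C \<ge> 0" "\<And>t. t > 0 \<Longrightarrow> norm (sigmaK \<nu> J t) \<le> C"
    "\<And>t y. t > 0 \<Longrightarrow> y > 0 \<Longrightarrow> norm (sigmaK \<nu> J t - sigmaK \<nu> J y) \<le> C * (\<bar>t - y\<bar> / y)"
  shows "set_integrable lborel {0<..} (\<lambda>t. of_real (weight x \<gamma> t) * sigmaK \<nu> J (x * t) / (of_real (t - 1) + \<i> * of_real y))" (is ?A)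
    and "norm ((LINT t:{0<..}|lborel. of_real (weight x \<gamma> t) * sigmaK \<nu> J (x * t) / (of_real (t - 1) + \<i> * of_real y)) -
     sigmaK \<nu> J x * (LINT t:{0<..}|lborel. of_real (weight x \<gamma> t) / (of_real (t - 1) + \<i> * of_real y))) \<le> C * W" (is ?B)
proof -
  have x': "x > 0" using x x0 \<Gamma> by linarith
  define f where "f t = of_real (weight x \<gamma> t) / (of_real (t - 1) + \<i> * of_real y)" for t
  have f: "set_integrable lborel {0<..} f" unfolding f_def by (rule pole_integrable[OF x \<gamma> y])
  define s where "s t = indicator {0<..} t *\<^sub>R sigmaK \<nu> J (x * t)" for t
  have [measurable]: "s \<in> borel_measurable borel"
    unfolding s_def by (rule borel_measurable_continuous_on_indicator[OF _ sigmaK_continuous[OF \<nu> x']]) simp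
  have fs: "indicator {0<..} t *\<^sub>R (f t * sigmaK \<nu> J (x * t)) = (indicator {0<..} t *\<^sub>R f t) * s t" for t
    by (simp add: s_def indicator_def)
  have sC: "norm (s t) \<le> C" for t using C x' by (cases "t > 0") (auto simp: s_def)
  have int: "integrable lborel (\<lambda>t. (indicator {0<..} t *\<^sub>R f t) * s t)"
  proof (rule Bochner_Integration.integrable_bound)
    show "integrable lborel (\<lambda>t. C *\<^sub>R (indicator {0<..} t *\<^sub>R f t))" using f unfolding set_integrable_def by (rule integrable_scaleR_right)
    have [measurable]: "(\<lambda>t. indicator {0<..} t *\<^sub>R f t) \<in> borel_measurable lborel" using f unfolding set_integrable_def by (rule borel_measurable_integrable)
    show "(\<lambda>t. (indicator {0<..} t *\<^sub>R f t) * s t) \<in> borel_measurable lborel" by measurable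
    show "AE t in lborel. norm ((indicator {0<..} t *\<^sub>R f t) * s t) \<le> norm (C *\<^sub>R (indicator {0<..} t *\<^sub>R f t))"
    proof (intro AE_I2)
      fix t
      have "norm (indicator {0<..} t *\<^sub>R f t) * norm (s t) \<le> norm (indicator {0<..} t *\<^sub>R f t) * C"
        by (intro mult_left_mono sC norm_ge_zero)
      then show "norm ((indicator {0<..} t *\<^sub>R f t) * s t) \<le> norm (C *\<^sub>R (indicator {0<..} t *\<^sub>R f t))"
        unfolding norm_mult norm_scaleR[of C] abs_of_nonneg[OF C(1)] by (simp only: mult.commute)
    qed
  qed
  have comm: "of_real (weight x \<gamma> t) * sigmaK \<nu> J (x * t) / (of_real (t - 1) + \<i> * of_real y) = f t * sigmaK \<nu> J (x * t)" for t
    by (simp add: f_def)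
  show ?A unfolding comm set_integrable_def fs by (rule int)
  have f': "integrable lborel (\<lambda>t. indicator {0<..} t *\<^sub>R f t)" using f by (simp add: set_integrable_def)
  have "(LINT t:{0<..}|lborel. f t * sigmaK \<nu> J (x * t)) - sigmaK \<nu> J x * (LINT t:{0<..}|lborel. f t) =
     (\<integral>t. (indicator {0<..} t *\<^sub>R f t) * s t - sigmaK \<nu> J x * (indicator {0<..} t *\<^sub>R f t) \<partial>lborel)"
    unfolding set_lebesgue_integral_def fs
    by (simp only: Bochner_Integration.integral_diff[OF int integrable_mult_right[OF f']] integral_mult_right_zero)
  also have "norm \<dots> \<le> (\<integral>t. C * (indicator {0<..} t *\<^sub>R (weight x0 \<Gamma> t + weight x0 (- \<Gamma>) t)) \<partial>lborel)"
  proof (rule Bochner_Integration.integral_norm_bound_integral)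
    show "integrable lborel (\<lambda>t. (indicator {0<..} t *\<^sub>R f t) * s t - sigmaK \<nu> J x * (indicator {0<..} t *\<^sub>R f t))"
      by (intro Bochner_Integration.integrable_diff int integrable_mult_right f')
    show "integrable lborel (\<lambda>t. C * (indicator {0<..} t *\<^sub>R (weight x0 \<Gamma> t + weight x0 (- \<Gamma>) t)))"
      using W_int unfolding set_integrable_def by (rule integrable_mult_right)
    fix t :: real
    show "norm ((indicator {0<..} t *\<^sub>R f t) * s t - sigmaK \<nu> J x * (indicator {0<..} t *\<^sub>R f t)) \<le>
       C * (indicator {0<..} t *\<^sub>R (weight x0 \<Gamma> t + weight x0 (- \<Gamma>) t))"
    proof (cases "t > 0")
      case True
      define D where "D = of_real (t - 1) + \<i> * of_real y"
      have D: "norm D \<ge> \<bar>t - 1\<bar>" "norm D > 0"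
        using norm_shifted_pole_ge[of "t - 1" 1 y] y by (auto simp: D_def complex_eq_iff)
      have "norm (sigmaK \<nu> J (x * t) - sigmaK \<nu> J x) \<le> C * (\<bar>x * t - x\<bar> / x)" using C(3) True x' by simp
      also have "\<bar>x * t - x\<bar> / x = \<bar>t - 1\<bar>"
      proof -
        have "x * t - x = x * (t - 1)" by (simp add: algebra_simps)
        then show ?thesis using x' by (simp add: abs_mult)
      qed
      also have "C * \<bar>t - 1\<bar> \<le> C * norm D" using D C by (intro mult_left_mono) auto
      finally have 1: "norm (sigmaK \<nu> J (x * t) - sigmaK \<nu> J x) / norm D \<le> C" using D by (simp add: pos_divide_le_eq)
      have w: "weight x \<gamma> t \<le> weight x0 \<Gamma> t + weight x0 (- \<Gamma>) t"
        using weight_le[OF x \<gamma> True exponent_nonneg[OF True]] by simp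
      have "(indicator {0<..} t *\<^sub>R f t) * s t - sigmaK \<nu> J x * (indicator {0<..} t *\<^sub>R f t) = of_real (weight x \<gamma> t) * ((sigmaK \<nu> J (x * t) - sigmaK \<nu> J x) / D)"
        using True by (simp add: f_def s_def D_def algebra_simps diff_divide_distrib)
      also have "norm \<dots> = weight x \<gamma> t * (norm (sigmaK \<nu> J (x * t) - sigmaK \<nu> J x) / norm D)"
        unfolding norm_mult norm_of_real norm_divide using weight_nonneg by simp
      also have "\<dots> \<le> (weight x0 \<Gamma> t + weight x0 (- \<Gamma>) t) * C"
        using w 1 weight_sum_nonneg[of t] by (intro mult_mono) auto
      finally show ?thesis using True by (simp add: mult.commute)
    qed simp
  qed
  also have "\<dots> = C * W" by (simp add: W_def set_lebesgue_integral_def)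
  finally show ?B unfolding comm f_def .
qed

end

section \<open>The limit at argument +-pi\<close>

lemma exp_half_turn: "s \<in> {1, -1} \<Longrightarrow> exp (- (\<i> * of_real (s * pi)) / 2) = - of_real s * \<i>"
proof -
  assume s: "s \<in> {1, -1}"
  have "- (\<i> * of_real (s * pi)) / 2 = \<i> * of_real (- (s * pi) / 2)" by simp
  then have "exp (- (\<i> * of_real (s * pi)) / 2) = cis (- (s * pi) / 2)" by (simp only: cis_conv_exp)
  then show ?thesis using s by (auto simp: complex_eq_iff)
qed

text \<open>These points approach -x vertically and not along the circle, so that the denominators
  become t - 1 plus an imaginary shift. In the logarithmic coordinate they stay inside the strip
  where the exact formula holds.\<close>

lemma exp_Ln_circle:
  fixes x s \<eta> :: real
  assumes "x > 0" "s \<in> {1, -1}" "\<eta> > 0"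
  shows "exp (of_real (ln x) + Ln (of_real (- 1) + \<i> * of_real (s * \<eta>))) = of_real x * (-1 + \<i> * of_real (s * \<eta>))"
    and "\<bar>Im (of_real (ln x) + Ln (of_real (- 1) + \<i> * of_real (s * \<eta>)))\<bar> < pi"
proof -
  define y where "y = of_real (- 1) + \<i> * of_real (s * \<eta>)"
  have y: "y \<noteq> 0" "Im y \<noteq> 0" using assms by (auto simp: y_def complex_eq_iff)
  have "exp (of_real (ln x) + Ln y) = of_real x * y"
    unfolding exp_add exp_Ln[OF y(1)] using assms(1) by (simp add: exp_of_real)
  then show "exp (of_real (ln x) + Ln (of_real (- 1) + \<i> * of_real (s * \<eta>))) = of_real x * (-1 + \<i> * of_real (s * \<eta>))"
    by (simp add: y_def)
  have "Im (Ln y) \<le> pi" "- pi < Im (Ln y)" "Im (Ln y) \<noteq> pi"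
    using y Im_Ln_le_pi mpi_less_Im_Ln Im_Ln_eq_pi by auto
  then show "\<bar>Im (of_real (ln x) + Ln (of_real (- 1) + \<i> * of_real (s * \<eta>)))\<bar> < pi"
    by (simp add: y_def abs_less_iff)
qed

context saddle_estimates
begin

definition H :: "real \<Rightarrow> real \<Rightarrow> complex" where
  "H x \<gamma> = integral {-\<delta>..\<delta>} (\<lambda>w. of_real (exp (- x * w\<^sup>2)) * h \<gamma> w)"

text \<open>The exact formula is taken at points near -x and the shift is sent to 0. Main terms
  converge by the Plemelj limit. The parts that are only estimated are put into \<open>E\<close>;
  their convergence is not proved from the integrals but read off from the identity itself.\<close>

lemma boundary_representation:
  fixes x s :: real and m :: nat
  assumes x: "x \<ge> x0" and s: "s \<in> {1, -1}" and m: "\<bar>Re \<nu>\<bar> < real m + 1/2"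
    and \<alpha>: "\<bar>real m - 2 * x\<bar> + real J \<le> \<Gamma>" and cos: "cos (of_real pi * \<nu>) \<noteq> 0"
    and C: "C \<ge> 0" "\<And>t. t > 0 \<Longrightarrow> norm (sigmaK \<nu> J t) \<le> C"
    "\<And>t y. t > 0 \<Longrightarrow> y > 0 \<Longrightarrow> norm (sigmaK \<nu> J t - sigmaK \<nu> J y) \<le> C * (\<bar>t - y\<bar> / y)"
  defines "\<alpha> \<equiv> real m - 2 * x" and "Eo \<equiv> W / d * exp (- (x - x0) * \<delta>\<^sup>2)"
  obtains E where
    "norm E \<le> (\<Sum>j<J. norm (coeff_a \<nu> j / of_real x ^ j)) * Eo
        + norm (stokesC \<nu> / of_real x ^ J) * (C * (norm (H x (\<alpha> - real J)) + pi + Eo) + C * W)"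
    "besselK_polar \<nu> x (s * pi) =
        - of_real s * \<i> * of_real (sqrt (pi / (2 * x)) * exp x) * (\<Sum>k<m. (-1) ^ k * coeff_a \<nu> k / of_real x ^ k)
        + of_real s * \<i> * of_real (sqrt (pi / (2 * x)) * exp (- x)) * (cos (of_real pi * \<nu>) / of_real pi) *
          ((\<Sum>j<J. coeff_a \<nu> j / of_real x ^ j * (- H x (\<alpha> - real j) - \<i> * of_real (s * pi))) + E)"
proof -
  have x': "x > 0" using x x0 \<Gamma> by linarith
  have \<gamma>: "\<bar>\<alpha> - real j\<bar> \<le> \<Gamma>" if "j \<le> J" for j
    using that assms(4) unfolding \<alpha>_def by (auto simp: abs_le_iff)
  define \<eta> :: "nat \<Rightarrow> real" where "\<eta> n = inverse (real (Suc n))" for n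
  have \<eta>: "\<eta> n > 0" "\<eta> \<longlonglongrightarrow> 0" for n unfolding \<eta>_def using LIMSEQ_inverse_real_of_nat by auto
  have y: "s * \<eta> n \<noteq> 0" for n using s \<eta>(1)[of n] by auto
  define \<zeta> where "\<zeta> n = of_real (ln x) + Ln (of_real (- 1) + \<i> * of_real (s * \<eta> n))" for n
  define \<zeta>' where "\<zeta>' = of_real (ln x) + \<i> * of_real (s * pi)"
  have \<zeta>lim: "\<zeta> \<longlonglongrightarrow> \<zeta>'"
    unfolding \<zeta>_def \<zeta>'_def using Ln_near_negative_axis[OF zero_less_one s \<eta>] by (intro tendsto_add tendsto_const) simp
  have e\<zeta>: "exp (\<zeta> n) = of_real x * (-1 + \<i> * of_real (s * \<eta> n))" and Im\<zeta>: "\<bar>Im (\<zeta> n)\<bar> < pi" for n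
    unfolding \<zeta>_def by (rule exp_Ln_circle[OF x' s \<eta>(1)])+
  define pre where "pre z = of_real (sqrt (pi / 2)) * exp (- z / 2) * exp (- exp z)" for z :: complex
  define sm where "sm z = (\<Sum>k<m. coeff_a \<nu> k * exp (- (of_nat k * z)))" for z :: complex
  define mul where "mul z = (-1) ^ m * exp (z - of_nat m * z) * stokesC \<nu>" for z :: complex
  define A0 where "A0 = complex_of_real (sqrt (pi / 2) * (x ^ m / x) * exp (- 2 * x))"
  have L: "besselK_log \<nu> (\<zeta> n) = pre (\<zeta> n) * (sm (\<zeta> n) + mul (\<zeta> n) * stieltjesK \<nu> m (of_real x * (-1 + \<i> * of_real (s * \<eta> n))))" for n
    unfolding pre_def sm_def mul_def stokesC_def e\<zeta>[symmetric] by (rule besselK_log_stieltjes[OF Im\<zeta> m])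
  have nzs: "stokesC \<nu> \<noteq> 0" using cos by (simp add: stokesC_def)
  have nz: "pre z \<noteq> 0" "mul z \<noteq> 0" "A0 \<noteq> 0" for z
    using nzs x' by (auto simp: pre_def mul_def A0_def)
  define Qin where "Qin j n = (LINT t:{a..b}|lborel. of_real (weight x (\<alpha> - real j) t) / (of_real (t - 1) + \<i> * of_real (s * \<eta> n)))" for j n
  define Q where "Q j n = (LINT t:{0<..}|lborel. of_real (weight x (\<alpha> - real j) t) / (of_real (t - 1) + \<i> * of_real (s * \<eta> n)))" for j n
  define R where "R n = (LINT t:{0<..}|lborel. of_real (weight x (\<alpha> - real J) t) * sigmaK \<nu> J (x * t) / (of_real (t - 1) + \<i> * of_real (s * \<eta> n)))" for n
  have S: "stieltjesK \<nu> m (of_real x * (-1 + \<i> * of_real (s * \<eta> n))) =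
     A0 * ((\<Sum>j<J. coeff_a \<nu> j / of_real x ^ j * Q j n) + (-1) ^ J * stokesC \<nu> / of_real x ^ J * R n)" for n
  proof -
    let ?D = "\<lambda>t. of_real (t - 1) + \<i> * of_real (s * \<eta> n)"
    have i1: "set_integrable lborel {0<..} (\<lambda>t. coeff_a \<nu> j / of_real x ^ j * (of_real (weight x (\<alpha> - real j) t) / ?D t))" if "j \<in> {..<J}" for j
      using that by (intro set_integrable_mult_right pole_integrable[OF x \<gamma> y]) auto
    have i2: "set_integrable lborel {0<..} (\<lambda>t. (-1) ^ J * stokesC \<nu> / of_real x ^ J * (of_real (weight x (\<alpha> - real J) t) * sigmaK \<nu> J (x * t) / ?D t))"
      by (intro set_integrable_mult_right pole_sigma(1)[OF x \<gamma> y C]) auto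
    have "stieltjesK \<nu> m (of_real x * (-1 + \<i> * of_real (s * \<eta> n))) = (LINT t:{0<..}|lborel.
        A0 * ((\<Sum>j<J. coeff_a \<nu> j / of_real x ^ j * (of_real (weight x (\<alpha> - real j) t) / ?D t)) +
           (-1) ^ J * stokesC \<nu> / of_real x ^ J * (of_real (weight x (\<alpha> - real J) t) * sigmaK \<nu> J (x * t) / ?D t)))"
      unfolding stieltjesK_scaled[OF x']
    proof (rule set_lebesgue_integral_cong)
      show "\<forall>t. t \<in> {0<..} \<longrightarrow> of_real ((x * t) powr (real m - 1/2) * exp (- (x * t))) * besselK \<nu> (x * t) / ?D t =
         A0 * ((\<Sum>j<J. coeff_a \<nu> j / of_real x ^ j * (of_real (weight x (\<alpha> - real j) t) / ?D t)) +
           (-1) ^ J * stokesC \<nu> / of_real x ^ J * (of_real (weight x (\<alpha> - real J) t) * sigmaK \<nu> J (x * t) / ?D t))"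
      proof (intro allI impI)
        fix t :: real assume "t \<in> {0<..}"
        then have t: "t > 0" by simp
        show "of_real ((x * t) powr (real m - 1/2) * exp (- (x * t))) * besselK \<nu> (x * t) / ?D t =
         A0 * ((\<Sum>j<J. coeff_a \<nu> j / of_real x ^ j * (of_real (weight x (\<alpha> - real j) t) / ?D t)) +
           (-1) ^ J * stokesC \<nu> / of_real x ^ J * (of_real (weight x (\<alpha> - real J) t) * sigmaK \<nu> J (x * t) / ?D t))"
          unfolding moment_integrand_expansion[OF x' t \<nu>] \<alpha>_def[symmetric] A0_def[symmetric]
          by (simp only: times_divide_eq_right[symmetric] add_divide_distrib sum_divide_distrib)
      qed
    qed simp
    also have "\<dots> = A0 * ((LINT t:{0<..}|lborel. \<Sum>j<J. coeff_a \<nu> j / of_real x ^ j * (of_real (weight x (\<alpha> - real j) t) / ?D t)) +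
       (LINT t:{0<..}|lborel. (-1) ^ J * stokesC \<nu> / of_real x ^ J * (of_real (weight x (\<alpha> - real J) t) * sigmaK \<nu> J (x * t) / ?D t)))"
      by (subst set_integral_mult_right) (simp only: set_integral_add(2)[OF set_integral_finite_sum(1)[OF i1] i2])
    also have "(LINT t:{0<..}|lborel. \<Sum>j<J. coeff_a \<nu> j / of_real x ^ j * (of_real (weight x (\<alpha> - real j) t) / ?D t)) =
       (\<Sum>j<J. coeff_a \<nu> j / of_real x ^ j * Q j n)"
      unfolding Q_def set_integral_mult_right[symmetric] by (rule set_integral_finite_sum(2)[OF i1])
    also have "(LINT t:{0<..}|lborel. (-1) ^ J * stokesC \<nu> / of_real x ^ J * (of_real (weight x (\<alpha> - real J) t) * sigmaK \<nu> J (x * t) / ?D t))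
       = (-1) ^ J * stokesC \<nu> / of_real x ^ J * R n"
      unfolding R_def by (rule set_integral_mult_right)
    finally show ?thesis .
  qed
  \<comment> \<open>Everything for which only bounds are available: the range outside [a,b] and the
    term with the inner remainder.\<close>
  define E where "E n = (\<Sum>j<J. coeff_a \<nu> j / of_real x ^ j * (Q j n - Qin j n)) + (-1) ^ J * stokesC \<nu> / of_real x ^ J * R n" for n
  have LE: "besselK_log \<nu> (\<zeta> n) = pre (\<zeta> n) * (sm (\<zeta> n) + mul (\<zeta> n) * (A0 * ((\<Sum>j<J. coeff_a \<nu> j / of_real x ^ j * Qin j n) + E n)))" for n
    unfolding L S E_def by (simp only: right_diff_distrib sum_subtractf) simp
  have Qd: "norm (Q j n - Qin j n) \<le> Eo" if "j \<le> J" for j n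
    unfolding Q_def Qin_def Eo_def by (rule pole_outside[OF x \<gamma>[OF that] y])
  have Rb: "norm (R n) \<le> C * (norm (Qin J n) + Eo) + C * W" for n
  proof -
    have "norm (R n - sigmaK \<nu> J x * Q J n) \<le> C * W"
      unfolding R_def Q_def by (rule pole_sigma(2)[OF x \<gamma> y C]) simp
    moreover have "norm (sigmaK \<nu> J x * Q J n) \<le> C * (norm (Qin J n) + Eo)"
    proof -
      have "norm (Q J n) \<le> norm (Qin J n) + Eo" using Qd[of J n] norm_triangle_sub[of "Q J n" "Qin J n"] by simp
      then show ?thesis unfolding norm_mult using C(1) C(2)[OF x'] by (intro mult_mono) auto
    qed
    ultimately show ?thesis using norm_triangle_sub[of "R n" "sigmaK \<nu> J x * Q J n"] by linarith
  qed
  define Eb where "Eb q = (\<Sum>j<J. norm (coeff_a \<nu> j / of_real x ^ j)) * Eo + norm (stokesC \<nu> / of_real x ^ J) * (C * (q + Eo) + C * W)" for q :: real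
  have Ebound: "norm (E n) \<le> Eb (norm (Qin J n))" for n
    unfolding E_def Eb_def
  proof (rule norm_triangle_mono)
    show "norm (\<Sum>j<J. coeff_a \<nu> j / of_real x ^ j * (Q j n - Qin j n)) \<le> (\<Sum>j<J. norm (coeff_a \<nu> j / of_real x ^ j)) * Eo"
      unfolding sum_distrib_right
    proof (rule sum_norm_le)
      fix j assume "j \<in> {..<J}"
      then show "norm (coeff_a \<nu> j / of_real x ^ j * (Q j n - Qin j n)) \<le> norm (coeff_a \<nu> j / of_real x ^ j) * Eo"
        unfolding norm_mult[of "coeff_a \<nu> j / of_real x ^ j"] by (intro mult_left_mono Qd) auto
    qed
    have "norm ((-1) ^ J * stokesC \<nu> / of_real x ^ J * R n) = norm (stokesC \<nu> / of_real x ^ J) * norm (R n)"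
      by (simp add: norm_mult norm_divide norm_power)
    also have "\<dots> \<le> norm (stokesC \<nu> / of_real x ^ J) * (C * (norm (Qin J n) + Eo) + C * W)" by (intro mult_left_mono Rb) simp
    finally show "norm ((-1) ^ J * stokesC \<nu> / of_real x ^ J * R n) \<le> norm (stokesC \<nu> / of_real x ^ J) * (C * (norm (Qin J n) + Eo) + C * W)" .
  qed
  have Qlim: "Qin j \<longlonglongrightarrow> - H x (\<alpha> - real j) - \<i> * of_real (s * pi)" for j
    unfolding Qin_def H_def weight_def by (rule plemelj_saddle[OF x' s \<eta>])
  define QQ where "QQ = (\<Sum>j<J. coeff_a \<nu> j / of_real x ^ j * (- H x (\<alpha> - real j) - \<i> * of_real (s * pi)))"
  have Qsum: "(\<lambda>n. \<Sum>j<J. coeff_a \<nu> j / of_real x ^ j * Qin j n) \<longlonglongrightarrow> QQ"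
    unfolding QQ_def by (intro tendsto_sum tendsto_mult tendsto_const Qlim)
  have "isCont (besselK_log \<nu>) \<zeta>'"
    using besselK_log_holomorphic[of \<nu>] by (auto simp: continuous_on_eq_continuous_at dest!: holomorphic_on_imp_continuous_on)
  then have Llim: "(\<lambda>n. besselK_log \<nu> (\<zeta> n)) \<longlonglongrightarrow> besselK_log \<nu> \<zeta>'" by (rule isCont_tendsto_compose[OF _ \<zeta>lim])
  have plim: "(\<lambda>n. pre (\<zeta> n)) \<longlonglongrightarrow> pre \<zeta>'" "(\<lambda>n. sm (\<zeta> n)) \<longlonglongrightarrow> sm \<zeta>'" "(\<lambda>n. mul (\<zeta> n)) \<longlonglongrightarrow> mul \<zeta>'"
    unfolding pre_def sm_def mul_def by (intro tendsto_intros \<zeta>lim; simp)+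
  \<comment> \<open>Solving the identity for \<open>E n\<close> shows that it converges, because all
    other quantities do. The division uses that the Stokes constant is nonzero, that is, cos (pi
    \<nu>) is nonzero. The bounds on \<open>E n\<close> pass to the limit.\<close>
  have Eeq: "E n = (besselK_log \<nu> (\<zeta> n) / pre (\<zeta> n) - sm (\<zeta> n)) / mul (\<zeta> n) / A0 - (\<Sum>j<J. coeff_a \<nu> j / of_real x ^ j * Qin j n)" for n
    unfolding LE using nz by simp
  define E' where "E' = (besselK_log \<nu> \<zeta>' / pre \<zeta>' - sm \<zeta>') / mul \<zeta>' / A0 - QQ"
  have Elim: "E \<longlonglongrightarrow> E'"
    unfolding Eeq E'_def by (intro tendsto_diff tendsto_divide tendsto_const Llim plim Qsum nz)
  have "(\<lambda>n. Eb (norm (Qin J n))) \<longlonglongrightarrow> Eb (norm (- H x (\<alpha> - real J) - \<i> * of_real (s * pi)))"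
    unfolding Eb_def by (intro tendsto_intros Qlim)
  then have "norm E' \<le> Eb (norm (- H x (\<alpha> - real J) - \<i> * of_real (s * pi)))"
    using tendsto_norm[OF Elim] Ebound by (intro LIMSEQ_le) auto
  also have "\<dots> \<le> Eb (norm (H x (\<alpha> - real J)) + pi)"
  proof -
    have "norm (- H x (\<alpha> - real J) - \<i> * of_real (s * pi)) \<le> norm (H x (\<alpha> - real J)) + norm (\<i> * of_real (s * pi))"
      using norm_triangle_ineq4[of "- H x (\<alpha> - real J)" "\<i> * of_real (s * pi)"] by simp
    also have "norm (\<i> * of_real (s * pi)) = pi" using s by (auto simp: norm_mult)
    finally show ?thesis unfolding Eb_def using C(1)
      by (intro add_left_mono mult_left_mono add_right_mono) auto
  qed
  finally have E'bound: "norm E' \<le> Eb (norm (H x (\<alpha> - real J)) + pi)" .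
  have "besselK_log \<nu> \<zeta>' = pre \<zeta>' * (sm \<zeta>' + mul \<zeta>' * (A0 * (QQ + E')))"
    unfolding E'_def using nz by simp
  also have "\<dots> = pre \<zeta>' * sm \<zeta>' + pre \<zeta>' * mul \<zeta>' * A0 * (QQ + E')" by (simp add: algebra_simps)
  also have "pre \<zeta>' = - of_real s * \<i> * of_real (sqrt (pi / (2 * x)) * exp x)"
  proof -
    have e1: "exp \<zeta>' = - of_real x"
      unfolding \<zeta>'_def exp_add using s x' by (auto simp: exp_of_real exp_minus)
    have "exp (- \<zeta>' / 2) = exp (- of_real (ln x) / 2) * exp (- (\<i> * of_real (s * pi)) / 2)"
      unfolding \<zeta>'_def by (simp add: diff_divide_distrib flip: exp_add)
    also have "exp (- complex_of_real (ln x) / 2) = of_real (1 / sqrt x)"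
    proof -
      have "exp (- ln x / 2) = x powr (- (1/2))" using x' by (simp add: powr_def)
      also have "\<dots> = 1 / sqrt x" using x' by (simp add: powr_minus_divide powr_half_sqrt)
      finally have l: "exp (- ln x / 2) = 1 / sqrt x" .
      have "exp (- complex_of_real (ln x) / 2) = exp (of_real (- ln x / 2))" by simp
      also have "\<dots> = of_real (exp (- ln x / 2))" by (rule exp_of_real)
      finally show ?thesis unfolding l .
    qed
    finally have e2: "exp (- \<zeta>' / 2) = of_real (1 / sqrt x) * (- of_real s * \<i>)" unfolding exp_half_turn[OF s] .
    have e3: "exp (- (- of_real x)) = complex_of_real (exp x)" by (simp add: exp_of_real)
    have sq: "sqrt (pi / (2 * x)) = sqrt (pi / 2) * (1 / sqrt x)" by (simp add: real_sqrt_divide real_sqrt_mult)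
    show ?thesis unfolding pre_def e1 e2 e3 sq by (simp add: mult_ac)
  qed
  also have "sm \<zeta>' = (\<Sum>k<m. (-1) ^ k * coeff_a \<nu> k / of_real x ^ k)"
    unfolding sm_def
  proof (rule sum.cong[OF refl])
    fix k
    have e1: "exp \<zeta>' = - of_real x"
      unfolding \<zeta>'_def exp_add using s x' by (auto simp: exp_of_real exp_minus)
    have "exp (- (of_nat k * \<zeta>')) = 1 / (- of_real x) ^ k" by (simp add: exp_minus exp_of_nat_mult e1 divide_inverse)
    also have "\<dots> = (-1) ^ k / of_real x ^ k" by (simp add: power_minus[of "of_real x"] divide_simps)
    finally show "coeff_a \<nu> k * exp (- (of_nat k * \<zeta>')) = (-1) ^ k * coeff_a \<nu> k / of_real x ^ k" by simp
  qed
  \<comment> \<open>At \<zeta>' the exponential is -x, so the powers x^m cancel against those in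
    \<open>A0\<close>, the signs (-1)^m cancel each other, and exp x times exp (-2x) leaves the
    recessive exp (-x).\<close>
  also have "- of_real s * \<i> * of_real (sqrt (pi / (2 * x)) * exp x) * mul \<zeta>' * A0 =
      of_real s * \<i> * of_real (sqrt (pi / (2 * x)) * exp (- x)) * (cos (of_real pi * \<nu>) / of_real pi)"
  proof -
    have e1: "exp \<zeta>' = - of_real x"
      unfolding \<zeta>'_def exp_add using s x' by (auto simp: exp_of_real exp_minus)
    have "exp (\<zeta>' - of_nat m * \<zeta>') = - of_real x / (- of_real x) ^ m" by (simp add: exp_diff exp_of_nat_mult e1)
    then have "mul \<zeta>' = - of_real (x / x ^ m) * stokesC \<nu>"
      unfolding mul_def by (simp add: power_minus[of "of_real x"])
    then have "- of_real s * \<i> * of_real (sqrt (pi / (2 * x)) * exp x) * mul \<zeta>' * A0 =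
      of_real s * \<i> * stokesC \<nu> * of_real (sqrt (pi / (2 * x)) * (exp x * exp (- 2 * x)) * ((x / x ^ m) * (x ^ m / x)) * sqrt (pi / 2))"
      unfolding A0_def by (simp add: mult_ac)
    also have "exp x * exp (- 2 * x) = exp (- x)" by (simp flip: exp_add)
    also have "(x / x ^ m) * (x ^ m / x) = 1" using x' by simp
    also have "stokesC \<nu> = (cos (of_real pi * \<nu>) / of_real pi) * of_real (sqrt (2 / pi))" by (simp add: stokesC_def)
    also have "of_real s * \<i> * ((cos (of_real pi * \<nu>) / of_real pi) * of_real (sqrt (2 / pi))) * of_real (sqrt (pi / (2 * x)) * exp (- x) * 1 * sqrt (pi / 2))
      = of_real s * \<i> * of_real (sqrt (pi / (2 * x)) * exp (- x)) * (cos (of_real pi * \<nu>) / of_real pi) * of_real (sqrt (2 / pi) * sqrt (pi / 2))"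
      by (simp add: mult_ac)
    also have "sqrt (2 / pi) * sqrt (pi / 2) = 1" by (simp flip: real_sqrt_mult)
    finally show ?thesis by simp
  qed
  finally have final: "besselK_log \<nu> \<zeta>' = - of_real s * \<i> * of_real (sqrt (pi / (2 * x)) * exp x) * (\<Sum>k<m. (-1) ^ k * coeff_a \<nu> k / of_real x ^ k)
        + of_real s * \<i> * of_real (sqrt (pi / (2 * x)) * exp (- x)) * (cos (of_real pi * \<nu>) / of_real pi) * (QQ + E')" .
  have "besselK_polar \<nu> x (s * pi) = besselK_log \<nu> \<zeta>'"
    unfolding besselK_polar_def \<zeta>'_def by (rule arg_cong[where f = "besselK_log \<nu>"]) (simp add: complex_eq_iff)
  with final E'bound show thesis
    unfolding Eb_def QQ_def by (intro that[of E']) (simp_all add: add.assoc)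
qed

end

section \<open>Collecting the two series and the error\<close>

lemma coeff_A_eq: "coeff_A \<nu> j = (-2) ^ j * coeff_a \<nu> j"
proof -
  have "(-2) ^ j * ((-1) ^ j / (2 ^ j * fact j)) = (1 / fact j :: complex)"
  proof -
    have "(-2) ^ j * (-1) ^ j = (2 ^ j :: complex)" unfolding power_mult_distrib[symmetric] by simp
    then show ?thesis by simp
  qed
  moreover have "(-2) ^ j * coeff_a \<nu> j =
      ((-2) ^ j * ((-1) ^ j / (2 ^ j * fact j))) * (pochhammer (1/2 + \<nu>) j * pochhammer (1/2 - \<nu>) j)"
    unfolding coeff_a_def by (simp only: mult.assoc)
  ultimately show ?thesis unfolding coeff_A_def by (simp add: mult.commute)
qed

text \<open>The signs and powers of two combine to (-1)^n (-2)^k (-2)^(n-k) = 2^n, which cancels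
  against (2x)^n. Hence the B-series is the Cauchy product of the a-series with the Laplace series,
  in which \<gamma> depends on the first index.\<close>

lemma scaled_coeff_B:
  "(-1) ^ n * coeff_B \<nu> \<alpha> n / of_real (2 * x) ^ n =
     (\<Sum>k\<le>n. coeff_a \<nu> (n - k) / of_real x ^ (n - k) * (coeff_g (\<alpha> - real (n - k)) (2 * k) * pochhammer (1/2) k / of_real x ^ k))"
  unfolding coeff_B_def sum_distrib_left sum_divide_distrib atLeast0AtMost
proof (rule sum.cong[OF refl])
  fix k assume "k \<in> {..n}"
  then have n: "n = (n - k) + k" by simp
  have x: "complex_of_real x ^ n = of_real x ^ (n - k) * of_real x ^ k" by (subst n) (rule power_add)
  have "(-1) ^ n * ((-2) ^ k * (-2) ^ (n - k)) = ((-1) * (-2) :: complex) ^ n"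
    unfolding power_mult_distrib using n by (simp flip: power_add)
  then have two: "(-1) ^ n * ((-2) ^ k * (-2) ^ (n - k)) = (2 :: complex) ^ n" by simp
  have "(-1) ^ n * ((-2) ^ k * pochhammer (1/2) k * coeff_A \<nu> (n - k) * coeff_g (\<alpha> - real (n - k)) (2 * k)) / of_real (2 * x) ^ n
     = ((-1) ^ n * ((-2) ^ k * (-2) ^ (n - k))) * (coeff_a \<nu> (n - k) * (coeff_g (\<alpha> - real (n - k)) (2 * k) * pochhammer (1/2) k)) / (2 ^ n * of_real x ^ n)"
    unfolding coeff_A_eq by (simp add: power_mult_distrib mult_ac)
  also have "\<dots> = coeff_a \<nu> (n - k) / of_real x ^ (n - k) * (coeff_g (\<alpha> - real (n - k)) (2 * k) * pochhammer (1/2) k / of_real x ^ k)"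
    unfolding two x by (simp add: divide_simps)
  finally show "(-1) ^ n * ((-2) ^ k * pochhammer (1/2) k * coeff_A \<nu> (n - k) * coeff_g (\<alpha> - real (n - k)) (2 * k)) / of_real (2 * x) ^ n
     = coeff_a \<nu> (n - k) / of_real x ^ (n - k) * (coeff_g (\<alpha> - real (n - k)) (2 * k) * pochhammer (1/2) k / of_real x ^ k)" .
qed

text \<open>The terms of total order below M form the triangle that gives the coefficients B; what
  is left has total order at least M.\<close>

lemma double_sum_beyond_triangle:
  fixes F :: "nat \<Rightarrow> nat \<Rightarrow> 'a::ab_group_add"
  assumes "M \<le> J"
  shows "(\<Sum>j<J. \<Sum>k<M. F j k) - (\<Sum>n<M. \<Sum>k\<le>n. F (n - k) k) =
    (\<Sum>(j, k)\<in>{p \<in> {..<J} \<times> {..<M}. M \<le> fst p + snd p}. F j k)"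
proof -
  have "(\<Sum>n<M. \<Sum>k\<le>n. F (n - k) k) = (\<Sum>(k, j)\<in>{(i, j). i + j < M}. F j k)"
    by (rule sum.triangle_reindex[symmetric])
  also have "\<dots> = (\<Sum>(j, k)\<in>{p \<in> {..<J} \<times> {..<M}. \<not> M \<le> fst p + snd p}. F j k)"
    by (rule sum.reindex_bij_witness[of _ prod.swap prod.swap]) (use assms in auto)
  finally have tri: "(\<Sum>n<M. \<Sum>k\<le>n. F (n - k) k) = (\<Sum>(j, k)\<in>{p \<in> {..<J} \<times> {..<M}. \<not> M \<le> fst p + snd p}. F j k)" .
  have "(\<Sum>j<J. \<Sum>k<M. F j k) = (\<Sum>(j, k)\<in>{..<J} \<times> {..<M}. F j k)" by (rule sum.cartesian_product)
  also have "\<dots> = (\<Sum>(j, k)\<in>{p \<in> {..<J} \<times> {..<M}. M \<le> fst p + snd p}. F j k)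
      + (\<Sum>(j, k)\<in>{p \<in> {..<J} \<times> {..<M}. \<not> M \<le> fst p + snd p}. F j k)"
    by (subst sum.union_disjoint[symmetric]) (auto intro!: sum.cong)
  finally show ?thesis unfolding tri by simp
qed

text \<open>Apply y <= exp y at y = c x / M and raise to the power M.\<close>

lemma exp_minus_le_inverse_power:
  fixes c x :: real
  assumes "c > 0" "x > 0" "M > 0"
  shows "exp (- (c * x)) \<le> (real M / c) ^ M / x ^ M"
proof -
  define y where "y = c * x / real M"
  have y: "y > 0" using assms by (simp add: y_def)
  have "y \<le> exp y" using exp_ge_add_one_self[of y] by linarith
  then have "y ^ M \<le> exp y ^ M" using y by (intro power_mono) auto
  also have "exp y ^ M = exp (c * x)" using assms by (simp add: y_def flip: exp_of_nat_mult)
  finally have "inverse (exp (c * x)) \<le> inverse (y ^ M)" using y by (intro le_imp_inverse_le) auto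
  also have "inverse (y ^ M) = (real M / c) ^ M / x ^ M"
    unfolding y_def by (simp add: power_divide power_mult_distrib)
  finally show ?thesis by (simp add: exp_minus)
qed

lemma inverse_power_le: "x \<ge> 1 \<Longrightarrow> M \<le> j \<Longrightarrow> 1 / x ^ j \<le> 1 / x ^ M" for x :: real
  by (intro divide_left_mono power_increasing mult_pos_pos) auto

context saddle_estimates
begin

text \<open>The constants depend on \<open>A\<close> and not on \<open>m\<close>, so the estimate
  holds for all truncation indices within distance \<open>A\<close> of 2x at once; this is what an
  index function of x requires.\<close>

lemma asymptotic_bound:
  assumes M: "M > 0" "M \<le> J" and A: "A \<ge> 0" "A + real J \<le> \<Gamma>" and cos: "cos (of_real pi * \<nu>) \<noteq> 0"
  obtains K x1 where "\<And>x m s. x \<ge> x1 \<Longrightarrow> \<bar>real m - 2 * x\<bar> \<le> A \<Longrightarrow> s \<in> {1, -1} \<Longrightarrow>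
    \<exists>Z. norm (Z - ((1/2) * (\<Sum>k<M. coeff_a \<nu> k / of_real x ^ k)
              - of_real s * \<i> / of_real (2 * sqrt (pi * x))
                * (\<Sum>j<M. (-1) ^ j * coeff_B \<nu> (real m - 2 * x) j / of_real (2 * x) ^ j))) \<le> K / x ^ M \<and>
      besselK_polar \<nu> x (s * pi) =
        - of_real s * \<i> * of_real (sqrt (pi / (2 * x)) * exp x) * (\<Sum>k<m. (-1) ^ k * coeff_a \<nu> k / of_real x ^ k)
        + 2 * cos (of_real pi * \<nu>) * of_real (sqrt (pi / (2 * x)) * exp (- x)) * Z"
proof -
  obtain C where C: "C \<ge> 0" "\<And>t. t > 0 \<Longrightarrow> norm (sigmaK \<nu> J t) \<le> C"
    "\<And>t y. t > 0 \<Longrightarrow> y > 0 \<Longrightarrow> norm (sigmaK \<nu> J t - sigmaK \<nu> J y) \<le> C * (\<bar>t - y\<bar> / y)"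
    using sigmaK_bounds[OF \<nu>] by blast
  define GG where "GG x \<gamma> = of_real (sqrt (pi / x)) * (\<Sum>k<M. gcoeff \<gamma> (2 * k) * pochhammer (1/2) k / of_real x ^ k)" for x \<gamma> :: real
  obtain CL where CL: "\<And>\<gamma> x. \<bar>\<gamma>\<bar> \<le> \<Gamma> \<Longrightarrow> x > 0 \<Longrightarrow> norm (H x \<gamma> - GG x \<gamma>) \<le> CL / (x ^ M * sqrt x)"
    using laplace_saddle[of \<Gamma> M] unfolding H_def GG_def by blast
  define b' where "b' k = 2 powr \<Gamma> * (9/4) / (\<rho>/2) ^ Suc (2 * k) * norm (pochhammer (1/2) k :: complex)" for k
  have gb: "norm (gcoeff \<gamma> (2 * k) * pochhammer (1/2) k) \<le> b' k" if "\<bar>\<gamma>\<bar> \<le> \<Gamma>" for \<gamma> k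
    unfolding b'_def norm_mult by (intro mult_right_mono norm_gcoeff_le that) simp
  have b'0: "b' k \<ge> 0" for k unfolding b'_def using \<rho> by simp
  define S where "S = (\<Sum>j<J. norm (coeff_a \<nu> j))"
  define BG where "BG = sqrt pi * (\<Sum>k<M. b' k)"
  define KE where "KE = exp (x0 * \<delta>\<^sup>2) * (real M / \<delta>\<^sup>2) ^ M"
  \<comment> \<open>In this order: the terms with j >= M, the Laplace errors, the products beyond
    the triangle, and the error \<open>E\<close> of the boundary representation.\<close>
  define K where "K = S + S * \<bar>CL\<bar> + sqrt pi * (\<Sum>(j, k)\<in>{..<J} \<times> {..<M}. norm (coeff_a \<nu> j) * b' k)
     + (S * (W / d * KE) + norm (stokesC \<nu>) * (C * (BG + \<bar>CL\<bar> + pi + W / d) + C * W))"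
  \<comment> \<open>Beyond \<open>x1\<close> the majorant at \<open>x0\<close> applies, negative
    powers of x are at most 1, and m >= 2x - A >= J, so the exact formula is available with m
    terms.\<close>
  define x1 where "x1 = max (max x0 1) (A + real J)"
  have S0: "S \<ge> 0" unfolding S_def by (intro sum_nonneg) simp
  have Wd: "W / d \<ge> 0" using W_nonneg d_pos by simp
  show thesis
  proof (rule that[of x1 K])
    fix x s :: real and m :: nat
    assume x: "x \<ge> x1" and m: "\<bar>real m - 2 * x\<bar> \<le> A" and s: "s \<in> {1, -1}"
    have xs: "x \<ge> x0" "x \<ge> 1" "x > 0" "x \<ge> A + real J" using x by (auto simp: x1_def)
    define \<alpha> where "\<alpha> = real m - 2 * x"
    have "real m \<ge> real J" using m xs A by (auto simp: abs_le_iff)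
    then have m': "\<bar>Re \<nu>\<bar> < real m + 1/2" using \<nu> by linarith
    have \<alpha>\<Gamma>: "\<bar>\<alpha>\<bar> + real J \<le> \<Gamma>" using m A by (simp add: \<alpha>_def)
    then have \<gamma>: "\<bar>\<alpha> - real j\<bar> \<le> \<Gamma>" if "j \<le> J" for j using that by (auto simp: abs_le_iff)
    define Eo where "Eo = W / d * exp (- (x - x0) * \<delta>\<^sup>2)"
    obtain E where E: "norm E \<le> (\<Sum>j<J. norm (coeff_a \<nu> j / of_real x ^ j)) * Eo
        + norm (stokesC \<nu> / of_real x ^ J) * (C * (norm (H x (\<alpha> - real J)) + pi + Eo) + C * W)"
      and rep: "besselK_polar \<nu> x (s * pi) =
        - of_real s * \<i> * of_real (sqrt (pi / (2 * x)) * exp x) * (\<Sum>k<m. (-1) ^ k * coeff_a \<nu> k / of_real x ^ k)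
        + of_real s * \<i> * of_real (sqrt (pi / (2 * x)) * exp (- x)) * (cos (of_real pi * \<nu>) / of_real pi) *
          ((\<Sum>j<J. coeff_a \<nu> j / of_real x ^ j * (- H x (\<alpha> - real j) - \<i> * of_real (s * pi))) + E)"
      using boundary_representation[OF xs(1) s m' \<alpha>\<Gamma>[unfolded \<alpha>_def] cos C] unfolding \<alpha>_def Eo_def by blast
    \<comment> \<open>The factor s i / pi of the representation, halved so that 2 cos (pi \<nu>) can
      stand in front of \<open>Z\<close>.\<close>
    define c where "c = of_real s * \<i> / of_real (2 * pi)"
    define Z where "Z = c * ((\<Sum>j<J. coeff_a \<nu> j / of_real x ^ j * (- H x (\<alpha> - real j) - \<i> * of_real (s * pi))) + E)"
    define a' where "a' j = coeff_a \<nu> j / of_real x ^ j" for j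
    define X1 where "X1 = (\<Sum>j\<in>{M..<J}. a' j)"
    define X2 where "X2 = (\<Sum>j<J. a' j * (H x (\<alpha> - real j) - GG x (\<alpha> - real j)))"
    define F where "F j k = a' j * (gcoeff (\<alpha> - real j) (2 * k) * pochhammer (1/2) k / of_real x ^ k)" for j k
    define X3 where "X3 = of_real (sqrt (pi / x)) * (\<Sum>(j, k)\<in>{p \<in> {..<J} \<times> {..<M}. M \<le> fst p + snd p}. F j k)"
    have cnorm: "norm c \<le> 1"
      using s pi_ge_two unfolding c_def norm_divide norm_mult by (auto simp: divide_le_eq)
    \<comment> \<open>Here the half residue, rescaled by \<open>c\<close>, becomes the coefficient
      1/2 of the a-series, with the same sign for both choices of \<open>s\<close>.\<close>
    have cs: "c * (\<i> * of_real (s * pi)) = - (1/2)" using s by (auto simp: c_def)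
    have GGs: "(\<Sum>j<J. a' j * GG x (\<alpha> - real j)) = X3 + of_real (sqrt (pi / x)) * (\<Sum>j<M. (-1) ^ j * coeff_B \<nu> \<alpha> j / of_real (2 * x) ^ j)"
    proof -
      have "(\<Sum>j<J. a' j * GG x (\<alpha> - real j)) = of_real (sqrt (pi / x)) * (\<Sum>j<J. \<Sum>k<M. F j k)"
        unfolding GG_def F_def sum_distrib_left by (intro sum.cong refl) (simp add: mult_ac)
      also have "(\<Sum>j<J. \<Sum>k<M. F j k) = (\<Sum>(j, k)\<in>{p \<in> {..<J} \<times> {..<M}. M \<le> fst p + snd p}. F j k) + (\<Sum>n<M. \<Sum>k\<le>n. F (n - k) k)"
        unfolding double_sum_beyond_triangle[OF M(2), symmetric] by simp
      also have "(\<Sum>n<M. \<Sum>k\<le>n. F (n - k) k) = (\<Sum>j<M. (-1) ^ j * coeff_B \<nu> \<alpha> j / of_real (2 * x) ^ j)"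
        unfolding scaled_coeff_B F_def a'_def coeff_g_eq by (rule refl)
      finally show ?thesis unfolding X3_def by (simp only: distrib_left)
    qed
    have cB: "c * of_real (sqrt (pi / x)) = of_real s * \<i> / of_real (2 * sqrt (pi * x))"
    proof -
      have "sqrt (pi / x) / (2 * pi) = 1 / (2 * sqrt (pi * x))"
        using xs(3) by (simp add: real_sqrt_divide real_sqrt_mult field_simps)
      then have "complex_of_real (sqrt (pi / x) / (2 * pi)) = of_real (1 / (2 * sqrt (pi * x)))" by (rule arg_cong)
      then have "complex_of_real (sqrt (pi / x)) / of_real (2 * pi) = 1 / of_real (2 * sqrt (pi * x))"
        by (simp only: of_real_divide of_real_1)
      then have "of_real s * \<i> * (complex_of_real (sqrt (pi / x)) / of_real (2 * pi)) = of_real s * \<i> * (1 / of_real (2 * sqrt (pi * x)))"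
        by (rule arg_cong)
      then show ?thesis unfolding c_def by (simp only: times_divide_eq_left times_divide_eq_right mult_1_right)
    qed
    have a'J: "(\<Sum>j<J. a' j) = (\<Sum>j<M. a' j) + X1"
      unfolding X1_def using sum.atLeastLessThan_concat[of 0 M J a'] M by (simp add: atLeast0LessThan)
    have "Z = - c * (\<Sum>j<J. a' j * H x (\<alpha> - real j)) - (\<Sum>j<J. a' j) * (c * (\<i> * of_real (s * pi))) + c * E"
      unfolding Z_def a'_def[symmetric] by (simp add: algebra_simps sum.distrib sum_subtractf sum_distrib_left sum_distrib_right sum_negf)
    also have "\<dots> = (1/2) * (\<Sum>j<J. a' j) - c * (\<Sum>j<J. a' j * H x (\<alpha> - real j)) + c * E"
      unfolding cs by simp
    also have "(\<Sum>j<J. a' j * H x (\<alpha> - real j)) = X2 + (\<Sum>j<J. a' j * GG x (\<alpha> - real j))"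
      unfolding X2_def by (simp add: right_diff_distrib sum_subtractf)
    finally have Zeq: "Z = (1/2) * ((\<Sum>j<M. a' j) + X1) - (c * X2 + (c * X3 + (c * of_real (sqrt (pi / x))) * (\<Sum>j<M. (-1) ^ j * coeff_B \<nu> \<alpha> j / of_real (2 * x) ^ j))) + c * E"
      unfolding GGs a'J by (simp add: distrib_left)
    have diff: "Z - ((1/2) * (\<Sum>k<M. coeff_a \<nu> k / of_real x ^ k)
              - of_real s * \<i> / of_real (2 * sqrt (pi * x))
                * (\<Sum>j<M. (-1) ^ j * coeff_B \<nu> \<alpha> j / of_real (2 * x) ^ j)) = (1/2) * X1 - c * X2 - c * X3 + c * E"
      unfolding Zeq cB a'_def[symmetric] by (simp add: distrib_left)
    have cle: "norm (c * q) \<le> norm q" for q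
      unfolding norm_mult using cnorm by (intro mult_left_le_one_le) auto
    have "norm ((1/2) * X1 - c * X2 - c * X3 + c * E) \<le> norm ((1/2) * X1 - c * X2 - c * X3) + norm (c * E)" by (rule norm_triangle_ineq)
    also have "\<dots> \<le> (norm ((1/2) * X1 - c * X2) + norm (c * X3)) + norm E" by (intro add_mono norm_triangle_ineq4 cle)
    also have "\<dots> \<le> ((norm ((1/2) * X1) + norm (c * X2)) + norm X3) + norm E" by (intro add_mono norm_triangle_ineq4 cle order_refl)
    also have "\<dots> \<le> ((norm X1 + norm X2) + norm X3) + norm E" by (intro add_mono cle order_refl) (simp add: norm_mult)
    finally have nd: "norm ((1/2) * X1 - c * X2 - c * X3 + c * E) \<le> norm X1 + norm X2 + norm X3 + norm E" .
    have xp: "0 < x ^ k" "1 \<le> x ^ k" for k using xs by (auto intro: one_le_power)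
    have an: "norm (a' j) = norm (coeff_a \<nu> j) * (1 / x ^ j)" for j
      using xs(3) by (simp add: a'_def norm_divide norm_power)
    have an1: "norm (a' j) \<le> norm (coeff_a \<nu> j)" for j
      unfolding an using xp(2)[of j] by (intro mult_right_le_one_le) auto
    have Sa: "(\<Sum>j<J. norm (a' j)) \<le> S" unfolding S_def by (intro sum_mono an1)
    have B1: "norm X1 \<le> S * (1 / x ^ M)"
    proof -
      have "norm X1 \<le> (\<Sum>j\<in>{M..<J}. norm (coeff_a \<nu> j) * (1 / x ^ M))"
        unfolding X1_def
      proof (rule sum_norm_le)
        fix j assume "j \<in> {M..<J}"
        then show "norm (a' j) \<le> norm (coeff_a \<nu> j) * (1 / x ^ M)"
          unfolding an by (intro mult_left_mono inverse_power_le xs) auto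
      qed
      also have "\<dots> = (\<Sum>j\<in>{M..<J}. norm (coeff_a \<nu> j)) * (1 / x ^ M)" by (rule sum_distrib_right[symmetric])
      also have "\<dots> \<le> S * (1 / x ^ M)"
        unfolding S_def using xp(1)[of M] by (intro mult_right_mono sum_mono2) auto
      finally show ?thesis .
    qed
    have HG: "norm (H x (\<alpha> - real j) - GG x (\<alpha> - real j)) \<le> \<bar>CL\<bar> * (1 / x ^ M)" if "j \<le> J" for j
    proof -
      have "norm (H x (\<alpha> - real j) - GG x (\<alpha> - real j)) \<le> CL / (x ^ M * sqrt x)" by (rule CL[OF \<gamma>[OF that] xs(3)])
      also have "\<dots> \<le> \<bar>CL\<bar> / (x ^ M * sqrt x)" using xs xp(1)[of M] by (intro divide_right_mono) auto
      also have "\<dots> \<le> \<bar>CL\<bar> / (x ^ M * 1)"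
        using xs xp(1)[of M] by (intro divide_left_mono mult_left_mono mult_pos_pos) auto
      finally show ?thesis by simp
    qed
    have B2: "norm X2 \<le> S * \<bar>CL\<bar> * (1 / x ^ M)"
    proof -
      have "norm X2 \<le> (\<Sum>j<J. norm (coeff_a \<nu> j) * (\<bar>CL\<bar> * (1 / x ^ M)))"
        unfolding X2_def
      proof (rule sum_norm_le)
        fix j assume "j \<in> {..<J}"
        then show "norm (a' j * (H x (\<alpha> - real j) - GG x (\<alpha> - real j))) \<le> norm (coeff_a \<nu> j) * (\<bar>CL\<bar> * (1 / x ^ M))"
          unfolding norm_mult by (intro mult_mono an1 HG) auto
      qed
      also have "\<dots> = S * \<bar>CL\<bar> * (1 / x ^ M)" unfolding S_def sum_distrib_right[symmetric] by (simp only: mult.assoc)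
      finally show ?thesis .
    qed
    have sq: "sqrt (pi / x) \<le> sqrt pi" using xs by (simp add: divide_le_eq)
    have B3: "norm X3 \<le> sqrt pi * (\<Sum>(j, k)\<in>{..<J} \<times> {..<M}. norm (coeff_a \<nu> j) * b' k) * (1 / x ^ M)"
    proof -
      let ?P = "{p \<in> {..<J} \<times> {..<M}. M \<le> fst p + snd p}"
      have "norm (\<Sum>(j, k)\<in>?P. F j k) \<le> (\<Sum>(j, k)\<in>?P. norm (coeff_a \<nu> j) * b' k * (1 / x ^ M))"
      proof (rule sum_norm_le)
        fix p assume p: "p \<in> ?P"
        obtain j k where jk: "p = (j, k)" by (cases p)
        with p have j: "j \<le> J" "M \<le> j + k" by auto
        have "norm (F j k) = norm (coeff_a \<nu> j) * norm (gcoeff (\<alpha> - real j) (2 * k) * pochhammer (1/2) k) * (1 / x ^ (j + k))"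
          unfolding F_def norm_mult an using xs(3) by (simp add: norm_mult norm_divide norm_power power_add)
        also have "\<dots> \<le> norm (coeff_a \<nu> j) * b' k * (1 / x ^ M)"
          using xp(1)[of "j + k"] b'0 by (intro mult_mono mult_left_mono gb[OF \<gamma>[OF j(1)]] inverse_power_le[OF xs(2) j(2)]) auto
        finally show "norm (case p of (j, k) \<Rightarrow> F j k) \<le> (case p of (j, k) \<Rightarrow> norm (coeff_a \<nu> j) * b' k * (1 / x ^ M))"
          unfolding jk by simp
      qed
      also have "\<dots> = (\<Sum>(j, k)\<in>?P. norm (coeff_a \<nu> j) * b' k) * (1 / x ^ M)"
        unfolding sum_distrib_right by (intro sum.cong) auto
      also have "\<dots> \<le> (\<Sum>(j, k)\<in>{..<J} \<times> {..<M}. norm (coeff_a \<nu> j) * b' k) * (1 / x ^ M)"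
        using xp(1)[of M] b'0 by (intro mult_right_mono sum_mono2) auto
      finally have "sqrt (pi / x) * norm (\<Sum>(j, k)\<in>?P. F j k) \<le> sqrt pi * ((\<Sum>(j, k)\<in>{..<J} \<times> {..<M}. norm (coeff_a \<nu> j) * b' k) * (1 / x ^ M))"
        using sq by (intro mult_mono) auto
      then show ?thesis unfolding X3_def norm_mult norm_of_real using xs by (simp add: mult.assoc)
    qed
    have GGb: "norm (GG x (\<alpha> - real J)) \<le> BG"
    proof -
      have "norm (\<Sum>k<M. gcoeff (\<alpha> - real J) (2 * k) * pochhammer (1/2) k / of_real x ^ k) \<le> (\<Sum>k<M. b' k)"
      proof (rule sum_norm_le)
        fix k
        have "norm (gcoeff (\<alpha> - real J) (2 * k) * pochhammer (1/2) k / of_real x ^ k) = norm (gcoeff (\<alpha> - real J) (2 * k) * pochhammer (1/2) k) * (1 / x ^ k)"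
          using xs(3) by (simp add: norm_divide norm_power)
        also have "\<dots> \<le> b' k * 1" using xp[of k] b'0 by (intro mult_mono gb[OF \<gamma>]) (auto simp: divide_le_eq)
        finally show "norm (gcoeff (\<alpha> - real J) (2 * k) * pochhammer (1/2) k / of_real x ^ k) \<le> b' k" by simp
      qed
      then have "sqrt (pi / x) * norm (\<Sum>k<M. gcoeff (\<alpha> - real J) (2 * k) * pochhammer (1/2) k / of_real x ^ k) \<le> BG"
        unfolding BG_def using sq by (intro mult_mono) auto
      then show ?thesis unfolding GG_def norm_mult norm_of_real using xs by simp
    qed
    have Hb: "norm (H x (\<alpha> - real J)) \<le> BG + \<bar>CL\<bar>"
    proof -
      have "\<bar>CL\<bar> * (1 / x ^ M) \<le> \<bar>CL\<bar> * 1" using xp[of M] by (intro mult_left_mono) (auto simp: divide_le_eq)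
      then have "norm (H x (\<alpha> - real J) - GG x (\<alpha> - real J)) \<le> \<bar>CL\<bar>" using HG[of J] by simp
      then show ?thesis using GGb norm_triangle_sub[of "H x (\<alpha> - real J)" "GG x (\<alpha> - real J)"] by linarith
    qed
    have Eo0: "0 \<le> Eo" unfolding Eo_def using Wd by (intro mult_nonneg_nonneg) auto
    have Eo1: "Eo \<le> W / d"
    proof -
      have "0 \<le> (x - x0) * \<delta>\<^sup>2" using xs by (intro mult_nonneg_nonneg) auto
      then have "exp (- (x - x0) * \<delta>\<^sup>2) \<le> 1" unfolding exp_le_one_iff mult_minus_left by linarith
      then show ?thesis unfolding Eo_def using Wd by (intro mult_right_le_one_le) auto
    qed
    \<comment> \<open>The exponentially small tail is turned into an inverse power so as to fit the
      common form of the bound.\<close>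
    have Eo2: "Eo \<le> W / d * KE * (1 / x ^ M)"
    proof -
      have "exp (- (x - x0) * \<delta>\<^sup>2) = exp (x0 * \<delta>\<^sup>2) * exp (- (\<delta>\<^sup>2 * x))" unfolding exp_add[symmetric] by (simp add: algebra_simps)
      also have "\<dots> \<le> exp (x0 * \<delta>\<^sup>2) * ((real M / \<delta>\<^sup>2) ^ M / x ^ M)"
        using \<delta>(1) xs(3) M(1) by (intro mult_left_mono exp_minus_le_inverse_power) auto
      finally have "exp (- (x - x0) * \<delta>\<^sup>2) \<le> KE * (1 / x ^ M)" unfolding KE_def by (simp only: times_divide_eq_right mult_1_right mult.assoc)
      then show ?thesis unfolding Eo_def mult.assoc using Wd by (intro mult_left_mono)
    qed
    have B4: "norm E \<le> (S * (W / d * KE) + norm (stokesC \<nu>) * (C * (BG + \<bar>CL\<bar> + pi + W / d) + C * W)) * (1 / x ^ M)"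
    proof -
      have "(\<Sum>j<J. norm (coeff_a \<nu> j / of_real x ^ j)) * Eo \<le> S * (W / d * KE * (1 / x ^ M))"
        using Sa S0 Eo0 Eo2 unfolding a'_def by (intro mult_mono) auto
      moreover have "norm (stokesC \<nu> / of_real x ^ J) * (C * (norm (H x (\<alpha> - real J)) + pi + Eo) + C * W)
         \<le> norm (stokesC \<nu>) * (1 / x ^ M) * (C * (BG + \<bar>CL\<bar> + pi + W / d) + C * W)"
      proof (rule mult_mono)
        have "norm (stokesC \<nu> / of_real x ^ J) = norm (stokesC \<nu>) * (1 / x ^ J)" using xs(3) by (simp add: norm_divide norm_power)
        also have "\<dots> \<le> norm (stokesC \<nu>) * (1 / x ^ M)" by (intro mult_left_mono inverse_power_le xs M) auto
        finally show "norm (stokesC \<nu> / of_real x ^ J) \<le> norm (stokesC \<nu>) * (1 / x ^ M)" .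
        show "C * (norm (H x (\<alpha> - real J)) + pi + Eo) + C * W \<le> C * (BG + \<bar>CL\<bar> + pi + W / d) + C * W"
          using Hb Eo1 C(1) by (intro add_mono mult_left_mono) auto
        show "0 \<le> C * (norm (H x (\<alpha> - real J)) + pi + Eo) + C * W"
          using C(1) Eo0 W_nonneg by (intro add_nonneg_nonneg mult_nonneg_nonneg) auto
      qed (use xp(1)[of M] in auto)
      ultimately have "norm E \<le> S * (W / d * KE * (1 / x ^ M)) + norm (stokesC \<nu>) * (1 / x ^ M) * (C * (BG + \<bar>CL\<bar> + pi + W / d) + C * W)"
        using E by linarith
      also have "\<dots> = (S * (W / d * KE) + norm (stokesC \<nu>) * (C * (BG + \<bar>CL\<bar> + pi + W / d) + C * W)) * (1 / x ^ M)"
        unfolding distrib_right[of "S * _"] by (simp only: mult_ac)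
      finally show ?thesis .
    qed
    have "norm X1 + norm X2 + norm X3 + norm E \<le> K * (1 / x ^ M)"
      unfolding K_def distrib_right[of _ _ "1 / x ^ M"]
      using add_mono[OF add_mono[OF add_mono[OF B1 B2] B3] B4] unfolding distrib_right[of _ _ "1 / x ^ M"] .
    then have bound: "norm (Z - ((1/2) * (\<Sum>k<M. coeff_a \<nu> k / of_real x ^ k)
              - of_real s * \<i> / of_real (2 * sqrt (pi * x))
                * (\<Sum>j<M. (-1) ^ j * coeff_B \<nu> \<alpha> j / of_real (2 * x) ^ j))) \<le> K / x ^ M"
      unfolding diff using nd by simp
    have fin: "besselK_polar \<nu> x (s * pi) =
        - of_real s * \<i> * of_real (sqrt (pi / (2 * x)) * exp x) * (\<Sum>k<m. (-1) ^ k * coeff_a \<nu> k / of_real x ^ k)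
        + 2 * cos (of_real pi * \<nu>) * of_real (sqrt (pi / (2 * x)) * exp (- x)) * Z"
      unfolding rep Z_def c_def by (simp add: field_simps)
    show "\<exists>Z. norm (Z - ((1/2) * (\<Sum>k<M. coeff_a \<nu> k / of_real x ^ k)
              - of_real s * \<i> / of_real (2 * sqrt (pi * x))
                * (\<Sum>j<M. (-1) ^ j * coeff_B \<nu> (real m - 2 * x) j / of_real (2 * x) ^ j))) \<le> K / x ^ M \<and>
      besselK_polar \<nu> x (s * pi) =
        - of_real s * \<i> * of_real (sqrt (pi / (2 * x)) * exp x) * (\<Sum>k<m. (-1) ^ k * coeff_a \<nu> k / of_real x ^ k)
        + 2 * cos (of_real pi * \<nu>) * of_real (sqrt (pi / (2 * x)) * exp (- x)) * Z"
      using bound fin unfolding \<alpha>_def by blast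
  qed
qed

end

theorem theorem4:
  fixes \<nu> :: complex and M :: nat and m :: "real \<Rightarrow> nat"
  assumes nu: "\<nu> - 1/2 \<notin> \<int>"
    and M: "M > 0"
    and m_pos: "\<And>x. x > 0 \<Longrightarrow> m x > 0"
    and m_opt: "(\<lambda>x. real (m x) - 2 * x) \<in> O[at_top](\<lambda>_. 1)"
  shows "\<forall>s\<in>{1, -1::real}. \<exists>R::real \<Rightarrow> complex.
    R \<in> O[at_top](\<lambda>x. of_real (1 / x ^ M)) \<and>
    (\<forall>x>0.
      besselK_polar \<nu> x (s * pi) =
        - of_real s * \<i> * of_real (sqrt (pi / (2 * x)) * exp x)
          * (\<Sum>k<m x. (-1) ^ k * coeff_a \<nu> k / of_real x ^ k)
        + 2 * cos (of_real pi * \<nu>) * of_real (sqrt (pi / (2 * x)) * exp (- x))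
          * ( (1/2) * (\<Sum>k<M. coeff_a \<nu> k / of_real x ^ k)
              - of_real s * \<i> / of_real (2 * sqrt (pi * x))
                * (\<Sum>j<M. (-1) ^ j * coeff_B \<nu> (real (m x) - 2 * x) j / of_real (2 * x) ^ j)
              + R x))"
proof -
  \<comment> \<open>The zeros of cos (pi \<nu>) are exactly the half-integer orders.\<close>
  have cos: "cos (of_real pi * \<nu>) \<noteq> 0"
  proof
    assume "cos (of_real pi * \<nu>) = 0"
    then obtain n :: int where "of_real pi * \<nu> = of_real (of_int n * pi) + of_real pi / 2"
      using cos_eq_0[of "of_real pi * \<nu>"] by auto
    then have "of_real pi * \<nu> = of_real pi * (of_int n + 1/2)" by (simp add: algebra_simps)
    then have "\<nu> = of_int n + 1/2" by (simp only: mult_cancel_left) simp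
    then have "\<nu> - 1/2 = of_int n" by simp
    then show False using nu by simp
  qed
  from m_opt obtain A where "\<forall>\<^sub>F x in at_top. norm (real (m x) - 2 * x) \<le> A * norm (1 :: real)"
    by (elim landau_o.bigE) auto
  then obtain x2 where x2: "\<And>x. x \<ge> x2 \<Longrightarrow> \<bar>real (m x) - 2 * x\<bar> \<le> A"
    unfolding eventually_at_top_linorder by auto
  have A: "A \<ge> 0" using x2[of x2] by linarith
  \<comment> \<open>J >= M makes the inner remainder O(x^(-M)), and the ceiling secures |Re \<nu>| <
    J + 1/2.\<close>
  define J where "J = max M (nat \<lceil>\<bar>Re \<nu>\<bar>\<rceil>)"
  have J: "M \<le> J" "\<bar>Re \<nu>\<bar> < real J + 1/2"
  proof -
    have "\<bar>Re \<nu>\<bar> \<le> real (nat \<lceil>\<bar>Re \<nu>\<bar>\<rceil>)" by linarith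
    also have "\<dots> \<le> real J" by (simp add: J_def)
    finally show "\<bar>Re \<nu>\<bar> < real J + 1/2" by linarith
  qed (simp add: J_def)
  obtain G :: "complex \<Rightarrow> complex" and T r \<rho> where "saddle G T r \<rho>" using saddle_exists by blast
  then interpret saddle G T r \<rho> .
  obtain a b \<delta> where ab: "1 - r < a" "a < 1" "1 < b" "b < 1 + r" "V a = - \<delta>" "V b = \<delta>" "0 < \<delta>" "\<delta> \<le> \<rho> / 8"
    by (rule interval_exists)
  have "saddle_interval G T r \<rho> a b \<delta>"
    by (intro saddle_interval.intro saddle_axioms saddle_interval_axioms.intro ab)
  \<comment> \<open>|\<alpha> - j| is at most A + J for j <= J, which fixes \<Gamma>; adding 1 gives
    an \<open>x0\<close> with 2 \<open>x0\<close> > \<Gamma>.\<close>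
  then have "saddle_estimates G T r \<rho> a b \<delta> (A + real J) (A + real J + 1) \<nu> J"
    by (rule saddle_estimates.intro) (rule saddle_estimates_axioms.intro, use A J(2) in simp_all)
  then interpret saddle_estimates G T r \<rho> a b \<delta> "A + real J" "A + real J + 1" \<nu> J .
  obtain x1 K where K: "\<And>x m s. x \<ge> x1 \<Longrightarrow> \<bar>real m - 2 * x\<bar> \<le> A \<Longrightarrow> s \<in> {1, -1} \<Longrightarrow>
    \<exists>Z. norm (Z - ((1/2) * (\<Sum>k<M. coeff_a \<nu> k / of_real x ^ k)
              - of_real s * \<i> / of_real (2 * sqrt (pi * x))
                * (\<Sum>j<M. (-1) ^ j * coeff_B \<nu> (real m - 2 * x) j / of_real (2 * x) ^ j))) \<le> K / x ^ M \<and>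
      besselK_polar \<nu> x (s * pi) =
        - of_real s * \<i> * of_real (sqrt (pi / (2 * x)) * exp x) * (\<Sum>k<m. (-1) ^ k * coeff_a \<nu> k / of_real x ^ k)
        + 2 * cos (of_real pi * \<nu>) * of_real (sqrt (pi / (2 * x)) * exp (- x)) * Z"
    by (rule asymptotic_bound[OF M J(1) A order_refl cos], rule that)
  show ?thesis
  proof
    fix s :: real assume s: "s \<in> {1, -1}"
    define D where "D x = - of_real s * \<i> * of_real (sqrt (pi / (2 * x)) * exp x)
      * (\<Sum>k<m x. (-1) ^ k * coeff_a \<nu> k / of_real x ^ k)" for x
    define c where "c x = 2 * cos (of_real pi * \<nu>) * of_real (sqrt (pi / (2 * x)) * exp (- x))" for x
    define Y where "Y x = (1/2) * (\<Sum>k<M. coeff_a \<nu> k / of_real x ^ k)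
      - of_real s * \<i> / of_real (2 * sqrt (pi * x))
        * (\<Sum>j<M. (-1) ^ j * coeff_B \<nu> (real (m x) - 2 * x) j / of_real (2 * x) ^ j)" for x
    \<comment> \<open>Solving for the error makes the identity hold for all x > 0 by construction;
      only the bound on it is restricted to large x.\<close>
    define R where "R x = (besselK_polar \<nu> x (s * pi) - D x) / c x - Y x" for x
    have c: "c x \<noteq> 0" if "x > 0" for x using cos that unfolding c_def by simp
    have eq: "besselK_polar \<nu> x (s * pi) = D x + c x * (Y x + R x)" if "x > 0" for x
      using c[OF that] by (simp add: R_def)
    have bound: "norm (R x) \<le> K * norm (complex_of_real (1 / x ^ M))" if x: "x \<ge> max (max x1 x2) 1" for x
    proof -
      obtain Z where Z: "norm (Z - Y x) \<le> K / x ^ M" "besselK_polar \<nu> x (s * pi) = D x + c x * Z"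
        using K[OF _ x2 s, of x] x unfolding D_def c_def Y_def by auto
      have "R x = Z - Y x" using c[of x] x unfolding R_def Z(2) by simp
      then show ?thesis using Z(1) x by (simp add: norm_divide norm_power)
    qed
    have "R \<in> O[at_top](\<lambda>x. of_real (1 / x ^ M))"
      using bound by (intro bigoI[of _ K] eventually_at_top_linorderI)
    then show "\<exists>R. R \<in> O[at_top](\<lambda>x. of_real (1 / x ^ M)) \<and>
      (\<forall>x>0.
        besselK_polar \<nu> x (s * pi) =
          - of_real s * \<i> * of_real (sqrt (pi / (2 * x)) * exp x)
            * (\<Sum>k<m x. (-1) ^ k * coeff_a \<nu> k / of_real x ^ k)
          + 2 * cos (of_real pi * \<nu>) * of_real (sqrt (pi / (2 * x)) * exp (- x))
            * ( (1/2) * (\<Sum>k<M. coeff_a \<nu> k / of_real x ^ k)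
                - of_real s * \<i> / of_real (2 * sqrt (pi * x))
                  * (\<Sum>j<M. (-1) ^ j * coeff_B \<nu> (real (m x) - 2 * x) j / of_real (2 * x) ^ j)
                + R x))"
      using eq unfolding D_def c_def Y_def by blast
  qed
qed

end
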